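(* There is an absolute constant $C>0$ such that the following holds. Let $x_1,\dots,x_n\in\mathbb{R}^d$, let $\gamma>0$, let each $l_j:\mathbb{R}\to\mathbb{R}$ be convex and twice differentiable, and let $F(w)=\frac1n\sum_{j=1}^n l_j(x_j^Tw)+\frac{\gamma}{2}\|w\|_2^2$ with unique minimizer $w^\star$. Assume the Hessian of $F$ is $L$-Lipschitz: $\|\nabla^2F(w)-\nabla^2F(w')\|_2\le L\|w-w'\|_2$ for all $w,w'\in\mathbb{R}^d$. Let $w_t\in\mathbb{R}^d$ be the current iterate, let $A_t\in\mathbb{R}^{n\times d}$ have $j$-th row $\sqrt{l_j''(x_j^Tw_t)}\,x_j^T$, and let $H_t=\nabla^2F(w_t)=\frac1nA_t^TA_t+\gamma I_d$ and $\kappa_t=\sigma_{\max}(H_t)/\sigma_{\min}(H_t)$. Let $d_{\mathrm{eff}}^\gamma$ and $\mu^\gamma$ be the $\gamma$-effective dimension and the row $\gamma$-ridge coherence of $A_t$. Let $\varepsilon\in(0,\frac14)$, $\delta\in(0,1)$, and let the sub-sample size $s$ satisfy $$ s\ \ge\ C\,\frac{\mu^\gamma d_{\mathrm{eff}}^\gamma}{\varepsilon^2}\log\frac{d_{\mathrm{eff}}^\gamma}{\delta}. $$ Let $w_{t+1}=w_t-\widetilde H_t^{-1}\nabla F(w_t)$ be the Sub-Sampled Newton update with uniform sampling, where $\widetilde H_t=\frac1s\widetilde A_t^T\widetilde A_t+\gamma I_d$ and $\widetilde A_t\in\mathbb{R}^{s\times d}$ consists of $s$ uniformly sampled rows of $A_t$.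 Then, with probability at least $1-\delta$ over the sampling, $$ \|w_{t+1}-w^\star\|_2\ \le\ \varepsilon\sqrt{\kappa_t}\,\|w_t-w^\star\|_2+\frac{L}{\sigma_{\min}(H_t)}\|w_t-w^\star\|_2^2 . $$
   Context: For $A=[a_1^T;\dots;a_n^T]\in\mathbb{R}^{n\times d}$ and $\gamma\ge0$, the row $\gamma$-ridge leverage scores are $l_j^\gamma=a_j^T(A^TA+n\gamma I_d)^\dagger a_j$, $j=1,\dots,n$. The $\gamma$-effective dimension is $d_{\mathrm{eff}}^\gamma(A)=\sum_{j=1}^n l_j^\gamma=\sum_{k=1}^d\frac{\sigma_k^2}{\sigma_k^2+n\gamma}$, where $\sigma_1,\dots,\sigma_d$ are the singular values of $A$. The row $\gamma$-ridge coherence is $\mu^\gamma(A)=\frac{n}{d_{\mathrm{eff}}^\gamma}\max_{i}l_i^\gamma$. Uniform sampling: $s$ row indices are drawn independently and uniformly from $\{1,\dots,n\}$; $\widetilde A_t$ consists of the corresponding rows of $A_t$. The iterate $w_t$ is regarded as given (the probability is over the sampling used in this step). $\sigma_{\max},\sigma_{\min}$ denote largest and smallest singular values.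
   Formalization: In the sample-size condition the logarithm log(d_eff/δ) is replaced by max(1, log(d_eff/δ)); without this the claim fails when d_eff ≤ δ, since the condition then places no constraint on s. *)

theory Defs
  imports
    "HOL-Probability.Product_PMF"
    "Jordan_Normal_Form.Gauss_Jordan_Elimination"
    "Jordan_Normal_Form.Spectral_Radius"
begin

text \<open>
  The constant of the sampling theorem must not depend on the dimension, so vectors and matrices
  are those of \<^theory>\<open>Jordan_Normal_Form.Matrix\<close>, whose dimensions are ordinary natural numbers.
  Rows and coordinates are numbered from 0.
\<close>

no_notation inner (infix "\<bullet>" 70)
no_notation Finite_Cartesian_Product.vec_nth (infixl "$" 90)
hide_const (open) Finite_Cartesian_Product.vec Finite_Cartesian_Product.mat
  Finite_Cartesian_Product.row Finite_Cartesian_Product.transpose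

definition vnorm :: "real vec \<Rightarrow> real" where
  "vnorm v = sqrt (v \<bullet> v)"

definition spec_norm :: "real mat \<Rightarrow> real" where
  "spec_norm M = Sup {vnorm (M *\<^sub>v v) | v. v \<in> carrier_vec (dim_col M) \<and> vnorm v \<le> 1}"

text \<open>A matrix with \<open>d\<close> columns has \<open>d\<close> singular values, zeros included: the square roots of the
  eigenvalues of its Gram matrix.\<close>

definition sing_vals :: "real mat \<Rightarrow> real set" where
  "sing_vals M = sqrt ` spectrum (M\<^sup>T * M)"

definition sigma_max :: "real mat \<Rightarrow> real" where
  "sigma_max M = Max (sing_vals M)"

definition sigma_min :: "real mat \<Rightarrow> real" where
  "sigma_min M = Min (sing_vals M)"

definition cond_num :: "real mat \<Rightarrow> real" where
  "cond_num M = sigma_max M / sigma_min M"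

text \<open>The Moore-Penrose inverse, by the four Penrose equations.\<close>

definition is_pinv :: "real mat \<Rightarrow> real mat \<Rightarrow> bool" where
  "is_pinv M X \<longleftrightarrow> X \<in> carrier_mat (dim_col M) (dim_row M) \<and>
     M * X * M = M \<and> X * M * X = X \<and> (M * X)\<^sup>T = M * X \<and> (X * M)\<^sup>T = X * M"

definition pinv :: "real mat \<Rightarrow> real mat" where
  "pinv M = (THE X. is_pinv M X)"

definition ridge_leverage :: "real \<Rightarrow> real mat \<Rightarrow> nat \<Rightarrow> real" where
  "ridge_leverage \<gamma> A j =
     row A j \<bullet> (pinv (A\<^sup>T * A + (real (dim_row A) * \<gamma>) \<cdot>\<^sub>m 1\<^sub>m (dim_col A)) *\<^sub>v row A j)"

definition eff_dim :: "real \<Rightarrow> real mat \<Rightarrow> real" where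
  "eff_dim \<gamma> A = (\<Sum>j<dim_row A. ridge_leverage \<gamma> A j)"

definition ridge_coherence :: "real \<Rightarrow> real mat \<Rightarrow> real" where
  "ridge_coherence \<gamma> A =
     real (dim_row A) / eff_dim \<gamma> A * Max (ridge_leverage \<gamma> A ` {..<dim_row A})"

definition partial_deriv :: "nat \<Rightarrow> (real vec \<Rightarrow> real) \<Rightarrow> real vec \<Rightarrow> real" where
  "partial_deriv i f w = deriv (\<lambda>t. f (w + t \<cdot>\<^sub>v unit_vec (dim_vec w) i)) 0"

definition gradient :: "(real vec \<Rightarrow> real) \<Rightarrow> real vec \<Rightarrow> real vec" where
  "gradient f w = vec (dim_vec w) (\<lambda>i. partial_deriv i f w)"

definition hessian :: "(real vec \<Rightarrow> real) \<Rightarrow> real vec \<Rightarrow> real mat" where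
  "hessian f w = mat (dim_vec w) (dim_vec w) (\<lambda>(i, j). partial_deriv i (partial_deriv j f) w)"

definition objective ::
    "nat \<Rightarrow> real \<Rightarrow> (nat \<Rightarrow> real \<Rightarrow> real) \<Rightarrow> (nat \<Rightarrow> real vec) \<Rightarrow> real vec \<Rightarrow> real" where
  "objective n \<gamma> l x w = 1 / real n * (\<Sum>j<n. l j (x j \<bullet> w)) + \<gamma> / 2 * (vnorm w)\<^sup>2"

definition scaled_data ::
    "nat \<Rightarrow> nat \<Rightarrow> (nat \<Rightarrow> real \<Rightarrow> real) \<Rightarrow> (nat \<Rightarrow> real vec) \<Rightarrow> real vec \<Rightarrow> real mat" where
  "scaled_data n d l x w =
     mat n d (\<lambda>(j, k). sqrt (deriv (deriv (l j)) (x j \<bullet> w)) * x j $ k)"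

definition sampled_rows :: "real mat \<Rightarrow> nat \<Rightarrow> (nat \<Rightarrow> nat) \<Rightarrow> real mat" where
  "sampled_rows A s \<phi> = mat s (dim_col A) (\<lambda>(k, i). A $$ (\<phi> k, i))"

definition subsampled_hessian :: "real \<Rightarrow> real mat \<Rightarrow> nat \<Rightarrow> (nat \<Rightarrow> nat) \<Rightarrow> real mat" where
  "subsampled_hessian \<gamma> A s \<phi> =
     (1 / real s) \<cdot>\<^sub>m ((sampled_rows A s \<phi>)\<^sup>T * sampled_rows A s \<phi>) + \<gamma> \<cdot>\<^sub>m 1\<^sub>m (dim_col A)"

text \<open>With \<open>\<gamma> > 0\<close> the sub-sampled Hessian is always invertible, so \<^const>\<open>mat_inverse\<close> returns
  the inverse.\<close>

definition subsampled_newton_step ::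
    "real \<Rightarrow> (real vec \<Rightarrow> real) \<Rightarrow> real mat \<Rightarrow> nat \<Rightarrow> (nat \<Rightarrow> nat) \<Rightarrow> real vec \<Rightarrow> real vec" where
  "subsampled_newton_step \<gamma> F A s \<phi> w =
     w - the (mat_inverse (subsampled_hessian \<gamma> A s \<phi>)) *\<^sub>v gradient F w"

text \<open>\<open>s\<close> independent uniform draws from \<open>{..<n}\<close>; the functions are 0 outside \<open>{..<s}\<close>.\<close>

definition uniform_sampling :: "nat \<Rightarrow> nat \<Rightarrow> (nat \<Rightarrow> nat) pmf" where
  "uniform_sampling n s = Pi_pmf {..<s} 0 (\<lambda>_. pmf_of_set {..<n})"

text \<open>
  The logarithm in the sample-size condition is taken as \<open>max 1 (ln (eff_dim \<gamma> A / \<delta>))\<close>. For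
  \<open>eff_dim \<gamma> A \<ge> exp 1 * \<delta>\<close> this is the logarithm itself; for \<open>eff_dim \<gamma> A \<le> \<delta>\<close> the logarithm is
  not positive, so the untruncated condition would place no constraint on \<open>s\<close> and the
  conclusion would fail.
\<close>

end

theory Submission
  imports Defs
begin

text \<open>
  Write \<open>H = P\<^sup>2\<close> with \<open>P = H\<^sup>1\<^sup>/\<^sup>2\<close> and let \<open>b\<^sub>j = P\<^sup>-\<^sup>1 a\<^sub>j\<close> be the whitened rows. Then
  \<open>|b\<^sub>j|\<^sup>2\<close> is \<open>n\<close> times the leverage score, \<open>S = 1/n \<Sum> b\<^sub>j b\<^sub>j\<^sup>T\<close> has trace \<open>d\<^sub>e\<^sub>f\<^sub>f\<close> and \<open>1 - S = \<gamma> H\<^sup>-\<^sup>1\<close>,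
  and the sub-sampled Hessian is \<open>P (1 + E) P\<close>, where \<open>E\<close> is the deviation of the sample mean of
  the \<open>b\<^sub>j b\<^sub>j\<^sup>T\<close> from \<open>S\<close>. If \<open>E\<close> has norm at most \<open>\<epsilon>/2\<close>, the classical Newton error estimate gives
  the claim.

  The norm of \<open>E\<close> is controlled by an intrinsic-dimension form of the Ahlswede-Winter method. For a sum
  \<open>Y\<close> of centred independent terms, \<open>tr e\<^sup>Y - tr 1 = tr (e\<^sup>Y - 1 - Y)\<close> in expectation, and
  \<open>e\<^sup>Y - 1 - Y\<close> is positive, so that \<open>S \<le> 1\<close> gives \<open>tr (e\<^sup>Y S) \<le> tr S + tr e\<^sup>Y - tr 1\<close> in expectation.
  Together with the Golden-Thompson inequality this makes the expectation of \<open>tr S + tr e\<^sup>Y - tr 1\<close>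
  grow by at most a fixed factor \<open>1 + O(\<tau>\<^sup>2 M)\<close> with each new term (\<open>\<tau>\<close> the scaling of the terms, \<open>M\<close> a bound
  on \<open>|b\<^sub>j|\<^sup>2\<close>), and it starts at \<open>tr S\<close> rather than at the dimension. To avoid the matrix
  exponential, \<open>e\<^sup>Y\<close> is replaced by \<open>(1 + Y/N)\<^sup>N\<close> with \<open>N\<close> a power of two, and \<open>N \<rightarrow> \<infinity>\<close> at the end.
\<close>

section \<open>Tracial algebras with involution\<close>

text \<open>The obstacle is that no bound may depend on the dimension, while every crude trace
  estimate produces \<open>tr 1 = d\<close>. For powers of two, the trace inequality behind
  Golden-Thompson needs only Cauchy-Schwarz and cyclicity, by repeated doubling of the exponent.
  Hence an abstract algebra with involution and trace is enough; eigenvectors enter through a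
  projection of trace 1, which turns a large eigenvalue into a large trace. Origin of 256: with
  \<open>K = \<epsilon>\<^sup>2 * s / M\<close> and \<open>\<tau> = \<epsilon> / (8 * M)\<close> the
  moment grows like \<open>exp (3 * K / 64)\<close>, while a deviation \<epsilon>/2 sits at the
  threshold \<open>K / 16 = 4 * K / 64\<close>. The surplus \<open>K / 64\<close> has to pay for
  \<open>ln (D / \<delta>)\<close>, where \<open>D\<close> is the effective dimension, and for a
  factor 8, so for \<open>3 + ln (D / \<delta>)\<close>, at most 4 truncated logarithms; and 4 * 64
  = 256. The deviation is \<epsilon>/2, not \<epsilon>, to pay for the denominators
  \<open>1 - \<epsilon> / 2\<close> of the Newton estimate.\<close>

locale tracial_star_algebra =
  fixes star :: "'a::real_algebra_1 \<Rightarrow> 'a" and tr :: "'a \<Rightarrow> real"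
  assumes star_add: "star (x + y) = star x + star y"
    and star_scaleR: "star (c *\<^sub>R x) = c *\<^sub>R star x"
    and star_mult: "star (x * y) = star y * star x"
    and star_star [simp]: "star (star x) = x"
    and tr_add: "tr (x + y) = tr x + tr y"
    and tr_scaleR: "tr (c *\<^sub>R x) = c * tr x"
    and tr_commute: "tr (x * y) = tr (y * x)"
    and tr_star: "tr (star x) = tr x"
    and tr_nonneg: "0 \<le> tr (x * star x)"
begin

lemma star_one [simp]: "star 1 = 1"
  by (metis mult.right_neutral star_mult star_star mult_1)

lemma star_zero [simp]: "star 0 = 0"
  using star_scaleR[of 0 0] by simp

lemma star_minus: "star (- x) = - star x"
  using star_scaleR[of "-1" x] by simp

lemma star_diff: "star (x - y) = star x - star y"
  using star_add[of x "- y"] by (simp add: star_minus)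

lemma star_sum: "star (\<Sum>i\<in>I. f i) = (\<Sum>i\<in>I. star (f i))"
  by (induction I rule: infinite_finite_induct) (simp_all add: star_add)

lemma star_power: "star (x ^ n) = star x ^ n"
  by (induction n) (simp_all add: star_mult power_commutes)

lemma tr_zero [simp]: "tr 0 = 0"
  using tr_scaleR[of 0 0] by simp

lemma tr_minus: "tr (- x) = - tr x"
  using tr_scaleR[of "-1" x] by simp

lemma tr_diff: "tr (x - y) = tr x - tr y"
  using tr_add[of x "- y"] by (simp add: tr_minus)

lemma tr_sum: "tr (\<Sum>i\<in>I. f i) = (\<Sum>i\<in>I. tr (f i))"
  by (induction I rule: infinite_finite_induct) (simp_all add: tr_add)

lemma tr_star_mult_nonneg: "0 \<le> tr (star x * x)"
  using tr_nonneg[of "star x"] by simp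

lemma tr_square_nonneg: "star x = x \<Longrightarrow> 0 \<le> tr (x * x)"
  using tr_nonneg[of x] by simp

section \<open>Hilbert-Schmidt seminorm and Cauchy-Schwarz\<close>

definition hs_norm :: "'a \<Rightarrow> real" where
  "hs_norm x = sqrt (tr (x * star x))"

lemma hs_norm_nonneg [simp]: "0 \<le> hs_norm x"
  by (simp add: hs_norm_def tr_nonneg)

lemma hs_norm_sq: "(hs_norm x)\<^sup>2 = tr (x * star x)"
  by (simp add: hs_norm_def tr_nonneg)

lemma hs_norm_star: "hs_norm (star x) = hs_norm x"
  by (simp add: hs_norm_def tr_commute)

lemma hs_norm_scaleR: "hs_norm (c *\<^sub>R x) = \<bar>c\<bar> * hs_norm x"
proof -
  have "tr ((c *\<^sub>R x) * star (c *\<^sub>R x)) = c\<^sup>2 * tr (x * star x)"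
    by (simp add: star_scaleR tr_scaleR power2_eq_square)
  then show ?thesis by (simp add: hs_norm_def real_sqrt_mult)
qed

lemma tr_mult_star_commute: "tr (x * star y) = tr (y * star x)"
  using tr_star[of "x * star y"] by (simp add: star_mult)

lemma hs_norm_add_sq:
  "(hs_norm (x + c *\<^sub>R y))\<^sup>2 = (hs_norm x)\<^sup>2 + 2 * c * tr (x * star y) + c\<^sup>2 * (hs_norm y)\<^sup>2"
  unfolding hs_norm_sq
  by (simp add: star_add star_scaleR distrib_left distrib_right tr_add tr_scaleR
      tr_mult_star_commute[of y x] power2_eq_square)

lemma tr_cauchy_schwarz: "\<bar>tr (x * star y)\<bar> \<le> hs_norm x * hs_norm y"
proof -
  define a b t where "a = (hs_norm x)\<^sup>2" and "b = (hs_norm y)\<^sup>2" and "t = tr (x * star y)"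
  have q: "0 \<le> a + 2 * c * t + c\<^sup>2 * b" for c
    using hs_norm_add_sq[of x c y] unfolding a_def b_def t_def by (metis zero_le_power2)
  have b: "0 \<le> b" by (simp add: b_def)
  have "t\<^sup>2 \<le> a * b"
  \<comment> \<open>The trace need not be faithful, so \<open>b = 0\<close> does not make
    \<open>y\<close> zero. In that case the quadratic \<open>q\<close> is affine in \<open>c\<close>
    and bounded below, which forces its slope to vanish; otherwise it is evaluated at its minimum
    \<open>- t / b\<close>.\<close>
  proof (cases "b = 0")
    case True
    have "t = 0"
    proof (rule ccontr)
      assume "t \<noteq> 0"
      then have "a + 2 * (- (a + 1) / (2 * t)) * t = - 1" by (simp add: field_simps)
      with q[of "- (a + 1) / (2 * t)"] True show False by simp
    qed
    then show ?thesis by (simp add: True)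
  next
    case False
    have "a + 2 * (- t / b) * t + (- t / b)\<^sup>2 * b = a - t\<^sup>2 / b"
      using False by (simp add: field_simps power2_eq_square)
    with q[of "- t / b"] have "t\<^sup>2 / b \<le> a" by simp
    with False b show ?thesis by (simp add: field_simps)
  qed
  then have "\<bar>t\<bar>\<^sup>2 \<le> (hs_norm x * hs_norm y)\<^sup>2"
    by (simp add: a_def b_def power_mult_distrib)
  then show ?thesis unfolding t_def
    by (rule power2_le_imp_le) simp
qed

lemma tr_cauchy_schwarz': "\<bar>tr (x * y)\<bar> \<le> hs_norm x * hs_norm y"
  using tr_cauchy_schwarz[of x "star y"] by (simp add: hs_norm_star)

lemma hs_norm_triangle: "hs_norm (x + y) \<le> hs_norm x + hs_norm y"
proof -
  have "(hs_norm (x + y))\<^sup>2 \<le> (hs_norm x + hs_norm y)\<^sup>2"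
    using hs_norm_add_sq[of x 1 y] tr_cauchy_schwarz[of x y]
    by (simp add: power2_sum)
  then show ?thesis by (rule power2_le_imp_le) simp
qed

section \<open>Trace inequalities for powers of products\<close>

lemma power_mult_cycle: "tr ((x * y) ^ m) = tr ((y * x) ^ m)"
proof (cases m)
  case (Suc k)
  have "(x * y) ^ Suc k = x * ((y * x) ^ k * y)"
    by (induction k) (simp_all add: mult.assoc)
  then have "tr ((x * y) ^ Suc k) = tr ((y * x) ^ k * y * x)"
    by (simp add: tr_commute[of x])
  then show ?thesis by (simp add: Suc mult.assoc flip: power_Suc2)
qed simp

text \<open>The two inequalities are proved together because each one at exponent
  \<open>2 * k\<close> uses both at exponent \<open>k\<close>: the first removes non-normality, the
  second separates the self-adjoint factors that remain after cycling. The base case of both is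
  Cauchy-Schwarz.\<close>

lemma tr_holder_pair:
  assumes m: "m = 2 ^ j"
  shows "\<bar>tr (x ^ (2 * m))\<bar> \<le> tr ((x * star x) ^ m)"
    and "star p = p \<Longrightarrow> star q = q \<Longrightarrow>
      \<bar>tr ((p * q) ^ m)\<bar> \<le> sqrt (tr (p ^ (2 * m))) * sqrt (tr (q ^ (2 * m)))"
  using m
proof (induction j arbitrary: m x p q)
  case 0
  {
    case 1
    have "\<bar>tr (x * x)\<bar> \<le> hs_norm x * hs_norm x" by (rule tr_cauchy_schwarz')
    also have "\<dots> = tr (x * star x)" using hs_norm_sq[of x] by (simp add: power2_eq_square)
    finally show ?case using 1 by (simp add: power2_eq_square)
  next
    case 2
    then show ?case
      using tr_cauchy_schwarz'[of p q] by (simp add: hs_norm_def power2_eq_square)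
  }
next
  case (Suc j)
  define k :: nat where "k = 2 ^ j"
  {
    case 1
    have m: "m = 2 * k" using 1 by (simp add: k_def)
    let ?p = "x * star x" and ?q = "star x * x"
    have sp: "star ?p = ?p" and sq: "star ?q = ?q" by (simp_all add: star_mult)
    have "\<bar>tr (x ^ (2 * m))\<bar> = \<bar>tr ((x * x) ^ (2 * k))\<bar>"
      by (simp only: m power_mult[of x 2 "2 * k"] power2_eq_square)
    also have "\<dots> \<le> tr ((x * x * star (x * x)) ^ k)"
      using Suc.IH(1) k_def by blast
    also have "(x * x * star (x * x)) = x * (?p * star x)"
      by (simp add: star_mult mult.assoc)
    also have "tr ((x * (?p * star x)) ^ k) = tr ((?p * ?q) ^ k)"
      by (simp add: power_mult_cycle[of x] mult.assoc)
    also have "\<dots> \<le> sqrt (tr (?p ^ (2 * k))) * sqrt (tr (?q ^ (2 * k)))"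
      using Suc.IH(2)[OF sp sq k_def] by linarith
    \<comment> \<open>The two square roots recombine because \<open>x * star x\<close> and
      \<open>star x * x\<close> have equal traces of powers.\<close>
    also have "tr (?q ^ (2 * k)) = tr (?p ^ (2 * k))"
      by (rule power_mult_cycle)
    also have "sqrt (tr (?p ^ (2 * k))) * sqrt (tr (?p ^ (2 * k))) = tr (?p ^ m)"
    proof -
      have "0 \<le> tr (?p ^ k * ?p ^ k)"
        by (rule tr_square_nonneg) (simp add: star_power star_mult)
      then show ?thesis by (simp add: m mult_2 power_add)
    qed
    finally show ?case .
  next
    case 2
    have m: "m = 2 * k" using 2 by (simp add: k_def)
    have sp: "star (p * p) = p * p" and sq: "star (q * q) = q * q"
      using 2 by (simp_all add: star_mult)
    have "\<bar>tr ((p * q) ^ m)\<bar> \<le> tr ((p * q * star (p * q)) ^ k)"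
      unfolding m using Suc.IH(1) k_def by blast
    also have "(p * q * star (p * q)) = p * (q * q * p)"
      by (simp add: star_mult 2 mult.assoc)
    also have "tr ((p * (q * q * p)) ^ k) = tr ((p * p * (q * q)) ^ k)"
      using power_mult_cycle[of p "q * q * p" k] power_mult_cycle[of "q * q" "p * p" k]
    by (simp add: mult.assoc)
    also have "\<dots> \<le> sqrt (tr ((p * p) ^ (2 * k))) * sqrt (tr ((q * q) ^ (2 * k)))"
      using Suc.IH(2)[OF sp sq k_def] by linarith
    finally show ?case
      unfolding m
      by (simp only: power_mult[of p 2 "2 * k"] power_mult[of q 2 "2 * k"] power2_eq_square)
  }
qed

text \<open>A Lieb-Thirring type inequality, the finite-power core of Golden-Thompson. Halving the
  exponent replaces \<open>p\<close> and \<open>q\<close> by their squares, with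
  \<open>tr_holder_pair\<close> supplying the inequality and cyclicity the regrouping.\<close>

lemma tr_power_mult_le:
  assumes "m = 2 ^ j" "star p = p" "star q = q"
  shows "tr ((p * q) ^ m) \<le> tr (p ^ m * q ^ m)"
  using assms
proof (induction j arbitrary: m p q)
  case (Suc j)
  define k :: nat where "k = 2 ^ j"
  have m: "m = 2 * k" using Suc by (simp add: k_def)
  have "tr ((p * q) ^ m) \<le> tr ((p * q * star (p * q)) ^ k)"
    unfolding m using tr_holder_pair(1)[OF k_def, of "p * q"] by linarith
  also have "(p * q * star (p * q)) = p * (q * q * p)"
    by (simp add: star_mult Suc.prems mult.assoc)
  also have "tr ((p * (q * q * p)) ^ k) = tr ((p * p * (q * q)) ^ k)"
    using power_mult_cycle[of p "q * q * p" k] power_mult_cycle[of "q * q" "p * p" k]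
    by (simp add: mult.assoc)
  also have "\<dots> \<le> tr ((p * p) ^ k * (q * q) ^ k)"
    using Suc.IH[OF k_def, of "p * p" "q * q"] Suc.prems by (simp add: star_mult)
  finally show ?case
    by (simp add: m power_mult power2_eq_square)
qed simp

text \<open>Stands in for the operator norm: for matrices, the norm of left multiplication on
  Hilbert-Schmidt space is the spectral norm. A relation with an explicit bound avoids any
  supremum.\<close>

definition op_bounded :: "'a \<Rightarrow> real \<Rightarrow> bool" where
  "op_bounded x c \<longleftrightarrow> 0 \<le> c \<and> (\<forall>y. hs_norm (x * y) \<le> c * hs_norm y)"

lemma op_bounded_mono: "op_bounded x c \<Longrightarrow> c \<le> c' \<Longrightarrow> op_bounded x c'"
  unfolding op_bounded_def by (meson hs_norm_nonneg mult_right_mono order_trans)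

lemma op_bounded_one: "op_bounded 1 1"
  by (simp add: op_bounded_def)

lemma op_bounded_zero: "op_bounded 0 0"
  by (simp add: op_bounded_def hs_norm_def)

lemma op_bounded_add: "op_bounded x c \<Longrightarrow> op_bounded y c' \<Longrightarrow> op_bounded (x + y) (c + c')"
  unfolding op_bounded_def
  by (auto simp: distrib_right intro!: order_trans[OF hs_norm_triangle] add_mono)

lemma op_bounded_scaleR: "op_bounded x c \<Longrightarrow> op_bounded (t *\<^sub>R x) (\<bar>t\<bar> * c)"
  unfolding op_bounded_def
  by (auto simp: hs_norm_scaleR mult.assoc intro!: mult_left_mono)

lemma op_bounded_diff: "op_bounded x c \<Longrightarrow> op_bounded y c' \<Longrightarrow> op_bounded (x - y) (c + c')"
  using op_bounded_add[of x c "(-1) *\<^sub>R y" c'] op_bounded_scaleR[of y c' "-1"] by simp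

lemma op_bounded_mult:
  assumes "op_bounded x c" "op_bounded y c'"
  shows "op_bounded (x * y) (c * c')"
  unfolding op_bounded_def
proof (intro conjI allI)
  show "0 \<le> c * c'" using assms by (simp add: op_bounded_def)
  fix z
  have "hs_norm (x * (y * z)) \<le> c * hs_norm (y * z)" using assms by (simp add: op_bounded_def)
  also have "\<dots> \<le> c * (c' * hs_norm z)"
    using assms by (intro mult_left_mono) (auto simp: op_bounded_def)
  finally show "hs_norm (x * y * z) \<le> c * c' * hs_norm z" by (simp add: mult.assoc)
qed

lemma op_bounded_power: "op_bounded x c \<Longrightarrow> op_bounded (x ^ k) (c ^ k)"
  by (induction k) (simp_all add: op_bounded_one op_bounded_mult)

lemma op_bounded_sum:
  "(\<And>i. i \<in> I \<Longrightarrow> op_bounded (f i) (c i)) \<Longrightarrow> op_bounded (\<Sum>i\<in>I. f i) (\<Sum>i\<in>I. c i)"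
  by (induction I rule: infinite_finite_induct) (simp_all add: op_bounded_zero op_bounded_add)

text \<open>Telescoping \<open>x * (x ^ k - y ^ k) + (x - y) * y ^ k\<close>. Since
  \<open>1 \<le> c\<close>, the exponent of \<open>c\<close> may be kept at \<open>k\<close> instead
  of \<open>k - 1\<close>, which makes the induction uniform.\<close>

lemma op_bounded_power_diff:
  assumes "op_bounded x c" "op_bounded y c" "op_bounded (x - y) e" "1 \<le> c"
  shows "op_bounded (x ^ k - y ^ k) (real k * e * c ^ k)"
proof (induction k)
  case 0
  then show ?case by (simp add: op_bounded_zero)
next
  case (Suc k)
  have e: "0 \<le> e" using assms(3) by (simp add: op_bounded_def)
  have "x ^ Suc k - y ^ Suc k = x * (x ^ k - y ^ k) + (x - y) * y ^ k"
    by (simp add: algebra_simps)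
  moreover have "op_bounded \<dots> (c * (real k * e * c ^ k) + e * c ^ k)"
    by (intro op_bounded_add op_bounded_mult op_bounded_power assms Suc)
  moreover have "c * (real k * e * c ^ k) + e * c ^ k \<le> real (Suc k) * e * c ^ Suc k"
    using assms(4) e mult_right_mono[of 1 c "e * c ^ k"] by (simp add: algebra_simps)
  ultimately show ?case using op_bounded_mono by metis
qed

text \<open>The place where the dimension enters, as \<open>tr 1\<close>; it is applied only to an
  error that tends to 0 with \<open>N\<close>.\<close>

lemma tr_bounded:
  assumes "op_bounded x c"
  shows "\<bar>tr x\<bar> \<le> c * tr 1"
proof -
  have "\<bar>tr x\<bar> \<le> hs_norm (x * 1) * hs_norm 1"
    using tr_cauchy_schwarz[of x 1] by simp
  also have "\<dots> \<le> c * hs_norm 1 * hs_norm 1"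
    using assms unfolding op_bounded_def by (intro mult_right_mono) (blast, simp)
  also have "\<dots> = c * tr 1"
    using hs_norm_sq[of 1] by (simp add: power2_eq_square mult.assoc)
  finally show ?thesis .
qed

lemma tr_one_nonneg: "0 \<le> tr 1"
  using tr_nonneg[of 1] by simp

text \<open>Positivity of the quadratic form, tested by conjugation since there are no vectors at
  this level. Self-adjointness is not included and is assumed separately where powers are
  taken.\<close>

definition psd :: "'a \<Rightarrow> bool" where
  "psd x \<longleftrightarrow> (\<forall>y. 0 \<le> tr (star y * x * y))"

lemma psd_add: "psd x \<Longrightarrow> psd y \<Longrightarrow> psd (x + y)"
  by (simp add: psd_def distrib_left distrib_right tr_add)

lemma psd_zero: "psd 0"
  by (simp add: psd_def)

lemma psd_sum: "(\<And>i. i \<in> I \<Longrightarrow> psd (f i)) \<Longrightarrow> psd (\<Sum>i\<in>I. f i)"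
  by (induction I rule: infinite_finite_induct) (simp_all add: psd_zero psd_add)

lemma psd_conj: "psd x \<Longrightarrow> psd (star z * x * z)"
  unfolding psd_def
proof
  fix y
  assume "\<forall>y. 0 \<le> tr (star y * x * y)"
  then have "0 \<le> tr (star (z * y) * x * (z * y))" by blast
  then show "0 \<le> tr (star y * (star z * x * z) * y)" by (simp add: star_mult mult.assoc)
qed

lemma psd_one: "psd 1"
  by (simp add: psd_def tr_star_mult_nonneg)

lemma psd_one_add:
  assumes "op_bounded z 1"
  shows "psd (1 + z)"
  unfolding psd_def
proof
  fix y
  have "\<bar>tr (z * y * star y)\<bar> \<le> hs_norm (z * y) * hs_norm y" by (rule tr_cauchy_schwarz)
  also have "\<dots> \<le> hs_norm y * hs_norm y"
    using assms by (intro mult_right_mono) (auto simp: op_bounded_def)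
  also have "\<dots> = tr (y * star y)" using hs_norm_sq[of y] by (simp add: power2_eq_square)
  finally have "0 \<le> tr ((1 + z) * y * star y)" by (simp add: distrib_right tr_add)
  then show "0 \<le> tr (star y * (1 + z) * y)"
    by (simp add: mult.assoc tr_commute[of "star y"])
qed

text \<open>Even powers are squares of self-adjoint elements and odd ones are \<open>g\<close>
  conjugated by \<open>g ^ i\<close>, so no square root of \<open>g\<close> has to exist.\<close>

lemma psd_power:
  assumes "psd g" "star g = g"
  shows "psd (g ^ k)"
proof -
  have s: "star (g ^ i) = g ^ i" for i using assms by (simp add: star_power)
  show ?thesis
  proof (cases "even k")
    case True
    then obtain i where "k = i + i" by (auto elim!: evenE simp: mult_2)
    then show ?thesis using psd_conj[OF psd_one, of "g ^ i"] by (simp add: s power_add)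
  next
    case False
    then obtain i where "k = i + 1 + i" by (auto elim!: oddE simp: mult_2)
    then show ?thesis using psd_conj[OF assms(1), of "g ^ i"] 
      by (simp add: s power_add power_commutes mult.assoc)
  qed
qed

end

section \<open>Sums of independent uniform samples\<close>

lemma finite_set_uniform_sampling: "0 < n \<Longrightarrow> finite (set_pmf (uniform_sampling n s))"
  unfolding uniform_sampling_def
  by (subst set_Pi_pmf) (auto intro!: finite_PiE_dflt simp: lessThan_empty_iff)

lemma uniform_sampling_lt:
  assumes "0 < n" "\<phi> \<in> set_pmf (uniform_sampling n s)" "k < s"
  shows "\<phi> k < n"
  using assms by (auto simp: uniform_sampling_def set_Pi_pmf PiE_dflt_def lessThan_empty_iff)

definition uavg :: "nat \<Rightarrow> nat \<Rightarrow> ((nat \<Rightarrow> nat) \<Rightarrow> real) \<Rightarrow> real" where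
  "uavg n s G = measure_pmf.expectation (uniform_sampling n s) G"

lemma uavg_0: "uavg n 0 G = G (\<lambda>_. 0)"
  by (simp add: uavg_def uniform_sampling_def)

text \<open>The draw with index \<open>k\<close> is independent of the earlier ones, so it can be
  averaged with those frozen. Both inductions over the number of draws rest on this
  recursion.\<close>

lemma uavg_Suc:
  assumes n: "0 < n"
  shows "uavg n (Suc k) G = uavg n k (\<lambda>\<phi>. 1 / real n * (\<Sum>j<n. G (\<phi>(k := j))))"
proof -
  have ne: "{..<n} \<noteq> {}" using n by auto
  let ?U = "pmf_of_set {..<n}"
  have "uniform_sampling n (Suc k) =
      map_pmf (\<lambda>(y, f). f(k := y)) (pair_pmf ?U (uniform_sampling n k))"
    by (simp add: uniform_sampling_def lessThan_Suc Pi_pmf_insert)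
  also have "\<dots> = uniform_sampling n k \<bind> (\<lambda>f. map_pmf (\<lambda>y. f(k := y)) ?U)"
    by (simp add: pair_pmf_def map_pmf_def bind_assoc_pmf bind_return_pmf
        bind_commute_pmf[of ?U])
  finally have "uavg n (Suc k) G =
      (\<Sum>f\<in>set_pmf (uniform_sampling n k). pmf (uniform_sampling n k) f *\<^sub>R
        measure_pmf.expectation (map_pmf (\<lambda>y. f(k := y)) ?U) G)"
    using ne finite_set_uniform_sampling[OF n]
    by (simp add: uavg_def pmf_expectation_bind[of "set_pmf (uniform_sampling n k)"])
  also have "\<dots> = (\<Sum>f\<in>set_pmf (uniform_sampling n k). pmf (uniform_sampling n k) f *\<^sub>R
        (1 / real n * (\<Sum>j<n. G (f(k := j)))))"
    using ne by (intro sum.cong) (simp_all add: integral_pmf_of_set)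
  also have "\<dots> = uavg n k (\<lambda>\<phi>. 1 / real n * (\<Sum>j<n. G (\<phi>(k := j))))"
    unfolding uavg_def
    by (subst integral_measure_pmf[OF finite_set_uniform_sampling[OF n, of k]])
      (auto simp: mult.commute)
  finally show ?thesis .
qed

lemma uavg_mono:
  assumes n: "0 < n" and le: "\<And>\<phi>. (\<forall>i<k. \<phi> i < n) \<Longrightarrow> G \<phi> \<le> G' \<phi>"
  shows "uavg n k G \<le> uavg n k G'"
  unfolding uavg_def
  using finite_set_uniform_sampling[OF n, of k]
  by (intro integral_mono_AE integrable_measure_pmf_finite AE_pmfI le)
     (auto intro: uniform_sampling_lt[OF n])

lemma uavg_add:
  "0 < n \<Longrightarrow> uavg n k (\<lambda>\<phi>. G \<phi> + G' \<phi>) = uavg n k G + uavg n k G'"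
  unfolding uavg_def
  by (rule Bochner_Integration.integral_add)
     (auto intro: integrable_measure_pmf_finite finite_set_uniform_sampling)

lemma uavg_cmult: "uavg n k (\<lambda>\<phi>. c * G \<phi>) = c * uavg n k G"
  by (simp add: uavg_def)

lemma uavg_const: "uavg n k (\<lambda>\<phi>. c) = c"
  by (simp add: uavg_def)

lemma uavg_diff:
  "0 < n \<Longrightarrow> uavg n k (\<lambda>\<phi>. G \<phi> - G' \<phi>) = uavg n k G - uavg n k G'"
  using uavg_add[of n k G "\<lambda>\<phi>. - 1 * G' \<phi>"] uavg_cmult[of n k "-1" G'] by simp

section \<open>Finite powers in place of the exponential\<close>

context tracial_star_algebra
begin

lemma psd_tr_nonneg: "psd x \<Longrightarrow> 0 \<le> tr x"
  by (metis psd_def mult_1 mult_1_right star_one)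

text \<open>The polynomial \<open>((1 + z) ^ N - 1 - N z) / z\<^sup>2\<close>, written without
  division. Its expansion in powers of \<open>1 + z\<close> makes it a sum of positive terms when
  \<open>1 + z\<close> is positive, and easy to bound in norm.\<close>

definition tail_poly :: "nat \<Rightarrow> 'a \<Rightarrow> 'a" where
  "tail_poly N z = (\<Sum>j<N. \<Sum>i<j. (1 + z) ^ i)"

lemma power_commute_one_add: "z * (1 + z :: 'a) ^ i = (1 + z) ^ i * z"
  by (rule power_commuting_commutes[symmetric]) (simp add: algebra_simps)

lemma power_one_add_eq: "(1 + z) ^ N = 1 + real N *\<^sub>R z + z * tail_poly N z * z"
proof -
  have geom: "(1 + z) ^ j = 1 + z * (\<Sum>i<j. (1 + z) ^ i)" for j
  proof (induction j)
    case (Suc j)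
    have "(1 + z) ^ Suc j = (1 + z) ^ j + z * (1 + z) ^ j" by (simp add: distrib_right)
    then show ?case using Suc by (simp add: algebra_simps)
  qed simp
  have c: "z * (\<Sum>i<j. (1 + z) ^ i) = (\<Sum>i<j. (1 + z) ^ i) * z" for j
    by (simp add: sum_distrib_left sum_distrib_right power_commute_one_add)
  show ?thesis
  proof (induction N)
    case 0
    then show ?case by (simp add: tail_poly_def)
  next
    case (Suc N)
    have "(1 + z) ^ Suc N = (1 + z) ^ N + (1 + z) ^ N * z"
      by (simp add: distrib_right power_commute_one_add)
    also have "(1 + z) ^ N * z = z + z * (\<Sum>i<N. (1 + z) ^ i) * z"
      by (subst geom) (simp add: distrib_right)
    finally show ?case using Suc
      by (simp add: tail_poly_def algebra_simps)
  qed
qed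

text \<open>The counterpart of positivity of \<open>exp y - 1 - y\<close>. The bound
  \<open>N\<close> on \<open>y\<close> makes \<open>1 + y / N\<close> positive, so the tail
  polynomial is positive, and the remainder is that polynomial conjugated by
  \<open>y / N\<close>.\<close>

lemma psd_power_remainder:
  assumes "star y = y" "op_bounded y (real N)" "0 < N"
  shows "psd ((1 + (1 / real N) *\<^sub>R y) ^ N - 1 - y)"
proof -
  let ?z = "(1 / real N) *\<^sub>R y"
  have sz: "star ?z = ?z" using assms by (simp add: star_scaleR)
  have "op_bounded ?z 1"
    using op_bounded_scaleR[OF assms(2), of "1 / real N"] assms(3) by simp
  then have "psd (1 + ?z)" by (rule psd_one_add)
  moreover have "star (1 + ?z) = 1 + ?z" by (simp add: star_add sz)
  ultimately have "psd (tail_poly N ?z)"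
    unfolding tail_poly_def by (intro psd_sum psd_power)
  then have "psd (star ?z * tail_poly N ?z * ?z)" by (rule psd_conj)
  then show ?thesis
    using assms(3) by (simp only: power_one_add_eq sz) simp
qed

lemma op_bounded_one_add: "op_bounded z e \<Longrightarrow> op_bounded (1 + z) (1 + e)"
  by (intro op_bounded_add op_bounded_one)

text \<open>The product \<open>(1 + y / N) * (1 + x / N)\<close> differs from
  \<open>1 + (x + y) / N\<close> only by \<open>y * x / N\<^sup>2\<close>. Over \<open>N\<close>
  factors this costs order \<open>1 / N\<close>, after which \<open>tr_power_mult_le\<close>
  separates the two powers.\<close>

lemma golden_thompson_approx:
  assumes N: "N = 2 ^ j" and sx: "star x = x" and sy: "star y = y"
    and bx: "op_bounded x 1" and b_y: "op_bounded y b"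
  shows "tr ((1 + (1 / real N) *\<^sub>R (x + y)) ^ N)
    \<le> tr ((1 + (1 / real N) *\<^sub>R y) ^ N * (1 + (1 / real N) *\<^sub>R x) ^ N)
       + b * exp (2 * b + 1) * tr 1 / real N"
proof -
  let ?r = "1 / real N"
  have N0: "1 \<le> real N" by (simp add: N)
  have b: "0 \<le> b" using b_y by (simp add: op_bounded_def)
  \<comment> \<open>One common bound for both bases: \<open>b + 1\<close> covers the first-order
    terms, and the extra \<open>b\<close> absorbs the product term
    \<open>b / N\<^sup>2\<close>.\<close>
  let ?c = "1 + (2 * b + 1) / real N"
  define p q where "p = 1 + ?r *\<^sub>R y" and "q = 1 + ?r *\<^sub>R x"
  have bp: "op_bounded p (1 + b / real N)" and bq: "op_bounded q (1 + 1 / real N)"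
    unfolding p_def q_def
    using op_bounded_one_add[OF op_bounded_scaleR[OF b_y, of ?r]]
      op_bounded_one_add[OF op_bounded_scaleR[OF bx, of ?r]] by simp_all
  have eq: "p * q - (1 + ?r *\<^sub>R (x + y)) = ?r\<^sup>2 *\<^sub>R (y * x)"
    by (simp add: p_def q_def algebra_simps power2_eq_square)
  have d: "op_bounded (1 + ?r *\<^sub>R (x + y) - p * q) (b / (real N)\<^sup>2)"
  proof -
    have "1 + ?r *\<^sub>R (x + y) - p * q = - (?r\<^sup>2) *\<^sub>R (y * x)" using eq
      by (simp add: algebra_simps)
    then show ?thesis
      using op_bounded_scaleR[OF op_bounded_mult[OF b_y bx], of "- (?r\<^sup>2)"]
      by (simp add: power_divide)
  qed
  have "op_bounded (1 + ?r *\<^sub>R (x + y)) (1 + ?r * (1 + b))"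
    using op_bounded_one_add[OF op_bounded_scaleR[OF op_bounded_add[OF bx b_y], of ?r]] by simp
  then have b1: "op_bounded (1 + ?r *\<^sub>R (x + y)) ?c"
    by (rule op_bounded_mono) (use b N0 in \<open>simp add: field_simps\<close>)
  have "(1 + b / real N) * (1 + 1 / real N) \<le> ?c"
  proof -
    have "b / (real N * real N) \<le> b / real N"
      using b N0 by (intro divide_left_mono) auto
    moreover have "(1 + b / real N) * (1 + 1 / real N) = 1 + (b + 1) / real N + b / (real N * real N)"
      using N0 by (simp add: field_simps)
    moreover have "?c = 1 + (b + 1) / real N + b / real N"
      using N0 by (simp add: field_simps)
    ultimately show ?thesis by linarith
  qed
  then have b2: "op_bounded (p * q) ?c"
    by (rule op_bounded_mono[OF op_bounded_mult[OF bp bq]])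
  have c1: "1 \<le> ?c" using b by simp
  have "\<bar>tr ((1 + ?r *\<^sub>R (x + y)) ^ N - (p * q) ^ N)\<bar> \<le> real N * (b / (real N)\<^sup>2) * ?c ^ N * tr 1"
    by (rule tr_bounded[OF op_bounded_power_diff[OF b1 b2 d c1]])
  also have "\<dots> \<le> real N * (b / (real N)\<^sup>2) * exp (2 * b + 1) * tr 1"
  proof -
    have "?c ^ N \<le> exp ((2 * b + 1) / real N) ^ N"
      using b by (intro power_mono) (use exp_ge_add_one_self in auto)
    also have "\<dots> = exp (2 * b + 1)"
      using N0 by (simp flip: exp_of_nat_mult)
    finally show ?thesis
      using b tr_one_nonneg by (intro mult_right_mono mult_left_mono) simp_all
  qed
  also have "\<dots> = b * exp (2 * b + 1) * tr 1 / real N"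
    using N0 by (simp add: power2_eq_square)
  finally have "tr ((1 + ?r *\<^sub>R (x + y)) ^ N) \<le> tr ((p * q) ^ N) + b * exp (2 * b + 1) * tr 1 / real N"
    by (simp add: tr_diff)
  also have "tr ((p * q) ^ N) \<le> tr (p ^ N * q ^ N)"
    by (rule tr_power_mult_le[OF N]) (simp_all add: p_def q_def star_add star_scaleR sx sy)
  finally show ?thesis unfolding p_def q_def by simp
qed

text \<open>A second-order Taylor bound under a positive weight, given as a square
  \<open>h * h\<close> so that the remainder becomes \<open>q\<close> tested on
  \<open>x * h\<close>. The tail polynomial has at most \<open>N\<^sup>2\<close> terms, each of norm
  at most \<open>(1 + 1 / N) ^ N \<le> 3\<close>; that is the constant 3.\<close>

lemma tr_mult_power_le:
  assumes N: "0 < N" and sx: "star x = x" and bx: "op_bounded x 1" and sh: "star h = h"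
  shows "tr (h * h * (1 + (1 / real N) *\<^sub>R x) ^ N)
    \<le> tr (h * h) + tr (h * h * x) + 3 * tr (h * h * (x * x))"
proof -
  let ?z = "(1 / real N) *\<^sub>R x"
  have bz: "op_bounded (1 + ?z) (1 + 1 / real N)"
    using op_bounded_one_add[OF op_bounded_scaleR[OF bx, of "1 / real N"]] by simp
  have e: "(1 + 1 / real N) ^ i \<le> 3" if "i < N" for i
  proof -
    have "(1 + 1 / real N) ^ i \<le> (1 + 1 / real N) ^ N"
      using that by (intro power_increasing) auto
    also have "\<dots> \<le> exp (1 / real N) ^ N"
      by (intro power_mono) (use exp_ge_add_one_self in auto)
    also have "\<dots> = exp 1" using N by (simp flip: exp_of_nat_mult)
    also have "\<dots> \<le> 3" by (rule exp_le)
    finally show ?thesis .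
  qed
  have "op_bounded (tail_poly N ?z) (\<Sum>j<N. \<Sum>i<j. 3)"
    unfolding tail_poly_def
    by (intro op_bounded_sum op_bounded_mono[OF op_bounded_power[OF bz]] e) auto
  moreover have "(\<Sum>j<N. \<Sum>i<j. 3) \<le> 3 * (real N)\<^sup>2"
  proof -
    have "(\<Sum>j<N. \<Sum>i<j. 3::real) \<le> (\<Sum>j<N. 3 * real N)" by (intro sum_mono) auto
    then show ?thesis by (simp add: power2_eq_square)
  qed
  ultimately have bt: "op_bounded (tail_poly N ?z) (3 * (real N)\<^sup>2)"
    by (rule op_bounded_mono)
  define q where "q = (1 / (real N)\<^sup>2) *\<^sub>R tail_poly N ?z"
  have bq: "op_bounded q 3"
    using op_bounded_scaleR[OF bt, of "1 / (real N)\<^sup>2"] N by (simp add: q_def)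
  have "(1 + ?z) ^ N = 1 + x + x * q * x"
    using N by (simp add: power_one_add_eq q_def power2_eq_square)
  then have "tr (h * h * (1 + ?z) ^ N) = tr (h * h) + tr (h * h * x) + tr (h * h * (x * q * x))"
    by (simp add: distrib_left tr_add)
  moreover have "tr (h * h * (x * q * x)) \<le> 3 * tr (h * h * (x * x))"
  proof -
    have "tr (h * h * (x * q * x)) = tr (q * (x * h) * star (x * h))"
      using tr_commute[of "h * h * x" "q * x"] tr_commute[of "q * x * h" "h * x"]
      by (simp add: star_mult sx sh mult.assoc)
    also have "\<dots> \<le> hs_norm (q * (x * h)) * hs_norm (x * h)"
      using tr_cauchy_schwarz[of "q * (x * h)" "x * h"] by linarith
    also have "\<dots> \<le> 3 * hs_norm (x * h) * hs_norm (x * h)"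
      using bq unfolding op_bounded_def by (intro mult_right_mono) (blast, simp)
    also have "\<dots> = 3 * tr (x * h * star (x * h))"
      using hs_norm_sq[of "x * h"] by (simp add: power2_eq_square mult.assoc)
    also have "tr (x * h * star (x * h)) = tr (h * h * (x * x))"
      using tr_commute[of x "h * h * x"] by (simp add: star_mult sx sh mult.assoc)
    finally show ?thesis .
  qed
  ultimately show ?thesis by simp
qed

text \<open>The remainder is positive, so compressing it to the complement of \<open>p\<close> has
  nonnegative trace; hence its whole trace dominates the part on \<open>p\<close>, which is a scalar
  because \<open>p\<close> projects onto an eigenvector.\<close>

lemma eigenprojection_trace_le:
  assumes y: "star y = y" "op_bounded y (real N)" "0 < N" "even N"
    and p: "star p = p" "p * p = p" "tr p = 1" "y * p = l *\<^sub>R p" and T: "0 \<le> T" "T \<le> l"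
  shows "(1 + T / real N) ^ N - 1 - T \<le> tr ((1 + (1 / real N) *\<^sub>R y) ^ N - 1 - y)"
proof -
  define Q where "Q = (1 + (1 / real N) *\<^sub>R y) ^ N - 1 - y"
  have psd: "psd Q" unfolding Q_def by (rule psd_power_remainder[OF y(1-3)])
  have "(1 + (1 / real N) *\<^sub>R y) ^ k * p = (1 + l / real N) ^ k *\<^sub>R p" for k
    by (induction k) (simp_all add: mult.assoc distrib_right p(4) scaleR_left_distrib power_commutes
       algebra_simps)
  then have Qp: "Q * p = ((1 + l / real N) ^ N - 1 - l) *\<^sub>R p"
    by (simp add: Q_def left_diff_distrib p(4) scaleR_left_diff_distrib)
  have "0 \<le> tr (star (1 - p) * Q * (1 - p))" using psd by (simp add: psd_def)
  also have "\<dots> = tr (Q * ((1 - p) * (1 - p)))"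
    by (simp add: star_diff p(1) tr_commute[of "1 - p"] mult.assoc)
  also have "(1 - p) * (1 - p) = 1 - p" by (simp add: algebra_simps p(2))
  finally have "tr (Q * p) \<le> tr Q" by (simp add: right_diff_distrib tr_diff)
  then have *: "(1 + l / real N) ^ N - 1 - l \<le> tr Q" by (simp add: Qp tr_scaleR p(3))
  \<comment> \<open>Monotonicity lets the fixed threshold \<open>T\<close> replace the unknown
    eigenvalue \<open>l\<close>.\<close>
  have "(1 + T / real N) ^ N - T \<le> (1 + l / real N) ^ N - l"
  proof (rule DERIV_nonneg_imp_nondecreasing[OF T(2)])
    fix u assume u: "T \<le> u" "u \<le> l"
    have "((\<lambda>u. (1 + u / real N) ^ N - u) has_real_derivative
        real N * ((1 / real N) * (1 + u / real N) ^ (N - 1)) - 1) (at u)"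
      by (auto intro!: derivative_eq_intros)
    moreover have "1 \<le> (1 + u / real N) ^ (N - 1)"
      using u T by (intro one_le_power) simp
    ultimately show "\<exists>D. ((\<lambda>u. (1 + u / real N) ^ N - u) has_real_derivative D) (at u) \<and> 0 \<le> D"
      using \<open>0 < N\<close> by (intro exI conjI) auto
  qed
  with * show ?thesis by (simp add: Q_def)
qed

end

section \<open>Concentration of sums of sampled elements\<close>

text \<open>\<open>B j\<close> models a rank-one matrix whose vector has squared length
  \<open>\<beta> j\<close>; only \<open>B_square\<close> and positivity record this. The
  factorization \<open>R\<close> states that \<open>S\<close> is at most 1 in a form that can be
  used for conjugation, and the condition on \<tau> makes every centred term bounded by 1. The sign
  of \<tau> is free, to reach both ends of the spectrum.\<close>

locale tracial_sampling = tracial_star_algebra star tr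
  for star :: "'a::real_algebra_1 \<Rightarrow> 'a" and tr :: "'a \<Rightarrow> real" +
  fixes n :: nat and B :: "nat \<Rightarrow> 'a" and \<beta> :: "nat \<Rightarrow> real" and M :: real
    and S R :: 'a and \<tau> :: real
  assumes n: "0 < n"
    and B_star: "j < n \<Longrightarrow> star (B j) = B j"
    and B_square: "j < n \<Longrightarrow> B j * B j = \<beta> j *\<^sub>R B j"
    and B_psd: "j < n \<Longrightarrow> psd (B j)"
    and \<beta>_nonneg: "j < n \<Longrightarrow> 0 \<le> \<beta> j"
    and \<beta>_le: "j < n \<Longrightarrow> \<beta> j \<le> M"
    and S_eq: "S = (1 / real n) *\<^sub>R (\<Sum>j<n. B j)"
    and R: "1 - S = R * star R"
    and \<tau>: "2 * M * \<bar>\<tau>\<bar> \<le> 1"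
begin

definition X :: "nat \<Rightarrow> 'a" where
  "X j = \<tau> *\<^sub>R (B j - S)"

definition Y :: "nat \<Rightarrow> (nat \<Rightarrow> nat) \<Rightarrow> 'a" where
  "Y k \<phi> = (\<Sum>i<k. X (\<phi> i))"

lemma S_star: "star S = S"
  by (simp add: S_eq star_scaleR star_sum B_star)

lemma X_star: "j < n \<Longrightarrow> star (X j) = X j"
  by (simp add: X_def star_scaleR star_diff B_star S_star)

lemma Y_star: "\<forall>i<k. \<phi> i < n \<Longrightarrow> star (Y k \<phi>) = Y k \<phi>"
  by (simp add: Y_def star_sum X_star)

text \<open>From \<open>B_square\<close> alone: the squared seminorm of \<open>B j * y\<close> is
  \<beta> times \<open>tr (B j * y * star y)\<close>, and after Cauchy-Schwarz one factor
  \<open>hs_norm (B j * y)\<close> cancels.\<close>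

lemma B_bounded:
  assumes j: "j < n"
  shows "op_bounded (B j) M"
proof -
  have "hs_norm (B j * y) \<le> \<beta> j * hs_norm y" for y
  proof (cases "hs_norm (B j * y) = 0")
    case False
    have "(hs_norm (B j * y))\<^sup>2 = tr (B j * (y * (star y * B j)))"
      by (simp add: hs_norm_sq star_mult B_star[OF j] mult.assoc)
    also have "\<dots> = tr (B j * B j * y * star y)"
      using tr_commute[of "B j * y * star y" "B j"] by (simp add: mult.assoc)
    also have "\<dots> = \<beta> j * tr (B j * y * star y)"
      by (simp add: B_square[OF j] tr_scaleR)
    also have "\<dots> \<le> \<beta> j * (hs_norm (B j * y) * hs_norm y)"
      using tr_cauchy_schwarz[of "B j * y" y] \<beta>_nonneg[OF j] by (intro mult_left_mono) auto
    finally have "hs_norm (B j * y) * hs_norm (B j * y) \<le> hs_norm (B j * y) * (\<beta> j * hs_norm y)"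
      by (simp add: power2_eq_square mult_ac)
    then show ?thesis
      using False hs_norm_nonneg[of "B j * y"] by (simp add: mult_le_cancel_left)
  qed (simp add: \<beta>_nonneg[OF j])
  then have "op_bounded (B j) (\<beta> j)" using \<beta>_nonneg[OF j] by (simp add: op_bounded_def)
  then show ?thesis using \<beta>_le[OF j] by (rule op_bounded_mono)
qed

lemma S_bounded: "op_bounded S M"
proof -
  have "op_bounded S (\<bar>1 / real n\<bar> * (\<Sum>j<n. M))"
    unfolding S_eq by (intro op_bounded_scaleR op_bounded_sum B_bounded) simp
  then show ?thesis using n by simp
qed

lemma X_bounded:
  assumes "j < n"
  shows "op_bounded (X j) 1"
proof -
  have "op_bounded (X j) (\<bar>\<tau>\<bar> * (M + M))"
    unfolding X_def by (intro op_bounded_scaleR op_bounded_diff B_bounded S_bounded assms)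
  then show ?thesis by (rule op_bounded_mono) (use \<tau> in \<open>simp add: mult_ac\<close>)
qed

lemma Y_bounded: "(\<forall>i<k. \<phi> i < n) \<Longrightarrow> op_bounded (Y k \<phi>) (real k)"
  using op_bounded_sum[of "{..<k}" "\<lambda>i. X (\<phi> i)" "\<lambda>_. 1"] by (simp add: Y_def X_bounded)

lemma Y_Suc_upd: "Y (Suc k) (\<phi>(k := j)) = X j + Y k \<phi>"
  by (simp add: Y_def add.commute)

lemma sum_X: "(\<Sum>j<n. X j) = 0"
proof -
  have "(\<Sum>j<n. B j) = real n *\<^sub>R S" using n by (simp add: S_eq)
  then have "(\<Sum>j<n. B j - S) = 0"
    by (simp only: sum_subtractf sum_constant_scaleR card_lessThan) simp
  then show ?thesis by (simp add: X_def flip: scaleR_sum_right)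
qed

lemma uavg_Y: "uavg n k (\<lambda>\<phi>. tr (z * Y k \<phi>)) = 0"
proof (induction k)
  case 0
  then show ?case by (simp add: uavg_0 Y_def)
next
  case (Suc k)
  have "(\<Sum>j<n. tr (z * Y (Suc k) (\<phi>(k := j)))) = real n * tr (z * Y k \<phi>)" for \<phi>
    using sum_X by (simp add: Y_Suc_upd distrib_left tr_add sum.distrib
        flip: tr_sum sum_distrib_left)
  then show ?case using n Suc by (simp add: uavg_Suc)
qed

text \<open>Averaging turns both cross terms into \<open>S * S\<close>, leaving the mean of
  \<open>B j * B j\<close> minus \<open>S * S\<close>. The square of \<open>B j\<close> is at most
  \<open>M * B j\<close>, so the variance is controlled by \<open>S\<close> itself, whose trace does
  not see the dimension.\<close>

lemma second_moment_le:
  assumes sh: "star h = h"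
  shows "1 / real n * (\<Sum>j<n. tr (h * h * (X j * X j))) \<le> \<tau>\<^sup>2 * M * tr (h * h * S)"
proof -
  have sumB: "(\<Sum>j<n. B j) = real n *\<^sub>R S" using n by (simp add: S_eq)
  have BB: "tr (h * h * (B j * B j)) \<le> M * tr (h * h * B j)" if j: "j < n" for j
  proof -
    have "tr (h * h * B j) = tr (star h * B j * h)"
      using tr_commute[of h "h * B j"] by (simp add: sh mult.assoc)
    then have "0 \<le> tr (h * h * B j)" using B_psd[OF j] by (simp add: psd_def)
    then show ?thesis
      using \<beta>_le[OF j] by (simp add: B_square[OF j] tr_scaleR mult_right_mono)
  qed
  have SS: "0 \<le> tr (h * h * (S * S))"
  proof -
    have "tr (h * h * (S * S)) = tr ((S * h) * star (S * h))"
      using tr_commute[of "h * h * S" S] by (simp add: star_mult S_star sh mult.assoc)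
    then show ?thesis using tr_nonneg by simp
  qed
  let ?D = "\<Sum>j<n. tr (h * h * (B j * B j)) - tr (h * h * (B j * S))
          - tr (h * h * (S * B j)) + tr (h * h * (S * S))"
  have eq: "(\<Sum>j<n. tr (h * h * (X j * X j))) = \<tau>\<^sup>2 * ?D"
    unfolding sum_distrib_left
    by (intro sum.cong refl)
       (simp add: X_def algebra_simps tr_add tr_diff tr_scaleR power2_eq_square)
  have "?D = (\<Sum>j<n. tr (h * h * (B j * B j))) - real n * tr (h * h * (S * S))"
  proof -
    have "(\<Sum>j<n. tr (h * h * (B j * S))) = real n * tr (h * h * (S * S))"
      by (simp add: sumB tr_scaleR flip: tr_sum sum_distrib_left sum_distrib_right)
    moreover have "(\<Sum>j<n. tr (h * h * (S * B j))) = real n * tr (h * h * (S * S))"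
      by (simp add: sumB tr_scaleR flip: tr_sum sum_distrib_left sum_distrib_right)
    ultimately show ?thesis by (simp add: sum.distrib sum_subtractf)
  qed
  also have "\<dots> \<le> (\<Sum>j<n. M * tr (h * h * B j))"
    using sum_mono[of "{..<n}" "\<lambda>j. tr (h * h * (B j * B j))" "\<lambda>j. M * tr (h * h * B j)"] BB SS n
    by (simp add: add.commute add_increasing2)
       (smt (verit) mult_nonneg_nonneg of_nat_0_le_iff)
  also have "\<dots> = M * (real n * tr (h * h * S))"
    by (simp add: sumB tr_scaleR flip: tr_sum sum_distrib_left)
  finally have "\<tau>\<^sup>2 * ?D \<le> \<tau>\<^sup>2 * (M * (real n * tr (h * h * S)))"
    by (rule mult_left_mono) simp
  then have "1 / real n * (\<tau>\<^sup>2 * ?D) \<le> 1 / real n * (\<tau>\<^sup>2 * (M * (real n * tr (h * h * S))))"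
    by (rule mult_left_mono) simp
  then show ?thesis using n unfolding eq by simp
qed

text \<open>The second moment produces \<open>tr (f * S)\<close>, which has to be bounded by the
  same potential \<open>tr f - tr 1 + tr S\<close> for the recursion to close. The price is a term
  linear in \<open>Y k \<phi>\<close>, kept here and removed later by averaging.\<close>

lemma tr_exp_step:
  assumes N: "N = 2 ^ Suc m" and kN: "k \<le> N" and \<phi>: "\<forall>i<k. \<phi> i < n"
  defines "f \<equiv> (1 + (1 / real N) *\<^sub>R Y k \<phi>) ^ N"
  shows "1 / real n * (\<Sum>j<n. tr ((1 + (1 / real N) *\<^sub>R Y (Suc k) (\<phi>(k := j))) ^ N))
    \<le> tr f + 3 * \<tau>\<^sup>2 * M * (tr f - tr 1 + tr S - tr (R * star R * Y k \<phi>))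
       + real k * exp (2 * real k + 1) * tr 1 / real N"
proof -
  let ?r = "1 / real N" and ?y = "Y k \<phi>"
  let ?K = "real k * exp (2 * real k + 1) * tr 1 / real N"
  have N0: "0 < N" by (simp add: N)
  have sy: "star ?y = ?y" and b_y: "op_bounded ?y (real k)"
    using Y_star[OF \<phi>] Y_bounded[OF \<phi>] by blast+
  have b_y': "op_bounded ?y (real N)" using b_y kN by (intro op_bounded_mono[OF b_y]) simp
  \<comment> \<open>The exponent \<open>2 ^ Suc m\<close> leaves half of it for \<open>h\<close>, so
    the weight \<open>f\<close> is the square of a self-adjoint element.\<close>
  define h where "h = (1 + ?r *\<^sub>R ?y) ^ 2 ^ m"
  have sh: "star h = h" by (simp add: h_def star_power star_add star_scaleR sy)
  have f: "f = h * h" unfolding f_def h_def power_add[symmetric]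
    by (rule arg_cong[of _ _ "power _"]) (simp add: N)
  have "tr ((1 + ?r *\<^sub>R Y (Suc k) (\<phi>(k := j))) ^ N)
      \<le> tr f + tr (h * h * X j) + 3 * tr (h * h * (X j * X j)) + ?K" if j: "j < n" for j
    using golden_thompson_approx[OF N X_star[OF j] sy X_bounded[OF j] b_y]
      tr_mult_power_le[OF N0 X_star[OF j] X_bounded[OF j] sh]
    by (simp add: Y_Suc_upd f flip: f_def)
  then have "(\<Sum>j<n. tr ((1 + ?r *\<^sub>R Y (Suc k) (\<phi>(k := j))) ^ N))
      \<le> (\<Sum>j<n. tr f + tr (h * h * X j) + 3 * tr (h * h * (X j * X j)) + ?K)"
    by (intro sum_mono) simp
  also have "\<dots> = real n * tr f + 3 * (\<Sum>j<n. tr (h * h * (X j * X j))) + real n * ?K"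
    using sum_X by (simp add: sum.distrib flip: tr_sum sum_distrib_left)
  finally have "1 / real n * (\<Sum>j<n. tr ((1 + ?r *\<^sub>R Y (Suc k) (\<phi>(k := j))) ^ N))
      \<le> 1 / real n * (real n * tr f + 3 * (\<Sum>j<n. tr (h * h * (X j * X j))) + real n * ?K)"
    by (intro mult_left_mono) auto
  also have "\<dots> = tr f + 3 * (1 / real n * (\<Sum>j<n. tr (h * h * (X j * X j)))) + ?K"
    using n by (simp add: field_simps)
  also have "\<dots> \<le> tr f + 3 * (\<tau>\<^sup>2 * M * tr (f * S)) + ?K"
    using second_moment_le[OF sh] by (simp add: f)
  finally have main: "1 / real n * (\<Sum>j<n. tr ((1 + ?r *\<^sub>R Y (Suc k) (\<phi>(k := j))) ^ N))
      \<le> tr f + 3 * (\<tau>\<^sup>2 * M * tr (f * S)) + ?K" .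
  \<comment> \<open>Conjugation by \<open>R\<close> weights the positive remainder with
    \<open>1 - S\<close>; expanding gives the wanted bound on \<open>tr (f * S)\<close>.\<close>
  have "0 \<le> tr (star R * (f - 1 - ?y) * R)"
    using psd_power_remainder[OF sy b_y' N0] by (simp add: psd_def f_def)
  also have "\<dots> = tr ((f - 1 - ?y) * (R * star R))"
    by (simp add: mult.assoc tr_commute[of "star R"])
  also have "\<dots> = tr f - tr (f * S) - tr 1 + tr S - tr (R * star R * ?y)"
    unfolding R[symmetric] using tr_commute[of S ?y]
    by (simp add: algebra_simps tr_diff tr_add)
  finally have "tr (f * S) \<le> tr f - tr 1 + tr S - tr (R * star R * ?y)" by simp
  moreover have "0 \<le> \<tau>\<^sup>2 * M"
    using order_trans[OF \<beta>_nonneg[OF n] \<beta>_le[OF n]] by simp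
  ultimately have "\<tau>\<^sup>2 * M * tr (f * S) \<le> \<tau>\<^sup>2 * M * (tr f - tr 1 + tr S - tr (R * star R * ?y))"
    by (rule mult_left_mono)
  with main show ?thesis by (simp add: mult.assoc)
qed

text \<open>The quantity on the left equals \<open>tr S\<close> at \<open>k = 0\<close>, and each
  draw multiplies it by at most \<open>1 + 3 * \<tau>\<^sup>2 * M\<close>, up to a splitting error.
  The linear term of \<open>tr_exp_step\<close> averages to 0 by \<open>uavg_Y\<close>.\<close>

lemma tr_exp_uavg_le:
  assumes N: "N = 2 ^ Suc m" and sN: "s \<le> N" and ks: "k \<le> s"
  shows "uavg n k (\<lambda>\<phi>. tr ((1 + (1 / real N) *\<^sub>R Y k \<phi>) ^ N)) - tr 1 + tr S
    \<le> (1 + 3 * \<tau>\<^sup>2 * M) ^ k * (tr S + real k * (real s * exp (2 * real s + 1) * tr 1 / real N))"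
  using ks
proof (induction k)
  case 0
  then show ?case by (simp add: uavg_0 Y_def)
next
  case (Suc k)
  let ?a = "3 * \<tau>\<^sup>2 * M" and ?K = "real s * exp (2 * real s + 1) * tr 1 / real N"
  let ?f = "\<lambda>k \<phi>. tr ((1 + (1 / real N) *\<^sub>R Y k \<phi>) ^ N)"
  have a: "0 \<le> ?a"
    using order_trans[OF \<beta>_nonneg[OF n] \<beta>_le[OF n]] by simp
  have K: "0 \<le> ?K" using tr_one_nonneg by simp
  have Kk: "real k * exp (2 * real k + 1) * tr 1 / real N \<le> ?K"
    using Suc.prems tr_one_nonneg
    by (intro divide_right_mono mult_right_mono mult_mono) auto
  have "uavg n (Suc k) (?f (Suc k))
     = uavg n k (\<lambda>\<phi>. 1 / real n * (\<Sum>j<n. ?f (Suc k) (\<phi>(k := j))))"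
    by (rule uavg_Suc[OF n])
  also have "\<dots> \<le> uavg n k (\<lambda>\<phi>. (1 + ?a) * ?f k \<phi> + (?a * (tr S - tr 1) + ?K)
       - ?a * tr (R * star R * Y k \<phi>))"
  proof (rule uavg_mono[OF n])
    fix \<phi> :: "nat \<Rightarrow> nat" assume \<phi>: "\<forall>i<k. \<phi> i < n"
    have kN: "k \<le> N" using Suc.prems sN by simp
    show "1 / real n * (\<Sum>j<n. ?f (Suc k) (\<phi>(k := j)))
      \<le> (1 + ?a) * ?f k \<phi> + (?a * (tr S - tr 1) + ?K) - ?a * tr (R * star R * Y k \<phi>)"
      using order_trans[OF tr_exp_step[OF N kN \<phi>] add_left_mono[OF Kk]]
      by (simp add: algebra_simps)
  qed
  also have "\<dots> = (1 + ?a) * uavg n k (?f k) + (?a * (tr S - tr 1) + ?K)"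
    using n uavg_Y[of k "R * star R"]
    by (simp only: uavg_diff uavg_add uavg_cmult uavg_const mult_zero_right diff_zero)
  finally have "uavg n (Suc k) (?f (Suc k)) - tr 1 + tr S
      \<le> (1 + ?a) * (uavg n k (?f k) - tr 1 + tr S) + ?K"
    by (simp add: algebra_simps)
  also have "\<dots> \<le> (1 + ?a) * ((1 + ?a) ^ k * (tr S + real k * ?K)) + ?K"
    using Suc.IH Suc.prems a by (intro add_right_mono mult_left_mono) auto
  \<comment> \<open>The new error is enlarged by a factor at least 1 so that all errors share one
    power.\<close>
  also have "\<dots> \<le> (1 + ?a) * ((1 + ?a) ^ k * (tr S + real k * ?K)) + (1 + ?a) ^ Suc k * ?K"
    using one_le_power[of "1 + ?a" "Suc k"] a K mult_right_mono[of 1 "(1 + ?a) ^ Suc k" ?K]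
    by (intro add_left_mono) simp
  also have "\<dots> = (1 + ?a) ^ Suc k * (tr S + real (Suc k) * ?K)"
  proof -
    have "c * (p * (t + i * K)) + c * p * K = c * p * (t + (1 + i) * K)" for c p t i K :: real
      by (simp add: algebra_simps)
    then show ?thesis unfolding power_Suc of_nat_Suc by blast
  qed
  finally show ?case .
qed

text \<open>An eigenvector is encoded by its orthogonal projection, a self-adjoint idempotent of
  trace 1.\<close>

definition large_eigenvalue :: "nat \<Rightarrow> real \<Rightarrow> (nat \<Rightarrow> nat) \<Rightarrow> bool" where
  "large_eigenvalue s T \<phi> \<longleftrightarrow>
     (\<exists>p l. star p = p \<and> p * p = p \<and> tr p = 1 \<and> Y s \<phi> * p = l *\<^sub>R p \<and> T \<le> l)"

text \<open>Markov's inequality for the trace of the positive remainder, which is at least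
  \<open>(1 + T / N) ^ N - 1 - T\<close> on the event. Subtracting \<open>1 + Y\<close> instead of
  applying Markov to the trace of the exponential is what replaces the dimension by
  \<open>tr S\<close>.\<close>

theorem large_eigenvalue_prob:
  assumes T: "0 \<le> T"
  shows "measure_pmf.prob (uniform_sampling n s) {\<phi>. large_eigenvalue s T \<phi>} * (exp T - 1 - T)
     \<le> tr S * exp (3 * \<tau>\<^sup>2 * M * real s)"
proof -
  let ?P = "measure_pmf.prob (uniform_sampling n s) {\<phi>. large_eigenvalue s T \<phi>}"
  let ?a = "3 * \<tau>\<^sup>2 * M"
  \<comment> \<open>Contains the dimension and is exponential in \<open>s\<close>, but is
    independent of \<open>N\<close>, so \<open>K / N\<close> vanishes along the powers of
    two.\<close>
  define K where "K = real s * (real s * exp (2 * real s + 1) * tr 1)"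
  have a: "0 \<le> ?a"
    using order_trans[OF \<beta>_nonneg[OF n] \<beta>_le[OF n]] by simp
  have *: "?P * ((1 + T / real N) ^ N - 1 - T) \<le> (1 + ?a) ^ s * (tr S + K / real N) - tr S"
    if N: "N = 2 ^ Suc m" and sN: "s \<le> N" for N m
  proof -
    let ?Q = "\<lambda>\<phi>. (1 + (1 / real N) *\<^sub>R Y s \<phi>) ^ N - 1 - Y s \<phi>"
    let ?t = "(1 + T / real N) ^ N - 1 - T"
    have N0: "0 < N" "even N" by (simp_all add: N)
    have "?P * ?t = uavg n s (\<lambda>\<phi>. ?t * indicator {\<phi>. large_eigenvalue s T \<phi>} \<phi>)"
      unfolding uavg_cmult by (simp add: uavg_def)
    also have "\<dots> \<le> uavg n s (\<lambda>\<phi>. tr (?Q \<phi>))"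
    proof (rule uavg_mono[OF n])
      fix \<phi> :: "nat \<Rightarrow> nat" assume \<phi>: "\<forall>i<s. \<phi> i < n"
      have sy: "star (Y s \<phi>) = Y s \<phi>" using Y_star[OF \<phi>] by blast
      have b_y: "op_bounded (Y s \<phi>) (real N)"
        using sN by (intro op_bounded_mono[OF Y_bounded[OF \<phi>]]) auto
      have "0 \<le> tr (?Q \<phi>)"
        by (intro psd_tr_nonneg psd_power_remainder[OF sy b_y N0(1)])
      then show "?t * indicator {\<phi>. large_eigenvalue s T \<phi>} \<phi> \<le> tr (?Q \<phi>)"
        using eigenprojection_trace_le[OF sy b_y N0 _ _ _ _ T]
        by (auto simp: indicator_def large_eigenvalue_def)
    qed
    also have "\<dots> = uavg n s (\<lambda>\<phi>. tr ((1 + (1 / real N) *\<^sub>R Y s \<phi>) ^ N)) - tr 1"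
      using n uavg_Y[of s 1] by (simp add: tr_diff uavg_diff uavg_const)
    also have "\<dots> \<le> (1 + ?a) ^ s * (tr S + K / real N) - tr S"
      using tr_exp_uavg_le[OF N sN order_refl] by (simp add: K_def)
    finally show ?thesis .
  qed
  have sub: "strict_mono (\<lambda>m. 2 ^ Suc m :: nat)" by (simp add: strict_mono_Suc_iff)
  have "(\<lambda>N. (1 + T / real N) ^ N) \<longlonglongrightarrow> exp T" by (rule tendsto_exp_limit_sequentially)
  from LIMSEQ_subseq_LIMSEQ[OF this sub]
  have e: "(\<lambda>m. (1 + T / real (2 ^ Suc m)) ^ (2 ^ Suc m)) \<longlonglongrightarrow> exp T" by (simp add: o_def)
  have "(\<lambda>N. K / real N) \<longlonglongrightarrow> 0"
    by (rule lim_const_over_n)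
  from LIMSEQ_subseq_LIMSEQ[OF this sub]
  have k: "(\<lambda>m. K / real (2 ^ Suc m)) \<longlonglongrightarrow> 0" by (simp add: o_def)
  have "?P * (exp T - 1 - T) \<le> (1 + ?a) ^ s * (tr S + 0) - tr S"
  proof (rule tendsto_le[OF sequentially_bot])
    show "(\<lambda>m. ?P * ((1 + T / real (2 ^ Suc m)) ^ (2 ^ Suc m) - 1 - T)) \<longlonglongrightarrow> ?P * (exp T - 1 - T)"
      by (intro tendsto_intros e)
    show "(\<lambda>m. (1 + ?a) ^ s * (tr S + K / real (2 ^ Suc m)) - tr S)
        \<longlonglongrightarrow> (1 + ?a) ^ s * (tr S + 0) - tr S"
      by (intro tendsto_intros k)
    have "s \<le> 2 ^ Suc m" if "s \<le> m" for m
    proof -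
      have "m < 2 ^ m" by (rule less_exp)
      then show ?thesis using that unfolding power_Suc by linarith
    qed
    then show "\<forall>\<^sub>F m in sequentially. ?P * ((1 + T / real (2 ^ Suc m)) ^ (2 ^ Suc m) - 1 - T)
        \<le> (1 + ?a) ^ s * (tr S + K / real (2 ^ Suc m)) - tr S"
      unfolding eventually_sequentially using *[OF refl] by blast
  qed
  also have "\<dots> \<le> tr S * (1 + ?a) ^ s"
  proof -
    have "0 \<le> tr S"
      using B_psd n unfolding S_eq tr_scaleR tr_sum
      by (intro mult_nonneg_nonneg sum_nonneg psd_tr_nonneg) auto
    then show ?thesis by simp
  qed
  also have "\<dots> \<le> tr S * exp (?a * real s)"
  proof -
    have "(1 + ?a) ^ s \<le> exp ?a ^ s"
      using a by (intro power_mono) (use exp_ge_add_one_self in auto)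
    moreover have "0 \<le> tr S"
      using B_psd n unfolding S_eq tr_scaleR tr_sum
      by (intro mult_nonneg_nonneg sum_nonneg psd_tr_nonneg) auto
    ultimately show ?thesis by (intro mult_left_mono) (simp_all add: mult.commute flip: exp_of_nat_mult)
  qed
  finally show ?thesis .
qed

end

section \<open>Families of matrices as a tracial algebra\<close>

definition mat_trace :: "real mat \<Rightarrow> real" where
  "mat_trace M = (\<Sum>i<dim_row M. M $$ (i, i))"

lemma mat_trace_mult_transpose:
  assumes "P \<in> carrier_mat d d"
  shows "mat_trace (P * P\<^sup>T) = (\<Sum>i<d. \<Sum>k<d. (P $$ (i, k))\<^sup>2)"
  using assms by (simp add: mat_trace_def scalar_prod_def power2_eq_square atLeast0LessThan)

lemma mat_trace_commute:
  assumes "P \<in> carrier_mat d d" "Q \<in> carrier_mat d d"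
  shows "mat_trace (P * Q) = mat_trace (Q * P)"
proof -
  have "mat_trace (P * Q) = (\<Sum>i<d. \<Sum>k<d. P $$ (i, k) * Q $$ (k, i))"
    using assms by (simp add: mat_trace_def scalar_prod_def atLeast0LessThan)
  also have "\<dots> = (\<Sum>k<d. \<Sum>i<d. P $$ (i, k) * Q $$ (k, i))" by (rule sum.swap)
  also have "\<dots> = mat_trace (Q * P)"
    using assms by (simp add: mat_trace_def scalar_prod_def atLeast0LessThan mult.commute)
  finally show ?thesis .
qed

text \<open>A single type for the matrices of all sizes: the ring type classes become available although
  the size \<open>d\<close> is a natural number, and the trace of the component at \<open>d\<close> is tracial on all of it.\<close>

typedef mat_family = "{f :: nat \<Rightarrow> real mat. \<forall>d. f d \<in> carrier_mat d d}"
  morphisms component Mat_family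
  by (rule exI[of _ "\<lambda>d. 0\<^sub>m d d"]) simp

setup_lifting type_definition_mat_family

lemma component_carrier [simp]: "component x d \<in> carrier_mat d d"
  using component by blast

lemma component_dim [simp]: "dim_row (component x d) = d" "dim_col (component x d) = d"
  using component_carrier[of x d] by blast+

lemma mat_family_eqI: "(\<And>d. component x d = component y d) \<Longrightarrow> x = y"
  by (simp add: component_inject[symmetric] fun_eq_iff)

instantiation mat_family :: real_algebra_1
begin

lift_definition zero_mat_family :: mat_family is "\<lambda>d. 0\<^sub>m d d" by simp
lift_definition one_mat_family :: mat_family is "\<lambda>d. 1\<^sub>m d" by simp
lift_definition plus_mat_family :: "mat_family \<Rightarrow> mat_family \<Rightarrow> mat_family"
  is "\<lambda>f g d. f d + g d" by simp
lift_definition minus_mat_family :: "mat_family \<Rightarrow> mat_family \<Rightarrow> mat_family"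
  is "\<lambda>f g d. f d - g d" by (simp add: minus_carrier_mat)
lift_definition uminus_mat_family :: "mat_family \<Rightarrow> mat_family"
  is "\<lambda>f d. - f d" by simp
lift_definition times_mat_family :: "mat_family \<Rightarrow> mat_family \<Rightarrow> mat_family"
  is "\<lambda>f g d. f d * g d" by (metis mult_carrier_mat)
lift_definition scaleR_mat_family :: "real \<Rightarrow> mat_family \<Rightarrow> mat_family"
  is "\<lambda>c f d. c \<cdot>\<^sub>m f d" by simp

lemmas component_simps = zero_mat_family.rep_eq one_mat_family.rep_eq plus_mat_family.rep_eq
  minus_mat_family.rep_eq uminus_mat_family.rep_eq times_mat_family.rep_eq scaleR_mat_family.rep_eq

instance
proof
  fix x y z :: mat_family and a b :: real
  note [simp] = component_simps
  show "x + y + z = x + (y + z)"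
    by (rule mat_family_eqI) (simp add: assoc_add_mat[OF component_carrier component_carrier component_carrier])
  show "x + y = y + x"
    by (rule mat_family_eqI) (simp add: comm_add_mat[OF component_carrier component_carrier])
  show "0 + x = x" by (rule mat_family_eqI) simp
  show "- x + x = 0" by (rule mat_family_eqI) (auto intro!: eq_matI)
  show "x - y = x + - y" by (rule mat_family_eqI) (auto intro!: eq_matI)
  show "a *\<^sub>R (x + y) = a *\<^sub>R x + a *\<^sub>R y"
    by (rule mat_family_eqI) (auto intro!: eq_matI simp: algebra_simps)
  show "(a + b) *\<^sub>R x = a *\<^sub>R x + b *\<^sub>R x"
    by (rule mat_family_eqI) (auto intro!: eq_matI simp: algebra_simps)
  show "a *\<^sub>R b *\<^sub>R x = (a * b) *\<^sub>R x"
    by (rule mat_family_eqI) (auto intro!: eq_matI)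
  show "1 *\<^sub>R x = x" by (rule mat_family_eqI) (auto intro!: eq_matI)
  show "x * y * z = x * (y * z)"
    by (rule mat_family_eqI) (simp add: assoc_mult_mat[OF component_carrier component_carrier component_carrier])
  show "(x + y) * z = x * z + y * z"
    by (rule mat_family_eqI) (simp add: add_mult_distrib_mat[OF component_carrier component_carrier component_carrier])
  show "x * (y + z) = x * y + x * z"
    by (rule mat_family_eqI) (simp add: mult_add_distrib_mat[OF component_carrier component_carrier component_carrier])
  show "a *\<^sub>R x * y = a *\<^sub>R (x * y)"
    by (rule mat_family_eqI) (simp add: mult_smult_assoc_mat[OF component_carrier component_carrier])
  show "x * a *\<^sub>R y = a *\<^sub>R (x * y)"
    by (rule mat_family_eqI) (simp add: mult_smult_distrib[OF component_carrier component_carrier])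
  show "1 * x = x" by (rule mat_family_eqI) simp
  show "x * 1 = x" by (rule mat_family_eqI) simp
  show "(0 :: mat_family) \<noteq> 1"
  proof
    assume "(0 :: mat_family) = 1"
    then have "component 0 1 $$ (0, 0) = component 1 1 $$ (0, 0)" by simp
    then show False by simp
  qed
qed

end

lift_definition family_star :: "mat_family \<Rightarrow> mat_family" is "\<lambda>f d. (f d)\<^sup>T" by simp

definition family_trace :: "nat \<Rightarrow> mat_family \<Rightarrow> real" where
  "family_trace d x = mat_trace (component x d)"

lemma tracial_star_algebra_family: "tracial_star_algebra family_star (family_trace d)"
proof
  fix x y :: mat_family and c :: real
  note [simp] = component_simps family_star.rep_eq
  show "family_star (x + y) = family_star x + family_star y"
    by (rule mat_family_eqI) (auto intro!: eq_matI)
  show "family_star (c *\<^sub>R x) = c *\<^sub>R family_star x"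
    by (rule mat_family_eqI) (auto intro!: eq_matI)
  show "family_star (x * y) = family_star y * family_star x"
    by (rule mat_family_eqI) (simp add: transpose_mult[OF component_carrier component_carrier])
  show "family_star (family_star x) = x"
    by (rule mat_family_eqI) simp
  show "family_trace d (x + y) = family_trace d x + family_trace d y"
    by (simp add: family_trace_def mat_trace_def sum.distrib)
  show "family_trace d (c *\<^sub>R x) = c * family_trace d x"
    by (simp add: family_trace_def mat_trace_def sum_distrib_left)
  show "family_trace d (x * y) = family_trace d (y * x)"
    by (simp add: family_trace_def mat_trace_commute[OF component_carrier component_carrier])
  show "family_trace d (family_star x) = family_trace d x"
    by (simp add: family_trace_def mat_trace_def)
  show "0 \<le> family_trace d (x * family_star x)"
    by (simp add: family_trace_def mat_trace_mult_transpose[OF component_carrier] sum_nonneg)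
qed

section \<open>Matrix form of the concentration bound\<close>

text \<open>The locale assumptions are equations between whole families, so the other sizes need a
  harmless filler: 0 for the samples and projections, 1 for \<open>R\<close>, because
  \<open>1 - S\<close> is the identity wherever \<open>S\<close> is 0.\<close>

lift_definition embed_mat :: "nat \<Rightarrow> real \<Rightarrow> real mat \<Rightarrow> mat_family"
  is "\<lambda>d a M k. if k = d \<and> M \<in> carrier_mat d d then M else a \<cdot>\<^sub>m 1\<^sub>m k" by simp

lemma component_embed_mat:
  "M \<in> carrier_mat d d \<Longrightarrow> component (embed_mat d a M) k = (if k = d then M else a \<cdot>\<^sub>m 1\<^sub>m k)"
  by (simp add: embed_mat.rep_eq)

definition outer :: "real vec \<Rightarrow> real mat" where
  "outer v = mat (dim_vec v) (dim_vec v) (\<lambda>(i, k). v $ i * v $ k)"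

lemma outer_carrier [simp]: "v \<in> carrier_vec d \<Longrightarrow> outer v \<in> carrier_mat d d"
  by (auto simp: outer_def)

lemma outer_index: "i < dim_vec v \<Longrightarrow> k < dim_vec v \<Longrightarrow> outer v $$ (i, k) = v $ i * v $ k"
  by (simp add: outer_def)

lemma outer_transpose: "(outer v)\<^sup>T = outer v"
  by (auto simp: outer_def intro!: eq_matI)

lemma outer_mult_outer: "outer v * outer v = (v \<bullet> v) \<cdot>\<^sub>m outer v"
  by (auto simp: outer_def scalar_prod_def sum_distrib_left sum_distrib_right mult_ac intro!: eq_matI sum.cong)

lemma mult_outer:
  assumes "P \<in> carrier_mat d d" "v \<in> carrier_vec d" "P *\<^sub>v v = l \<cdot>\<^sub>v v"
  shows "P * outer v = l \<cdot>\<^sub>m outer v"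
proof (rule eq_matI)
  fix i k assume "i < dim_row (l \<cdot>\<^sub>m outer v)" "k < dim_col (l \<cdot>\<^sub>m outer v)"
  then have ik: "i < d" "k < d" using assms by (auto simp: outer_def)
  have "(P * outer v) $$ (i, k) = (\<Sum>r<d. P $$ (i, r) * v $ r) * v $ k"
    using assms(1,2) ik
    by (auto simp: outer_def scalar_prod_def sum_distrib_right atLeast0LessThan mult.assoc
        intro!: sum.cong)
  also have "(\<Sum>r<d. P $$ (i, r) * v $ r) = (P *\<^sub>v v) $ i"
    using assms(1,2) ik
    by (auto simp: mult_mat_vec_def scalar_prod_def atLeast0LessThan intro!: sum.cong)
  finally show "(P * outer v) $$ (i, k) = (l \<cdot>\<^sub>m outer v) $$ (i, k)"
    using assms ik by (auto simp: outer_def)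
qed (use assms in \<open>auto simp: outer_def\<close>)

lemma mat_trace_outer: "mat_trace (outer v) = v \<bullet> v"
  by (simp add: mat_trace_def outer_def scalar_prod_def atLeast0LessThan)

lemma component_sum_index:
  "i < d \<Longrightarrow> k < d \<Longrightarrow> component (\<Sum>j\<in>J. x j) d $$ (i, k) = (\<Sum>j\<in>J. component (x j) d $$ (i, k))"
  by (induction J rule: infinite_finite_induct) (simp_all add: component_simps)

definition mean_outer :: "nat \<Rightarrow> nat \<Rightarrow> (nat \<Rightarrow> real vec) \<Rightarrow> real mat" where
  "mean_outer d n b = mat d d (\<lambda>(i, k). 1 / real n * (\<Sum>j<n. b j $ i * b j $ k))"

definition sample_deviation ::
    "nat \<Rightarrow> nat \<Rightarrow> (nat \<Rightarrow> real vec) \<Rightarrow> nat \<Rightarrow> (nat \<Rightarrow> nat) \<Rightarrow> real mat" where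
  "sample_deviation d n b s \<phi> =
     mat d d (\<lambda>(i, k). \<Sum>r<s. b (\<phi> r) $ i * b (\<phi> r) $ k - mean_outer d n b $$ (i, k))"

lemma scalar_prod_self_nonneg: "0 \<le> (v :: real vec) \<bullet> v"
  by (simp add: scalar_prod_def sum_nonneg)

lemma scalar_prod_self_eq_0:
  assumes "v \<in> carrier_vec d" "(v :: real vec) \<bullet> v = 0"
  shows "v = 0\<^sub>v d"
proof (rule eq_vecI)
  have "(\<Sum>i<d. v $ i * v $ i) = 0"
    using assms by (simp add: scalar_prod_def atLeast0LessThan)
  then have "\<forall>i\<in>{..<d}. v $ i * v $ i = 0"
    by (subst (asm) sum_nonneg_eq_0_iff) auto
  then show "v $ i = 0\<^sub>v d $ i" if "i < dim_vec (0\<^sub>v d :: real vec)" for i using that by simp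
qed (use assms in auto)

lemma sample_deviation_eigenvalue_prob:
  fixes b :: "nat \<Rightarrow> real vec"
  assumes n: "0 < n" and b: "\<And>j. b j \<in> carrier_vec d"
    and M: "\<And>j. j < n \<Longrightarrow> b j \<bullet> b j \<le> M"
    and R: "R \<in> carrier_mat d d" "1\<^sub>m d - mean_outer d n b = R * R\<^sup>T"
    and \<tau>: "2 * M * \<bar>\<tau>\<bar> \<le> 1" and T: "0 \<le> T"
  shows "measure_pmf.prob (uniform_sampling n s)
      {\<phi>. \<exists>u\<in>carrier_vec d. \<exists>l. u \<bullet> u = 1 \<and> T \<le> l \<and>
         (\<tau> \<cdot>\<^sub>m sample_deviation d n b s \<phi>) *\<^sub>v u = l \<cdot>\<^sub>v u} * (exp T - 1 - T)
     \<le> mat_trace (mean_outer d n b) * exp (3 * \<tau>\<^sup>2 * M * real s)"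
proof -
  interpret tracial_star_algebra family_star "family_trace d"
    by (rule tracial_star_algebra_family)
  let ?B = "\<lambda>j. embed_mat d 0 (outer (b j))"
  let ?S = "(1 / real n) *\<^sub>R (\<Sum>j<n. ?B j)"
  have cB: "component (?B j) k = (if k = d then outer (b j) else 0 \<cdot>\<^sub>m 1\<^sub>m k)" for j k
    using b by (simp add: component_embed_mat)
  have B_star: "family_star (?B j) = ?B j" for j
    by (rule mat_family_eqI) (auto simp: family_star.rep_eq cB outer_transpose intro!: eq_matI)
  have B_sq: "?B j * ?B j = (b j \<bullet> b j) *\<^sub>R ?B j" for j
    by (rule mat_family_eqI) (auto simp: component_simps cB outer_mult_outer intro!: eq_matI)
  have B_psd: "psd (?B j)" for j
  proof (cases "b j \<bullet> b j = 0")
    case True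
    then have "b j = 0\<^sub>v d" using b scalar_prod_self_eq_0 by blast
    then have "?B j = 0"
      by (intro mat_family_eqI, unfold component_simps(1) cB) (auto simp: outer_def intro!: eq_matI)
    then show ?thesis by (simp add: psd_zero)
  next
    case False
    \<comment> \<open>A nonzero rank-one matrix is the square of itself divided by the length of its
      vector, hence positive.\<close>
    have "sqrt (1 / (b j \<bullet> b j)) * sqrt (1 / (b j \<bullet> b j)) * (b j \<bullet> b j) = 1"
      using False scalar_prod_self_nonneg[of "b j"] by (simp add: real_sqrt_mult_self)
    then obtain c where c: "c * (c * (b j \<bullet> b j)) = 1" by (metis mult.assoc)
    have "psd (family_star (c *\<^sub>R ?B j) * 1 * (c *\<^sub>R ?B j))"
      by (rule psd_conj[OF psd_one])
    also have "family_star (c *\<^sub>R ?B j) * 1 * (c *\<^sub>R ?B j) = ?B j"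
      using c by (simp add: star_scaleR B_star B_sq mult.assoc)
    finally show ?thesis .
  qed
  have cS: "component ?S d = mean_outer d n b"
    using b by (intro eq_matI)
      (auto simp: component_simps component_sum_index cB mean_outer_def outer_index
         carrier_vecD[OF b])
  have cS': "component ?S k = 0 \<cdot>\<^sub>m 1\<^sub>m k" if "k \<noteq> d" for k
    using that by (intro eq_matI) (auto simp: component_simps component_sum_index cB)
  have cR: "component (embed_mat d 1 R) k = (if k = d then R else 1\<^sub>m k)" for k
    using R(1) by (auto simp: component_embed_mat intro!: eq_matI)
  have R': "1 - ?S = embed_mat d 1 R * family_star (embed_mat d 1 R)"
  proof (rule mat_family_eqI)
    fix k
    show "component (1 - ?S) k = component (embed_mat d 1 R * family_star (embed_mat d 1 R)) k"
    proof (cases "k = d")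
      case True
      then show ?thesis
        using R(2) by (simp only: component_simps(2,4,6) family_star.rep_eq cS cR simp_thms if_True)
    next
      case False
      have "component (1 - ?S) k = 1\<^sub>m k - 0 \<cdot>\<^sub>m 1\<^sub>m k"
        by (simp only: component_simps(2,4) cS'[OF False])
      also have "\<dots> = 1\<^sub>m k * (1\<^sub>m k)\<^sup>T" by (auto intro!: eq_matI)
      finally show ?thesis using False by (simp add: component_simps(6) family_star.rep_eq cR)
    qed
  qed
  interpret tracial_sampling family_star "family_trace d" n ?B "\<lambda>j. b j \<bullet> b j" M ?S "embed_mat d 1 R" \<tau>
    by unfold_locales (use n B_star B_sq B_psd M R' \<tau> scalar_prod_self_nonneg in auto)
  have cY: "component (Y s \<phi>) d = \<tau> \<cdot>\<^sub>m sample_deviation d n b s \<phi>" for \<phi>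
  proof (rule eq_matI)
    fix i k
    assume "i < dim_row (\<tau> \<cdot>\<^sub>m sample_deviation d n b s \<phi>)"
      and "k < dim_col (\<tau> \<cdot>\<^sub>m sample_deviation d n b s \<phi>)"
    then have ik: "i < d" "k < d" by (auto simp: sample_deviation_def)
    have "component (X j) d $$ (i, k) = \<tau> * (b j $ i * b j $ k - mean_outer d n b $$ (i, k))" for j
    proof -
      have "component (X j) d = \<tau> \<cdot>\<^sub>m (outer (b j) - mean_outer d n b)"
        unfolding X_def
        by (simp only: minus_mat_family.rep_eq scaleR_mat_family.rep_eq[of \<tau>] cS cB simp_thms if_True)
      then show ?thesis
        using ik b by (simp add: outer_def mean_outer_def carrier_vecD[OF b])
    qed
    then show "component (Y s \<phi>) d $$ (i, k) = (\<tau> \<cdot>\<^sub>m sample_deviation d n b s \<phi>) $$ (i, k)"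
      using ik by (simp add: Y_def component_sum_index sample_deviation_def sum_distrib_left)
  qed (simp_all add: sample_deviation_def)
  have cY': "component (Y s \<phi>) k * (0 \<cdot>\<^sub>m 1\<^sub>m k) = l \<cdot>\<^sub>m (0 \<cdot>\<^sub>m 1\<^sub>m k)" for \<phi> k l
    by (intro eq_matI) (auto simp: scalar_prod_def)
  have "large_eigenvalue s T \<phi>"
    if u: "u \<in> carrier_vec d" "u \<bullet> u = 1" "T \<le> l"
      "(\<tau> \<cdot>\<^sub>m sample_deviation d n b s \<phi>) *\<^sub>v u = l \<cdot>\<^sub>v u" for \<phi> u l
  proof -
    let ?p = "embed_mat d 0 (outer u)"
    have cp: "component ?p k = (if k = d then outer u else 0 \<cdot>\<^sub>m 1\<^sub>m k)" for k
      using u(1) by (simp add: component_embed_mat)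
    have "family_star ?p = ?p"
      by (rule mat_family_eqI) (auto simp: family_star.rep_eq cp outer_transpose intro!: eq_matI)
    moreover have "?p * ?p = ?p"
      by (rule mat_family_eqI) (auto simp: component_simps cp outer_mult_outer u(2) intro!: eq_matI)
    moreover have "family_trace d ?p = 1"
      by (simp add: family_trace_def cp mat_trace_outer u(2))
    moreover have "Y s \<phi> * ?p = l *\<^sub>R ?p"
    proof (rule mat_family_eqI)
      fix k
      show "component (Y s \<phi> * ?p) k = component (l *\<^sub>R ?p) k"
        using mult_outer[OF component_carrier u(1), of "Y s \<phi>" l] u(4) cY'
        by (cases "k = d") (simp_all add: component_simps(6,7) cp cY)
    qed
    ultimately show ?thesis using u(3) unfolding large_eigenvalue_def by blast
  qed
  then have "measure_pmf.prob (uniform_sampling n s)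
      {\<phi>. \<exists>u\<in>carrier_vec d. \<exists>l. u \<bullet> u = 1 \<and> T \<le> l \<and>
         (\<tau> \<cdot>\<^sub>m sample_deviation d n b s \<phi>) *\<^sub>v u = l \<cdot>\<^sub>v u}
    \<le> measure_pmf.prob (uniform_sampling n s) {\<phi>. large_eigenvalue s T \<phi>}"
    by (intro measure_pmf.finite_measure_mono) auto
  moreover have "0 \<le> exp T - 1 - T" using exp_ge_add_one_self[of T] by linarith
  ultimately have "measure_pmf.prob (uniform_sampling n s)
      {\<phi>. \<exists>u\<in>carrier_vec d. \<exists>l. u \<bullet> u = 1 \<and> T \<le> l \<and>
         (\<tau> \<cdot>\<^sub>m sample_deviation d n b s \<phi>) *\<^sub>v u = l \<cdot>\<^sub>v u} * (exp T - 1 - T)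
    \<le> measure_pmf.prob (uniform_sampling n s) {\<phi>. large_eigenvalue s T \<phi>} * (exp T - 1 - T)"
    by (rule mult_right_mono)
  also have "\<dots> \<le> family_trace d ?S * exp (3 * \<tau>\<^sup>2 * M * real s)"
    by (rule large_eigenvalue_prob[OF T])
  also have "family_trace d ?S = mat_trace (mean_outer d n b)"
    by (simp add: family_trace_def cS)
  finally show ?thesis .
qed

section \<open>The spectral theorem for real symmetric matrices\<close>

lemma symmetric_scalar_prod:
  assumes "A \<in> carrier_mat d d" "A\<^sup>T = A" "u \<in> carrier_vec d" "v \<in> carrier_vec d"
  shows "(A *\<^sub>v u) \<bullet> v = u \<bullet> (A *\<^sub>v (v :: real vec))"
  using transpose_vec_mult_scalar[of A d d v u] assms by simp

lemma mult_mat_vec_index: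
  assumes "A \<in> carrier_mat d d" "v \<in> carrier_vec d" "i < d"
  shows "(A *\<^sub>v v) $ i = (\<Sum>k<d. A $$ (i, k) * v $ k)"
  using assms by (auto simp: mult_mat_vec_def scalar_prod_def atLeast0LessThan intro!: sum.cong)

text \<open>Complexification provides an eigenvector \<open>a + i b\<close>. Symmetry of
  \<open>A\<close> between its real and imaginary parts forces the eigenvalue to be real, and then
  whichever of \<open>a\<close>, \<open>b\<close> is nonzero is a real eigenvector.\<close>

lemma symmetric_eigenvector:
  fixes A :: "real mat"
  assumes A: "A \<in> carrier_mat d d" "A\<^sup>T = A" and d: "0 < d"
  shows "\<exists>u\<in>carrier_vec d. \<exists>l. u \<bullet> u = 1 \<and> A *\<^sub>v u = l \<cdot>\<^sub>v u"
proof -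
  define C where "C = map_mat complex_of_real A"
  have C: "C \<in> carrier_mat d d" using A by (simp add: C_def)
  from spectrum_non_empty[OF C] d obtain z v where
    v: "v \<in> carrier_vec d" "v \<noteq> 0\<^sub>v d" "C *\<^sub>v v = z \<cdot>\<^sub>v v"
    using C by (auto simp: spectrum_def eigenvalue_def eigenvector_def)
  define a b where "a = map_vec Re v" and "b = map_vec Im v"
  have ab: "a \<in> carrier_vec d" "b \<in> carrier_vec d" using v(1) by (auto simp: a_def b_def)
  have ent: "(\<Sum>k<d. complex_of_real (A $$ (i, k)) * v $ k) = z * v $ i" if "i < d" for i
  proof -
    have "(C *\<^sub>v v) $ i = (\<Sum>k<d. complex_of_real (A $$ (i, k)) * v $ k)"
      using C A v(1) that
      by (auto simp: mult_mat_vec_def scalar_prod_def atLeast0LessThan C_def intro!: sum.cong)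
    then show ?thesis using v that by simp
  qed
  have Aa: "A *\<^sub>v a = Re z \<cdot>\<^sub>v a - Im z \<cdot>\<^sub>v b"
  proof (rule eq_vecI)
    fix i assume "i < dim_vec (Re z \<cdot>\<^sub>v a - Im z \<cdot>\<^sub>v b)"
    then have i: "i < d" using ab by auto
    show "(A *\<^sub>v a) $ i = (Re z \<cdot>\<^sub>v a - Im z \<cdot>\<^sub>v b) $ i"
      using arg_cong[OF ent[OF i], of Re] i ab v(1)
      unfolding mult_mat_vec_index[OF A(1) ab(1) i] by (simp add: a_def b_def)
  qed (use A ab in auto)
  have Ab: "A *\<^sub>v b = Re z \<cdot>\<^sub>v b + Im z \<cdot>\<^sub>v a"
  proof (rule eq_vecI)
    fix i assume "i < dim_vec (Re z \<cdot>\<^sub>v b + Im z \<cdot>\<^sub>v a)"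
    then have i: "i < d" using ab by auto
    show "(A *\<^sub>v b) $ i = (Re z \<cdot>\<^sub>v b + Im z \<cdot>\<^sub>v a) $ i"
      using arg_cong[OF ent[OF i], of Im] i ab v(1)
      unfolding mult_mat_vec_index[OF A(1) ab(2) i] by (simp add: a_def b_def)
  qed (use A ab in auto)
  have "(A *\<^sub>v a) \<bullet> b = a \<bullet> (A *\<^sub>v b)" by (rule symmetric_scalar_prod[OF A ab])
  then have "Im z * (a \<bullet> a + b \<bullet> b) = 0"
    using ab unfolding Aa Ab
    by (simp add: minus_scalar_prod_distrib[of _ d] scalar_prod_add_distrib[of _ d]
        comm_scalar_prod[of a d b] algebra_simps)
  moreover have "a \<bullet> a + b \<bullet> b \<noteq> 0"
  proof
    assume "a \<bullet> a + b \<bullet> b = 0"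
    then have "(\<Sum>i<d. (a $ i)\<^sup>2 + (b $ i)\<^sup>2) = 0"
      using ab by (simp add: scalar_prod_def atLeast0LessThan sum.distrib power2_eq_square)
    then have "\<forall>i\<in>{..<d}. (a $ i)\<^sup>2 + (b $ i)\<^sup>2 = 0"
      by (subst (asm) sum_nonneg_eq_0_iff) auto
    then have "v = 0\<^sub>v d"
      using v(1) by (intro eq_vecI) (auto simp: a_def b_def complex_eq_iff)
    with v(2) show False by simp
  qed
  ultimately have z: "Im z = 0" by simp
  have norm: ?thesis if w: "w \<in> carrier_vec d" "A *\<^sub>v w = Re z \<cdot>\<^sub>v w" "w \<bullet> w \<noteq> 0" for w
  proof -
    have pos: "0 < w \<bullet> w"
      using w(3) by (simp add: scalar_prod_def order_less_le sum_nonneg)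
    let ?u = "(1 / sqrt (w \<bullet> w)) \<cdot>\<^sub>v w"
    have "?u \<bullet> ?u = 1" using pos w(1) by simp
    moreover have "A *\<^sub>v ?u = Re z \<cdot>\<^sub>v ?u"
      using w A by (simp add: mult_mat_vec smult_smult_assoc mult.commute)
    ultimately show ?thesis using w(1) by (intro bexI[of _ ?u] exI conjI) auto
  qed
  show ?thesis
  proof (cases "a \<bullet> a = 0")
    case True
    with \<open>a \<bullet> a + b \<bullet> b \<noteq> 0\<close> have "b \<bullet> b \<noteq> 0" by simp
    moreover have "A *\<^sub>v b = Re z \<cdot>\<^sub>v b" using Ab z ab by (auto intro!: eq_vecI)
    ultimately show ?thesis using norm ab by blast
  next
    case False
    moreover have "A *\<^sub>v a = Re z \<cdot>\<^sub>v a" using Aa z ab by (auto intro!: eq_vecI)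
    ultimately show ?thesis using norm ab by blast
  qed
qed

text \<open>The reflection along \<open>u - e_0\<close> exchanges the unit vectors
  \<open>e_0\<close> and \<open>u\<close>. It supplies an orthogonal matrix with prescribed first
  column without extending \<open>u\<close> to an orthonormal basis.\<close>

lemma householder_reflection:
  fixes u :: "real vec"
  assumes u: "u \<in> carrier_vec (Suc m)" "u \<bullet> u = 1"
  shows "\<exists>Q\<in>carrier_mat (Suc m) (Suc m). Q\<^sup>T = Q \<and> Q * Q = 1\<^sub>m (Suc m) \<and> col Q 0 = u"
proof (cases "u = unit_vec (Suc m) 0")
  case True
  then show ?thesis by (intro bexI[of _ "1\<^sub>m (Suc m)"]) auto
next
  case False
  let ?d = "Suc m"
  define w where "w i = u $ i - (if i = 0 then 1 else 0)" for i
  define W where "W = (\<Sum>i<?d. w i * w i)"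
  have uu: "(\<Sum>i<?d. u $ i * u $ i) = 1"
    using u by (simp add: scalar_prod_def atLeast0LessThan)
  \<comment> \<open>This uses the unit length of \<open>u\<close> and is the reason why column 0
    comes out as \<open>u\<close>.\<close>
  have W: "W = - 2 * w 0"
  proof -
    have "W = (\<Sum>i<?d. u $ i * u $ i - 2 * (if i = 0 then u $ i else 0) + (if i = 0 then 1 else 0))"
      unfolding W_def by (intro sum.cong) (auto simp: w_def algebra_simps)
    also have "\<dots> = 2 - 2 * u $ 0"
      using uu by (simp add: sum.distrib sum_subtractf flip: sum_distrib_left)
    finally show ?thesis by (simp add: w_def)
  qed
  have W0: "W \<noteq> 0"
  proof
    assume "W = 0"
    then have "\<forall>i\<in>{..<?d}. w i * w i = 0"
      unfolding W_def by (subst (asm) sum_nonneg_eq_0_iff) auto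
    then have "u = unit_vec ?d 0"
      using u(1) by (intro eq_vecI) (auto simp: w_def unit_vec_def)
    with False show False by simp
  qed
  define c where "c = 2 / W"
  define Q where "Q = mat ?d ?d (\<lambda>(i, k). (if i = k then 1 else 0) - c * (w i * w k))"
  have "Q \<in> carrier_mat ?d ?d" by (simp add: Q_def)
  moreover have "Q\<^sup>T = Q" by (auto simp: Q_def mult.commute intro!: eq_matI)
  moreover have "Q * Q = 1\<^sub>m ?d"
  proof (rule eq_matI)
    fix i j assume "i < dim_row (1\<^sub>m ?d :: real mat)" "j < dim_col (1\<^sub>m ?d :: real mat)"
    then have ij: "i < ?d" "j < ?d" by auto
    have "(Q * Q) $$ (i, j) = (\<Sum>k<?d. ((if i = k then 1 else 0) - c * (w i * w k)) *
        ((if k = j then 1 else 0) - c * (w k * w j)))"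
      using ij by (simp add: Q_def scalar_prod_def atLeast0LessThan)
    also have "\<dots> = (\<Sum>k<?d. (if i = k then (if k = j then 1 else 0) else 0)
        - (if i = k then c * (w k * w j) else 0) - (if k = j then c * (w i * w k) else 0)
        + c * c * (w i * w j) * (w k * w k))"
      by (intro sum.cong) (auto simp: algebra_simps)
    also have "\<dots> = (if i = j then 1 else 0) - 2 * c * (w i * w j) + c * c * (w i * w j) * W"
      using ij unfolding W_def by (simp add: sum.distrib sum_subtractf sum_distrib_left del: sum.lessThan_Suc)
    also have "\<dots> = (if i = j then 1 else 0)"
      using W0 by (simp add: c_def)
    finally show "(Q * Q) $$ (i, j) = 1\<^sub>m ?d $$ (i, j)" using ij by simp
  qed (simp_all add: Q_def)
  moreover have "col Q 0 = u"
  proof (rule eq_vecI)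
    fix i assume "i < dim_vec u"
    then have i: "i < ?d" using u(1) by simp
    have "c * w 0 = - 1" using W W0 by (auto simp: c_def)
    then have "c * (w i * w 0) = - w i" by (metis mult.commute mult.left_commute mult_minus1)
    then show "col Q 0 $ i = u $ i" using i by (simp add: Q_def w_def)
  qed (use u(1) in \<open>simp add: Q_def\<close>)
  ultimately show ?thesis by blast
qed

definition diagonal :: "nat \<Rightarrow> (nat \<Rightarrow> real) \<Rightarrow> real mat" where
  "diagonal d f = mat d d (\<lambda>(i, k). if i = k then f i else 0)"

lemma diagonal_carrier [simp]: "diagonal d f \<in> carrier_mat d d"
  by (simp add: diagonal_def)

lemma diagonal_transpose: "(diagonal d f)\<^sup>T = diagonal d f"
  by (auto simp: diagonal_def intro!: eq_matI)

lemma diagonal_mult: "diagonal d f * diagonal d g = diagonal d (\<lambda>i. f i * g i)"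
proof (rule eq_matI)
  fix i j assume "i < dim_row (diagonal d (\<lambda>i. f i * g i))" "j < dim_col (diagonal d (\<lambda>i. f i * g i))"
  then have ij: "i < d" "j < d" by (simp_all add: diagonal_def)
  have "(diagonal d f * diagonal d g) $$ (i, j)
      = (\<Sum>k<d. (if i = k then f i else 0) * (if k = j then g k else 0))"
    using ij by (simp add: diagonal_def scalar_prod_def atLeast0LessThan)
  also have "\<dots> = (\<Sum>k<d. if k = i then (if i = j then f i * g i else 0) else 0)"
    by (intro sum.cong) auto
  finally show "(diagonal d f * diagonal d g) $$ (i, j) = diagonal d (\<lambda>i. f i * g i) $$ (i, j)"
    using ij by (simp add: diagonal_def)
qed (simp_all add: diagonal_def)

lemma diagonal_mult_vec:
  assumes "v \<in> carrier_vec d"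
  shows "diagonal d f *\<^sub>v v = vec d (\<lambda>i. f i * v $ i)"
proof (rule eq_vecI)
  fix i assume "i < dim_vec (vec d (\<lambda>i. f i * v $ i))"
  then have i: "i < d" by simp
  have "(diagonal d f *\<^sub>v v) $ i = (\<Sum>k<d. if k = i then f k * v $ k else 0)"
    unfolding mult_mat_vec_index[OF diagonal_carrier assms i]
    using i by (intro sum.cong) (auto simp: diagonal_def)
  then show "(diagonal d f *\<^sub>v v) $ i = vec d (\<lambda>i. f i * v $ i) $ i" using i by simp
qed (simp add: diagonal_def)

text \<open>Deflation: conjugating by the reflection sends an eigenvector to \<open>e_0\<close>, and
  symmetry then clears the first row as well as the first column, so the induction hypothesis
  applies to the remaining block.\<close>

theorem spectral_theorem:
  fixes A :: "real mat"
  assumes "A \<in> carrier_mat d d" "A\<^sup>T = A"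
  shows "\<exists>U\<in>carrier_mat d d. \<exists>f. U\<^sup>T * U = 1\<^sub>m d \<and> A = U * diagonal d f * U\<^sup>T"
  using assms
proof (induction d arbitrary: A)
  case 0
  then show ?case by (intro bexI[of _ "1\<^sub>m 0"]) (auto intro!: eq_matI)
next
  case (Suc m)
  let ?d = "Suc m"
  obtain u l where u: "u \<in> carrier_vec ?d" "u \<bullet> u = 1" "A *\<^sub>v u = l \<cdot>\<^sub>v u"
    using symmetric_eigenvector[OF Suc.prems] by auto
  obtain Q where Q: "Q \<in> carrier_mat ?d ?d" "Q\<^sup>T = Q" "Q * Q = 1\<^sub>m ?d" "col Q 0 = u"
    using householder_reflection[OF u(1,2)] by blast
  note A = Suc.prems(1)
  note mc = mult_carrier_mat[of _ ?d ?d _ ?d]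
  note as = assoc_mult_mat[of _ ?d ?d _ ?d _ ?d]
  have QQ: "Q * (Q * Z) = Z" if "Z \<in> carrier_mat ?d ?d" for Z
    using that Q(1,3) by (simp flip: as)
  define A' where "A' = Q * A * Q"
  have A': "A' \<in> carrier_mat ?d ?d" using Q(1) A by (simp add: A'_def mc)
  have "A'\<^sup>T = A'"
    using Q(1) A by (simp add: A'_def transpose_mult[of _ ?d ?d _ ?d] mc as Q(2) Suc.prems(2))
  then have sym: "A' $$ (i, k) = A' $$ (k, i)" if "i < ?d" "k < ?d" for i k
    using that A' by (metis carrier_matD index_transpose_mat(1))
  have "col A' 0 = (Q * A) *\<^sub>v col Q 0"
    unfolding A'_def using Q(1) A by (intro col_mult2[of _ ?d ?d]) (auto simp: mc)
  also have "\<dots> = Q *\<^sub>v (A *\<^sub>v u)"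
    using Q(1,4) A u(1) by (simp add: assoc_mult_mat_vec[of _ ?d ?d _ ?d])
  also have "\<dots> = l \<cdot>\<^sub>v (Q *\<^sub>v u)"
    using Q(1) u by (simp add: mult_mat_vec)
  also have "Q *\<^sub>v u = col (Q * Q) 0"
    unfolding Q(4)[symmetric] using Q(1) by (intro col_mult2[of _ ?d ?d, symmetric]) auto
  finally have c0: "col A' 0 = l \<cdot>\<^sub>v unit_vec ?d 0" using Q(3) by simp
  have ent: "A' $$ (i, 0) = (if i = 0 then l else 0)" if "i < ?d" for i
    using arg_cong[OF c0, of "\<lambda>v. v $ i"] that A' by (auto split: if_splits)
  define B where "B = mat m m (\<lambda>(i, k). A' $$ (Suc i, Suc k))"
  have "B\<^sup>T = B" using sym by (auto simp: B_def intro!: eq_matI)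
  then obtain V f where V: "V \<in> carrier_mat m m" "V\<^sup>T * V = 1\<^sub>m m" "B = V * diagonal m f * V\<^sup>T"
    using Suc.IH[of B] by (auto simp: B_def)
  let ?blk = "\<lambda>a M. four_block_mat (a \<cdot>\<^sub>m 1\<^sub>m 1) (0\<^sub>m 1 m) (0\<^sub>m m 1) (M :: real mat)"
  have mult_blk: "?blk a M * ?blk b N = ?blk (a * b) (M * N)"
    if "M \<in> carrier_mat m m" "N \<in> carrier_mat m m" for a b M N
    using that
    by (subst mult_four_block_mat[of _ 1 1 _ m _ m _ _ 1 _ m])
       (auto simp: mult_carrier_mat[of _ m m _ m] intro!: arg_cong2[of _ _ _ _ "\<lambda>x y. four_block_mat x _ _ y"] eq_matI)
  have tr_blk: "(?blk a M)\<^sup>T = ?blk a (M\<^sup>T)" if "M \<in> carrier_mat m m" for a M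
    using that by (auto intro!: eq_matI)
  have A'_blk: "A' = ?blk l B"
  proof (rule eq_matI)
    fix i k assume "i < dim_row (?blk l B)" "k < dim_col (?blk l B)"
    then have ik: "i < ?d" "k < ?d" by (auto simp: B_def)
    show "A' $$ (i, k) = ?blk l B $$ (i, k)"
      using ik ent[OF ik(1)] ent[OF ik(2)] sym[OF ik] by (cases i; cases k) (auto simp: B_def)
  qed (use A' in \<open>auto simp: B_def\<close>)
  define W where "W = ?blk 1 V"
  have W: "W \<in> carrier_mat ?d ?d" using V(1) by (auto simp: W_def)
  have D: "?blk l (diagonal m f) = diagonal ?d (case_nat l f)"
    by (intro eq_matI) (auto simp: diagonal_def split: nat.splits)
  have one: "?blk 1 (1\<^sub>m m) = 1\<^sub>m ?d"
    by (intro eq_matI) auto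
  have WW: "W\<^sup>T * W = 1\<^sub>m ?d"
    using V by (simp add: W_def tr_blk mult_blk one del: One_nat_def)
  have WD: "A' = W * diagonal ?d (case_nat l f) * W\<^sup>T"
    using V by (simp add: A'_blk W_def tr_blk mult_blk mult_carrier_mat[of _ m m _ m] del: One_nat_def flip: D)
  define U where "U = Q * W"
  have U: "U \<in> carrier_mat ?d ?d" using Q(1) W by (simp add: U_def mc)
  have UT: "U\<^sup>T = W\<^sup>T * Q" using Q(1,2) W by (simp add: U_def transpose_mult[of _ ?d ?d _ ?d])
  have "U\<^sup>T * U = 1\<^sub>m ?d"
    unfolding UT unfolding U_def using Q(1) W by (simp add: as mc QQ WW)
  moreover have "A = U * diagonal ?d (case_nat l f) * U\<^sup>T"
  proof -
    have "U * diagonal ?d (case_nat l f) * U\<^sup>T = Q * (W * diagonal ?d (case_nat l f) * W\<^sup>T) * Q"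
      unfolding UT unfolding U_def using Q(1) W by (simp add: as mc)
    also have "\<dots> = A"
      unfolding WD[symmetric] A'_def using Q(1,3) A by (simp add: as mc QQ)
    finally show ?thesis by simp
  qed
  ultimately show ?case using U by blast
qed

section \<open>Functions of symmetric matrices and the Newton error\<close>

lemma vnorm_nonneg [simp]: "0 \<le> vnorm v"
  by (simp add: vnorm_def scalar_prod_self_nonneg)

lemma vnorm_sq: "(vnorm v)\<^sup>2 = v \<bullet> v"
  by (simp add: vnorm_def scalar_prod_self_nonneg)

lemma vnorm_smult: "vnorm (c \<cdot>\<^sub>v v) = \<bar>c\<bar> * vnorm v"
proof -
  have "(c \<cdot>\<^sub>v v) \<bullet> (c \<cdot>\<^sub>v v) = c\<^sup>2 * (v \<bullet> v)"
    by (simp add: scalar_prod_def sum_distrib_left power2_eq_square mult_ac)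
  then show ?thesis by (simp add: vnorm_def real_sqrt_mult)
qed

lemma vec_cauchy_schwarz:
  assumes "u \<in> carrier_vec d" "v \<in> carrier_vec d"
  shows "\<bar>u \<bullet> v\<bar> \<le> vnorm u * vnorm v"
proof -
  have "(u \<bullet> v)\<^sup>2 \<le> (u \<bullet> u) * (v \<bullet> v)"
    using Cauchy_Schwarz_ineq_sum[of "\<lambda>i. u $ i" "\<lambda>i. v $ i" "{0..<d}"] assms
    by (simp add: scalar_prod_def power2_eq_square)
  then have "\<bar>u \<bullet> v\<bar>\<^sup>2 \<le> (vnorm u * vnorm v)\<^sup>2"
    by (simp add: power_mult_distrib vnorm_sq)
  then show ?thesis by (rule power2_le_imp_le) simp
qed

lemma vnorm_triangle:
  assumes "u \<in> carrier_vec d" "v \<in> carrier_vec d"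
  shows "vnorm (u + v) \<le> vnorm u + vnorm v"
proof -
  have "(u + v) \<bullet> (u + v) = u \<bullet> u + 2 * (u \<bullet> v) + v \<bullet> v"
    using assms by (simp add: scalar_prod_def algebra_simps sum.distrib sum_distrib_left)
  then have "(vnorm (u + v))\<^sup>2 \<le> (vnorm u + vnorm v)\<^sup>2"
    using vec_cauchy_schwarz[OF assms] by (simp add: power2_sum vnorm_sq)
  then show ?thesis by (rule power2_le_imp_le) simp
qed

lemma vnorm_triangle_diff:
  assumes "u \<in> carrier_vec d" "v \<in> carrier_vec d"
  shows "vnorm (u - v) \<le> vnorm u + vnorm v"
proof -
  have "u - v = u + (-1) \<cdot>\<^sub>v v" using assms by auto
  then show ?thesis
    using vnorm_triangle[of u d "(-1) \<cdot>\<^sub>v v"] assms by (simp add: vnorm_smult)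
qed

lemma smult_mult_mat_vec:
  assumes "A \<in> carrier_mat d d" "v \<in> carrier_vec d"
  shows "(c \<cdot>\<^sub>m A) *\<^sub>v v = c \<cdot>\<^sub>v (A *\<^sub>v (v :: real vec))"
  using assms by (intro eq_vecI) (auto simp: scalar_prod_def sum_distrib_left mult.assoc)

section \<open>Functional calculus in an orthonormal eigenbasis\<close>

locale orthonormal_frame =
  fixes d :: nat and U :: "real mat"
  assumes U [simp]: "U \<in> carrier_mat d d" and UTU: "U\<^sup>T * U = 1\<^sub>m d"
begin

text \<open>The functional calculus of a fixed eigenbasis: sums, products, roots and inverses become
  pointwise operations on the eigenvalue function.\<close>

definition diag_conj :: "(nat \<Rightarrow> real) \<Rightarrow> real mat" where
  "diag_conj f = U * diagonal d f * U\<^sup>T"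

lemma UT [simp]: "U\<^sup>T \<in> carrier_mat d d"
  by simp

lemma frame_vec [simp]:
  "w \<in> carrier_vec d \<Longrightarrow> U *\<^sub>v w \<in> carrier_vec d"
  "w \<in> carrier_vec d \<Longrightarrow> U\<^sup>T *\<^sub>v w \<in> carrier_vec d"
  using mult_mat_vec_carrier[OF U] mult_mat_vec_carrier[OF UT] by blast+

lemma UUT: "U * U\<^sup>T = 1\<^sub>m d"
  by (rule mat_mult_left_right_inverse[OF UT U UTU])

lemma diag_conj_carrier [simp]: "diag_conj f \<in> carrier_mat d d"
  by (simp add: diag_conj_def mult_carrier_mat[of _ d d _ d])

lemma diag_conj_transpose: "(diag_conj f)\<^sup>T = diag_conj f"
  by (simp add: diag_conj_def transpose_mult[of _ d d _ d] mult_carrier_mat[of _ d d _ d]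
      diagonal_transpose assoc_mult_mat[of _ d d _ d _ d])

lemma diag_conj_mult: "diag_conj f * diag_conj g = diag_conj (\<lambda>i. f i * g i)"
proof -
  note mc = mult_carrier_mat[of _ d d _ d]
  note as = assoc_mult_mat[of _ d d _ d _ d]
  have UZ: "U\<^sup>T * (U * Z) = Z" if "Z \<in> carrier_mat d d" for Z
    using that UTU by (simp flip: as)
  have DZ: "diagonal d f * (diagonal d g * Z) = diagonal d (\<lambda>i. f i * g i) * Z"
    if "Z \<in> carrier_mat d d" for Z
    using that by (simp add: diagonal_mult flip: as)
  show ?thesis by (simp add: diag_conj_def as mc UZ DZ)
qed

lemma diag_conj_cong: "(\<And>i. i < d \<Longrightarrow> f i = g i) \<Longrightarrow> diag_conj f = diag_conj g"
  unfolding diag_conj_def by (intro arg_cong2[of _ _ _ _ "(*)"] refl eq_matI) (auto simp: diagonal_def)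

lemma diag_conj_one: "(\<And>i. i < d \<Longrightarrow> f i = 1) \<Longrightarrow> diag_conj f = 1\<^sub>m d"
proof -
  assume "\<And>i. i < d \<Longrightarrow> f i = 1"
  then have "diagonal d f = 1\<^sub>m d" by (intro eq_matI) (auto simp: diagonal_def)
  then show ?thesis by (simp add: diag_conj_def UUT right_mult_one_mat[OF U])
qed

lemma frame_norm:
  assumes "w \<in> carrier_vec d"
  shows "(U *\<^sub>v w) \<bullet> (U *\<^sub>v w) = w \<bullet> w" "(U\<^sup>T *\<^sub>v w) \<bullet> (U\<^sup>T *\<^sub>v w) = w \<bullet> w"
proof -
  have "(U *\<^sub>v w) \<bullet> (U *\<^sub>v w) = (U\<^sup>T *\<^sub>v (U *\<^sub>v w)) \<bullet> w"
    using assms transpose_vec_mult_scalar[OF U assms, of "U *\<^sub>v w"] by simp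
  also have "U\<^sup>T *\<^sub>v (U *\<^sub>v w) = w"
    using assms UTU by (simp flip: assoc_mult_mat_vec[of _ d d _ d])
  finally show "(U *\<^sub>v w) \<bullet> (U *\<^sub>v w) = w \<bullet> w" .
  have "(U\<^sup>T *\<^sub>v w) \<bullet> (U\<^sup>T *\<^sub>v w) = w \<bullet> (U *\<^sub>v (U\<^sup>T *\<^sub>v w))"
    using assms transpose_vec_mult_scalar[OF U, of "U\<^sup>T *\<^sub>v w" w] by simp
  also have "U *\<^sub>v (U\<^sup>T *\<^sub>v w) = w"
    using assms UUT by (simp flip: assoc_mult_mat_vec[of _ d d _ d])
  finally show "(U\<^sup>T *\<^sub>v w) \<bullet> (U\<^sup>T *\<^sub>v w) = w \<bullet> w" .
qed

lemma diag_conj_norm: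
  assumes v: "v \<in> carrier_vec d"
  shows "(diag_conj f *\<^sub>v v) \<bullet> (diag_conj f *\<^sub>v v) = (\<Sum>i<d. (f i)\<^sup>2 * ((U\<^sup>T *\<^sub>v v) $ i)\<^sup>2)"
    and "v \<bullet> v = (\<Sum>i<d. ((U\<^sup>T *\<^sub>v v) $ i)\<^sup>2)"
proof -
  have y: "U\<^sup>T *\<^sub>v v \<in> carrier_vec d" using v by simp
  have "diag_conj f *\<^sub>v v = U *\<^sub>v (diagonal d f *\<^sub>v (U\<^sup>T *\<^sub>v v))"
    using v by (simp add: diag_conj_def assoc_mult_mat_vec[of _ d d _ d] mult_carrier_mat[of _ d d _ d])
  also have "diagonal d f *\<^sub>v (U\<^sup>T *\<^sub>v v) = vec d (\<lambda>i. f i * (U\<^sup>T *\<^sub>v v) $ i)"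
    by (rule diagonal_mult_vec[OF y])
  finally have "(diag_conj f *\<^sub>v v) \<bullet> (diag_conj f *\<^sub>v v)
      = vec d (\<lambda>i. f i * (U\<^sup>T *\<^sub>v v) $ i) \<bullet> vec d (\<lambda>i. f i * (U\<^sup>T *\<^sub>v v) $ i)"
    using frame_norm(1)[of "vec d (\<lambda>i. f i * (U\<^sup>T *\<^sub>v v) $ i)"] by simp
  then show "(diag_conj f *\<^sub>v v) \<bullet> (diag_conj f *\<^sub>v v) = (\<Sum>i<d. (f i)\<^sup>2 * ((U\<^sup>T *\<^sub>v v) $ i)\<^sup>2)"
    by (simp add: scalar_prod_def atLeast0LessThan power2_eq_square mult_ac)
  show "v \<bullet> v = (\<Sum>i<d. ((U\<^sup>T *\<^sub>v v) $ i)\<^sup>2)"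
    unfolding frame_norm(2)[OF v, symmetric] using v
    by (simp add: scalar_prod_def[of "U\<^sup>T *\<^sub>v v" "U\<^sup>T *\<^sub>v v"] atLeast0LessThan power2_eq_square
        carrier_matD[OF U])
qed

lemma diag_conj_vnorm_le:
  assumes v: "v \<in> carrier_vec d" and f: "\<And>i. i < d \<Longrightarrow> \<bar>f i\<bar> \<le> c" and c: "0 \<le> c"
  shows "vnorm (diag_conj f *\<^sub>v v) \<le> c * vnorm v"
proof -
  have "(f i)\<^sup>2 \<le> c\<^sup>2" if "i < d" for i using f[OF that] c by (simp add: abs_le_square_iff[symmetric])
  then have "(vnorm (diag_conj f *\<^sub>v v))\<^sup>2 \<le> (c * vnorm v)\<^sup>2"
    unfolding power_mult_distrib vnorm_sq diag_conj_norm(1)[OF v] diag_conj_norm(2)[OF v]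
      sum_distrib_left
    by (intro sum_mono mult_right_mono) auto
  then show ?thesis by (rule power2_le_imp_le) (use c in simp)
qed

lemma diag_conj_vnorm_ge:
  assumes v: "v \<in> carrier_vec d" and f: "\<And>i. i < d \<Longrightarrow> c \<le> f i" and c: "0 \<le> c"
  shows "c * vnorm v \<le> vnorm (diag_conj f *\<^sub>v v)"
proof -
  have "c\<^sup>2 \<le> (f i)\<^sup>2" if "i < d" for i using f[OF that] c by (simp add: power_mono)
  then have "(c * vnorm v)\<^sup>2 \<le> (vnorm (diag_conj f *\<^sub>v v))\<^sup>2"
    unfolding power_mult_distrib vnorm_sq diag_conj_norm(1)[OF v] diag_conj_norm(2)[OF v]
      sum_distrib_left
    by (intro sum_mono mult_right_mono) auto
  then show ?thesis by (rule power2_le_imp_le) simp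
qed

lemma col_frame:
  assumes i: "i < d"
  shows "col U i \<in> carrier_vec d" "col U i \<bullet> col U i = 1"
    "diag_conj f *\<^sub>v col U i = f i \<cdot>\<^sub>v col U i"
proof -
  show c: "col U i \<in> carrier_vec d" using i U by (auto intro: col_carrier_vec)
  have e: "col U i = U *\<^sub>v unit_vec d i" using i carrier_matD[OF U] by (intro eq_vecI) auto
  show "col U i \<bullet> col U i = 1"
    unfolding e using i by (subst frame_norm(1)) auto
  have "diag_conj f *\<^sub>v col U i = U *\<^sub>v (diagonal d f *\<^sub>v ((U\<^sup>T * U) *\<^sub>v unit_vec d i))"
    by (simp add: e diag_conj_def assoc_mult_mat_vec[of _ d d _ d] mult_carrier_mat[of _ d d _ d])
  also have "(U\<^sup>T * U) *\<^sub>v unit_vec d i = unit_vec d i" by (simp add: UTU)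
  also have "diagonal d f *\<^sub>v unit_vec d i = f i \<cdot>\<^sub>v unit_vec d i"
    using i by (simp add: diagonal_mult_vec) (auto intro!: eq_vecI)
  also have "U *\<^sub>v (f i \<cdot>\<^sub>v unit_vec d i) = f i \<cdot>\<^sub>v col U i"
    unfolding e by (rule mult_mat_vec[OF U]) simp
  finally show "diag_conj f *\<^sub>v col U i = f i \<cdot>\<^sub>v col U i" .
qed

lemma spectrum_diag_conj: "spectrum (diag_conj f) = f ` {..<d}"
proof (rule equalityI; rule subsetI)
  fix z assume "z \<in> spectrum (diag_conj f)"
  then obtain v where v: "v \<in> carrier_vec d" "v \<noteq> 0\<^sub>v d" "diag_conj f *\<^sub>v v = z \<cdot>\<^sub>v v"
    by (auto simp: spectrum_def eigenvalue_def eigenvector_def carrier_matD[OF diag_conj_carrier])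
  define y where "y = U\<^sup>T *\<^sub>v v"
  have y: "y \<in> carrier_vec d" using v by (simp add: y_def)
  have "vec d (\<lambda>i. f i * y $ i) = diagonal d f *\<^sub>v y"
    by (rule diagonal_mult_vec[OF y, symmetric])
  also have "\<dots> = (U\<^sup>T * U) *\<^sub>v (diagonal d f *\<^sub>v y)"
    using UTU y by (simp add: one_mult_mat_vec[of _ d] mult_mat_vec_carrier[OF diagonal_carrier])
  also have "\<dots> = U\<^sup>T *\<^sub>v (diag_conj f *\<^sub>v v)"
    using v(1) by (simp add: y_def diag_conj_def assoc_mult_mat_vec[of _ d d _ d]
        mult_carrier_mat[of _ d d _ d] mult_mat_vec_carrier[of _ d d])
  also have "\<dots> = z \<cdot>\<^sub>v y" unfolding v(3) y_def by (rule mult_mat_vec[OF UT v(1)])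
  finally have eq: "f i * y $ i = z * y $ i" if "i < d" for i
    using that y arg_cong[of _ _ "\<lambda>w. w $ i"] by (metis carrier_vecD index_smult_vec(1) index_vec)
  have "\<exists>i<d. y $ i \<noteq> 0"
  proof (rule ccontr)
    assume "\<not> (\<exists>i<d. y $ i \<noteq> 0)"
    then have "v \<bullet> v = 0" using diag_conj_norm(2)[OF v(1)] by (simp add: y_def)
    then show False using scalar_prod_self_eq_0 v by blast
  qed
  then show "z \<in> f ` {..<d}" using eq by auto
next
  fix z assume "z \<in> f ` {..<d}"
  then obtain i where i: "i < d" "z = f i" by auto
  have "col U i \<noteq> 0\<^sub>v d" using col_frame(2)[OF i(1)] by auto
  then show "z \<in> spectrum (diag_conj f)"
    using col_frame[OF i(1)] i(2)
    by (auto simp: spectrum_def eigenvalue_def eigenvector_def carrier_matD[OF diag_conj_carrier])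
qed

lemma sing_vals_diag_conj:
  assumes "\<And>i. i < d \<Longrightarrow> 0 \<le> f i"
  shows "sing_vals (diag_conj f) = f ` {..<d}"
  unfolding sing_vals_def diag_conj_transpose diag_conj_mult spectrum_diag_conj image_image
  using assms by (intro image_cong) auto

end

lemma symmetric_decomposition:
  assumes "A \<in> carrier_mat d d" "A\<^sup>T = A"
  obtains U f where "orthonormal_frame d U" "A = orthonormal_frame.diag_conj d U f"
proof -
  obtain U f where "U \<in> carrier_mat d d" "U\<^sup>T * U = 1\<^sub>m d" "A = U * diagonal d f * U\<^sup>T"
    using spectral_theorem[OF assms] by blast
  moreover then have "orthonormal_frame d U" by unfold_locales
  ultimately show ?thesis using that orthonormal_frame.diag_conj_def by metis
qed

lemma symmetric_vnorm_le:
  assumes A: "A \<in> carrier_mat d d" "A\<^sup>T = A" and c: "0 \<le> c"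
    and eig: "\<And>u l. u \<in> carrier_vec d \<Longrightarrow> u \<bullet> u = 1 \<Longrightarrow> A *\<^sub>v u = l \<cdot>\<^sub>v u \<Longrightarrow> \<bar>l\<bar> \<le> c"
    and v: "v \<in> carrier_vec d"
  shows "vnorm (A *\<^sub>v v) \<le> c * vnorm v"
proof -
  obtain U f where U: "orthonormal_frame d U" and AU: "A = orthonormal_frame.diag_conj d U f"
    using symmetric_decomposition[OF A] by blast
  interpret orthonormal_frame d U by (rule U)
  have "\<bar>f i\<bar> \<le> c" if "i < d" for i
    using eig[OF col_frame(1,2)[OF that]] col_frame(3)[OF that] AU by metis
  then show ?thesis unfolding AU using diag_conj_vnorm_le[OF v _ c] by blast
qed

text \<open>Pure arithmetic for the choice of constants. The factor 2 counts the two tails;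
  \<open>K / 16\<close> exceeds \<open>3 * K / 64\<close> by \<open>K / 64\<close>, which is at
  least \<open>3 + ln (D / \<delta>)\<close>.\<close>

lemma exp_tail_estimate:
  fixes D \<delta> K :: real
  assumes D: "0 < D" and \<delta>: "0 < \<delta>" and K: "256 * max 1 (ln (D / \<delta>)) \<le> K"
  shows "2 * (D * exp (3 * K / 64)) \<le> \<delta> * (exp (K / 16) - 1 - K / 16)"
proof -
  define T where "T = K / 16"
  have K1: "256 \<le> K" using K by linarith
  then have T: "2 \<le> T" by (simp add: T_def)
  have "1 + T + T\<^sup>2 / 2 \<le> exp T" using T by (intro exp_lower_Taylor_quadratic) simp
  moreover have "T \<le> T\<^sup>2 / 2" using T by (simp add: power2_eq_square)
  \<comment> \<open>Dropping \<open>1 + T\<close> costs a factor 4; with the two tails this is the 8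
    below, paid for by \<open>exp 3\<close>.\<close>
  ultimately have eT: "exp T \<le> 4 * (exp T - 1 - T)" using T by argo
  have "3 + ln (D / \<delta>) \<le> K / 64" using K by linarith
  then have "exp (3 + ln (D / \<delta>)) \<le> exp (K / 64)" by simp
  then have "exp 3 * (D / \<delta>) \<le> exp (K / 64)" using D \<delta> by (simp add: exp_add)
  moreover have "8 \<le> exp (3::real)" using exp_lower_Taylor_quadratic[of 3] by simp
  ultimately have "8 * (D / \<delta>) \<le> exp (K / 64)"
    using mult_right_mono[of 8 "exp (3::real)" "D / \<delta>"] D \<delta> by simp
  then have "8 * D \<le> \<delta> * exp (K / 64)" using \<delta> by (simp add: field_simps)
  then have "8 * D * exp (3 * K / 64) \<le> \<delta> * exp (K / 64) * exp (3 * K / 64)"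
    by (rule mult_right_mono) simp
  also have "\<dots> = \<delta> * exp T" by (simp add: T_def flip: exp_add)
  also have "\<dots> \<le> \<delta> * (4 * (exp T - 1 - T))" using eT \<delta> by simp
  also have "\<dots> = 4 * (\<delta> * (exp T - 1 - T))" by simp
  finally show ?thesis unfolding T_def by linarith
qed

text \<open>The deviation is symmetric, so its norm is attained at an eigenvalue. The eigenvalue
  bound is used with \<tau> and with \<open>- \<tau>\<close> for the two ends of the spectrum, and
  the failure probabilities are added.\<close>

lemma sample_deviation_norm_prob:
  fixes b :: "nat \<Rightarrow> real vec"
  assumes n: "0 < n" and b: "\<And>j. b j \<in> carrier_vec d"
    and M: "\<And>j. j < n \<Longrightarrow> b j \<bullet> b j \<le> M" and M0: "0 < M"
    and R: "R \<in> carrier_mat d d" "1\<^sub>m d - mean_outer d n b = R * R\<^sup>T"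
    and D: "0 < mat_trace (mean_outer d n b)"
    and \<epsilon>: "0 < \<epsilon>" "\<epsilon> \<le> 4" and \<delta>: "0 < \<delta>"
    and s: "256 * (M / \<epsilon>\<^sup>2) * max 1 (ln (mat_trace (mean_outer d n b) / \<delta>)) \<le> real s"
  shows "1 - \<delta> \<le> measure_pmf.prob (uniform_sampling n s)
    {\<phi>. \<forall>v\<in>carrier_vec d.
       vnorm ((1 / real s) \<cdot>\<^sub>m sample_deviation d n b s \<phi> *\<^sub>v v) \<le> \<epsilon> / 2 * vnorm v}"
proof -
  let ?D = "mat_trace (mean_outer d n b)"
  let ?prob = "measure_pmf.prob (uniform_sampling n s)"
  define K where "K = \<epsilon>\<^sup>2 * real s / M"
  \<comment> \<open>Small enough for the threshold, linear in \<tau>, to beat the growth exponent,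
    quadratic in \<tau>; the bound \<epsilon> \<le> 4 gives the admissibility condition on
    \<tau>.\<close>
  define \<tau> where "\<tau> = \<epsilon> / (8 * M)"
  define T where "T = K / 16"
  have K: "256 * max 1 (ln (?D / \<delta>)) \<le> K"
    using s \<epsilon> M0 by (simp add: K_def field_simps)
  have s0: "0 < s"
  proof (rule ccontr)
    assume "\<not> 0 < s"
    then have "K = 0" by (simp add: K_def)
    with K show False by simp
  qed
  have T: "0 \<le> T" using K by (simp add: T_def)
  have T0: "0 < T" using K by (simp add: T_def)
  have \<tau>: "0 < \<tau>" "2 * M * \<bar>\<tau>\<bar> \<le> 1" using \<epsilon> M0 by (auto simp: \<tau>_def)
  have exponent: "3 * \<tau>\<^sup>2 * M * real s = 3 * K / 64"
    using M0 by (simp add: \<tau>_def K_def power2_eq_square field_simps)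
  have Ts: "\<tau> * real s * (\<epsilon> / 2) = T"
    using M0 by (simp add: \<tau>_def K_def T_def power2_eq_square field_simps)
  let ?bad = "\<lambda>t. {\<phi>. \<exists>u\<in>carrier_vec d. \<exists>l. u \<bullet> u = 1 \<and> T \<le> l \<and>
         (t \<cdot>\<^sub>m sample_deviation d n b s \<phi>) *\<^sub>v u = l \<cdot>\<^sub>v u}"
  let ?good = "{\<phi>. \<forall>v\<in>carrier_vec d.
       vnorm ((1 / real s) \<cdot>\<^sub>m sample_deviation d n b s \<phi> *\<^sub>v v) \<le> \<epsilon> / 2 * vnorm v}"
  have sub: "- ?good \<subseteq> ?bad \<tau> \<union> ?bad (- \<tau>)"
  proof
    fix \<phi> assume "\<phi> \<in> - ?good"
    then obtain v where v: "v \<in> carrier_vec d"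
      "\<not> vnorm ((1 / real s) \<cdot>\<^sub>m sample_deviation d n b s \<phi> *\<^sub>v v) \<le> \<epsilon> / 2 * vnorm v" by auto
    let ?W = "sample_deviation d n b s \<phi>"
    have W: "?W \<in> carrier_mat d d" by (simp add: sample_deviation_def)
    have WT: "((1 / real s) \<cdot>\<^sub>m ?W)\<^sup>T = (1 / real s) \<cdot>\<^sub>m ?W"
      by (auto simp: sample_deviation_def mean_outer_def mult.commute intro!: eq_matI)
    obtain u l where u: "u \<in> carrier_vec d" "u \<bullet> u = 1"
      "(1 / real s) \<cdot>\<^sub>m ?W *\<^sub>v u = l \<cdot>\<^sub>v u" "\<epsilon> / 2 < \<bar>l\<bar>"
      using symmetric_vnorm_le[OF smult_carrier_mat[OF W] WT _ _ v(1), of "\<epsilon> / 2"] v(2) \<epsilon>(1)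
      by (metis less_eq_real_def divide_pos_pos not_le zero_less_numeral)
    have scale: "(t \<cdot>\<^sub>m ?W) *\<^sub>v u = (t * real s * l) \<cdot>\<^sub>v u" for t
    proof -
      have "t \<cdot>\<^sub>m ?W = (t * real s) \<cdot>\<^sub>m ((1 / real s) \<cdot>\<^sub>m ?W)" using s0 by auto
      then have "(t \<cdot>\<^sub>m ?W) *\<^sub>v u = (t * real s) \<cdot>\<^sub>v ((1 / real s) \<cdot>\<^sub>m ?W *\<^sub>v u)"
        using W u(1) by (simp add: smult_mult_mat_vec[of _ d])
      then show ?thesis using u(3) by (simp add: smult_smult_assoc)
    qed
    show "\<phi> \<in> ?bad \<tau> \<union> ?bad (- \<tau>)"
    proof (cases "0 \<le> l")
      case True
      then have "T \<le> \<tau> * real s * l"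
        unfolding Ts[symmetric] using u(4) \<tau> s0 by (intro mult_left_mono) auto
      then have "\<phi> \<in> ?bad \<tau>" using u(1,2) scale by blast
      then show ?thesis by blast
    next
      case False
      then have "T \<le> \<tau> * real s * (- l)"
        unfolding Ts[symmetric] using u(4) \<tau> s0 by (intro mult_left_mono) auto
      then have "T \<le> - \<tau> * real s * l" by simp
      then have "\<phi> \<in> ?bad (- \<tau>)" using u(1,2) scale by blast
      then show ?thesis by blast
    qed
  qed
  have bad: "?prob (?bad t) * (exp T - 1 - T) \<le> ?D * exp (3 * K / 64)" if "t\<^sup>2 = \<tau>\<^sup>2" "2 * M * \<bar>t\<bar> \<le> 1" for t
    using sample_deviation_eigenvalue_prob[OF n b M R that(2) T, of s] exponent that(1) by simp
  have "?prob (- ?good) \<le> ?prob (?bad \<tau> \<union> ?bad (- \<tau>))"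
    by (rule measure_pmf.finite_measure_mono[OF sub]) simp
  also have "\<dots> \<le> ?prob (?bad \<tau>) + ?prob (?bad (- \<tau>))"
    by (rule measure_Un_le) auto
  finally have p: "?prob (- ?good) \<le> ?prob (?bad \<tau>) + ?prob (?bad (- \<tau>))" .
  have e: "0 < exp T - 1 - T"
    using exp_lower_Taylor_quadratic[OF T] T0 zero_less_power[OF T0, of 2] by linarith
  have "?prob (- ?good) * (exp T - 1 - T) \<le> (?prob (?bad \<tau>) + ?prob (?bad (- \<tau>))) * (exp T - 1 - T)"
    using p e by (intro mult_right_mono) auto
  also have "\<dots> \<le> 2 * (?D * exp (3 * K / 64))"
    using bad[of \<tau>] bad[of "- \<tau>"] \<tau> by (simp add: distrib_right)
  also have "\<dots> \<le> \<delta> * (exp T - 1 - T)"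
    using exp_tail_estimate[OF D \<delta> K] by (simp add: T_def)
  finally have "?prob (- ?good) \<le> \<delta>" using e by simp
  then show ?thesis
    using measure_pmf.prob_compl[of ?good "uniform_sampling n s"] by (simp add: Compl_eq_Diff_UNIV)
qed

text \<open>In the coordinates \<open>y = P z\<close> the equation reads
  \<open>(1 + E) y = E P x - Q r\<close> with \<open>Q\<close> the inverse of \<open>P\<close>.
  There \<open>E\<close> is small in norm, and only changing coordinates back costs the root of the
  condition number.\<close>

lemma newton_error_estimate:
  assumes frame: "orthonormal_frame d U"
    and H: "H = orthonormal_frame.diag_conj d U f"
    and P: "P = orthonormal_frame.diag_conj d U (\<lambda>i. sqrt (f i))"
    and f: "\<And>i. i < d \<Longrightarrow> lo \<le> f i \<and> f i \<le> hi" and lo: "0 < lo" "lo \<le> hi"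
    and E: "E \<in> carrier_mat d d" and e: "0 \<le> e" "e < 1"
    and E_le: "\<And>v. v \<in> carrier_vec d \<Longrightarrow> vnorm (E *\<^sub>v v) \<le> e * vnorm v"
    and Ht: "Ht = P * (1\<^sub>m d + E) * P"
    and vec: "z \<in> carrier_vec d" "x \<in> carrier_vec d" "r \<in> carrier_vec d"
    and eq: "Ht *\<^sub>v z = (Ht - H) *\<^sub>v x - r"
  shows "vnorm z \<le> e / (1 - e) * sqrt (hi / lo) * vnorm x + vnorm r / ((1 - e) * lo)"
proof -
  interpret orthonormal_frame d U by (rule frame)
  define Q where "Q = diag_conj (\<lambda>i. 1 / sqrt (f i))"
  have fpos: "0 < f i" if "i < d" for i using f[OF that] lo by linarith
  have Pc [simp]: "P \<in> carrier_mat d d" and Qc [simp]: "Q \<in> carrier_mat d d"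
    by (simp_all add: P Q_def)
  note mv = mult_mat_vec_carrier[of _ d d]
  note as = assoc_mult_mat_vec[of _ d d _ d]
  have QP: "Q * P = 1\<^sub>m d"
    unfolding Q_def P diag_conj_mult using fpos by (intro diag_conj_one) force
  have PP: "P * P = H"
    unfolding P H diag_conj_mult using fpos by (intro diag_conj_cong) (simp add: less_imp_le)
  have QPv: "Q *\<^sub>v (P *\<^sub>v v) = v" if "v \<in> carrier_vec d" for v
    using that QP by (simp flip: as)
  have IE: "(1\<^sub>m d + E) *\<^sub>v v = v + E *\<^sub>v v" if "v \<in> carrier_vec d" for v
    using that E by (simp add: add_mult_distrib_mat_vec[of _ d d])
  have Htv: "Ht *\<^sub>v v = P *\<^sub>v (P *\<^sub>v v + E *\<^sub>v (P *\<^sub>v v))" if "v \<in> carrier_vec d" for v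
    using that E by (simp add: Ht as mv IE mult_carrier_mat[of _ d d _ d])
  have Hv: "H *\<^sub>v v = P *\<^sub>v (P *\<^sub>v v)" if "v \<in> carrier_vec d" for v
    using that by (simp add: as flip: PP)
  define y where "y = P *\<^sub>v z"
  have y: "y \<in> carrier_vec d" using vec by (simp add: y_def mv)
  have Hc: "H \<in> carrier_mat d d" "Ht \<in> carrier_mat d d"
    using E by (simp_all add: H Ht mult_carrier_mat[of _ d d _ d])
  have "P *\<^sub>v (y + E *\<^sub>v y) = P *\<^sub>v (P *\<^sub>v x + E *\<^sub>v (P *\<^sub>v x)) - P *\<^sub>v (P *\<^sub>v x) - r"
    using eq vec Hc by (simp add: Htv Hv y_def minus_mult_distrib_mat_vec[of _ d d])
  also have "P *\<^sub>v (P *\<^sub>v x + E *\<^sub>v (P *\<^sub>v x)) = P *\<^sub>v (P *\<^sub>v x) + P *\<^sub>v (E *\<^sub>v (P *\<^sub>v x))"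
    using vec E by (intro mult_add_distrib_mat_vec[of _ d d]) (auto simp: mv)
  also have "P *\<^sub>v (P *\<^sub>v x) + P *\<^sub>v (E *\<^sub>v (P *\<^sub>v x)) - P *\<^sub>v (P *\<^sub>v x) = P *\<^sub>v (E *\<^sub>v (P *\<^sub>v x))"
    using vec E Pc by (intro eq_vecI) auto
  finally have "P *\<^sub>v (y + E *\<^sub>v y) = P *\<^sub>v (E *\<^sub>v (P *\<^sub>v x)) - r" .
  then have "Q *\<^sub>v (P *\<^sub>v (y + E *\<^sub>v y)) = Q *\<^sub>v (P *\<^sub>v (E *\<^sub>v (P *\<^sub>v x)) - r)" by simp
  then have main: "y + E *\<^sub>v y = E *\<^sub>v (P *\<^sub>v x) - Q *\<^sub>v r"
    using vec E y by (simp add: QPv mv mult_minus_distrib_mat_vec[of _ d d])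
  have "y = (y + E *\<^sub>v y) - E *\<^sub>v y" using y E by auto
  then have "vnorm y \<le> vnorm (y + E *\<^sub>v y) + vnorm (E *\<^sub>v y)"
    using vnorm_triangle_diff[of "y + E *\<^sub>v y" d "E *\<^sub>v y"] y E by (simp add: mv)
  also have "vnorm (y + E *\<^sub>v y) \<le> vnorm (E *\<^sub>v (P *\<^sub>v x)) + vnorm (Q *\<^sub>v r)"
    unfolding main using vec E by (intro vnorm_triangle_diff[of _ d]) (auto simp: mv)
  finally have 1: "(1 - e) * vnorm y \<le> e * vnorm (P *\<^sub>v x) + vnorm (Q *\<^sub>v r)"
    using E_le[OF y] E_le[of "P *\<^sub>v x"] vec by (simp add: mv algebra_simps)
  have 2: "sqrt lo * vnorm z \<le> vnorm y"
    unfolding y_def P using f lo vec by (intro diag_conj_vnorm_ge) auto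
  have 3: "vnorm (P *\<^sub>v x) \<le> sqrt hi * vnorm x"
    unfolding P using f lo vec fpos by (intro diag_conj_vnorm_le) (auto simp: less_imp_le)
  have 4: "vnorm (Q *\<^sub>v r) \<le> 1 / sqrt lo * vnorm r"
    unfolding Q_def using f lo vec fpos
    by (intro diag_conj_vnorm_le) (auto simp: less_imp_le intro!: divide_left_mono)
  have "(1 - e) * (sqrt lo * vnorm z) \<le> e * (sqrt hi * vnorm x) + 1 / sqrt lo * vnorm r"
    using 1 4 mult_left_mono[OF 2, of "1 - e"] mult_left_mono[OF 3, of e] e by linarith
  moreover have "0 < (1 - e) * sqrt lo" using e lo by simp
  ultimately have "vnorm z \<le> (e * (sqrt hi * vnorm x) + 1 / sqrt lo * vnorm r) / ((1 - e) * sqrt lo)"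
    by (simp add: pos_le_divide_eq mult_ac)
  also have "\<dots> = e / (1 - e) * sqrt (hi / lo) * vnorm x + vnorm r / ((1 - e) * lo)"
  proof -
    define q where "q = sqrt lo"
    have q: "0 < q" "lo = q * q" using lo by (simp_all add: q_def)
    show ?thesis
      unfolding real_sqrt_divide q_def[symmetric] unfolding q(2) using e q(1)
      by (simp add: add_divide_distrib mult_ac)
  qed
  finally show ?thesis .
qed

section \<open>Ridge leverage scores\<close>

context orthonormal_frame
begin

lemma diag_conj_add: "diag_conj (\<lambda>i. f i + g i) = diag_conj f + diag_conj g"
proof -
  have "diagonal d (\<lambda>i. f i + g i) = diagonal d f + diagonal d g"
    by (intro eq_matI) (auto simp: diagonal_def)
  then show ?thesis
    by (simp add: diag_conj_def mult_add_distrib_mat[of _ d d _ d] mult_carrier_mat[of _ d d _ d]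
        add_mult_distrib_mat[of _ d d _ _ d])
qed

lemma diag_conj_const: "diag_conj (\<lambda>i. c) = c \<cdot>\<^sub>m 1\<^sub>m d"
proof -
  have "diagonal d (\<lambda>i. c) = c \<cdot>\<^sub>m 1\<^sub>m d" by (intro eq_matI) (auto simp: diagonal_def)
  then show ?thesis
    by (simp add: diag_conj_def mult_smult_distrib[of _ d d _ d] mult_smult_assoc_mat[of _ d d _ d]
        right_mult_one_mat[OF U] UUT)
qed

text \<open>For an invertible matrix the first Penrose equation alone determines the inverse, which
  settles the uniqueness required by the definite description.\<close>

lemma pinv_diag_conj:
  assumes "\<And>i. i < d \<Longrightarrow> f i \<noteq> 0"
  shows "pinv (diag_conj f) = diag_conj (\<lambda>i. 1 / f i)"
proof -
  let ?M = "diag_conj f" and ?N = "diag_conj (\<lambda>i. 1 / f i)"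
  have MN: "?M * ?N = 1\<^sub>m d" and NM: "?N * ?M = 1\<^sub>m d"
    unfolding diag_conj_mult using assms by (auto intro!: diag_conj_one)
  note as = assoc_mult_mat[of _ d d _ d _ d]
  have dims: "dim_row ?M = d" "dim_col ?M = d" using diag_conj_carrier by blast+
  have "is_pinv ?M ?N"
    by (simp add: is_pinv_def dims MN NM left_mult_one_mat[OF diag_conj_carrier])
  moreover have "X = ?N" if "is_pinv ?M X" for X
  proof -
    have X: "X \<in> carrier_mat d d" and eq: "?M * X * ?M = ?M"
      using that by (simp_all add: is_pinv_def dims)
    have "?N * (?M * X * ?M) * ?N = ?N * ?M * X * (?M * ?N)"
      using X by (simp add: as mult_carrier_mat[of _ d d _ d])
    also have "\<dots> = X" using X by (simp add: MN NM right_mult_one_mat[of _ d d])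
    finally show ?thesis unfolding eq
      by (simp add: NM left_mult_one_mat[OF diag_conj_carrier])
  qed
  ultimately show ?thesis unfolding pinv_def by (rule the_equality)
qed

lemma mat_inverse_diag_conj:
  assumes "\<And>i. i < d \<Longrightarrow> f i \<noteq> 0"
  obtains X where "mat_inverse (diag_conj f) = Some X" "X \<in> carrier_mat d d"
    "diag_conj f * X = 1\<^sub>m d"
proof -
  let ?M = "diag_conj f" and ?N = "diag_conj (\<lambda>i. 1 / f i)"
  have MN: "?M * ?N = 1\<^sub>m d" and NM: "?N * ?M = 1\<^sub>m d"
    unfolding diag_conj_mult using assms by (auto intro!: diag_conj_one)
  show ?thesis
  proof (cases "mat_inverse ?M")
    case None
    have "?M \<in> Units (ring_mat TYPE(real) d ())"
      using MN NM diag_conj_carrier unfolding Units_def by (auto simp: ring_mat_def)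
    with mat_inverse(1)[OF diag_conj_carrier None, of "()"] show ?thesis by blast
  next
    case (Some X)
    with mat_inverse(2)[OF diag_conj_carrier Some] that show ?thesis by blast
  qed
qed

end

lemma scaled_sum_product:
  fixes c :: real
  shows "(\<Sum>i\<in>I. \<Sum>k\<in>K. c * (p i * q k)) = c * ((\<Sum>i\<in>I. p i) * (\<Sum>k\<in>K. q k))"
  unfolding sum_product by (simp add: sum_distrib_left)

section \<open>Gram matrices and whitened rows\<close>

text \<open>Index set and scaling are parameters so that one set of lemmas serves the full Hessian,
  the sub-sampled one and their whitened versions.\<close>

definition gram :: "nat \<Rightarrow> nat set \<Rightarrow> real \<Rightarrow> (nat \<Rightarrow> real vec) \<Rightarrow> real mat" where
  "gram d J c a = mat d d (\<lambda>(i, k). c * (\<Sum>j\<in>J. a j $ i * a j $ k))"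

lemma gram_carrier [simp]: "gram d J c a \<in> carrier_mat d d"
  by (simp add: gram_def)

lemma gram_vec [simp]: "v \<in> carrier_vec d \<Longrightarrow> gram d J c a *\<^sub>v v \<in> carrier_vec d"
  by (rule mult_mat_vec_carrier[OF gram_carrier])

lemma gram_transpose: "(gram d J c a)\<^sup>T = gram d J c a"
  by (auto simp: gram_def mult.commute intro!: eq_matI)

lemma gram_bilinear:
  assumes a: "\<And>j. a j \<in> carrier_vec d" and "u \<in> carrier_vec d" "v \<in> carrier_vec d"
  shows "u \<bullet> (gram d J c a *\<^sub>v v) = c * (\<Sum>j\<in>J. (a j \<bullet> u) * (a j \<bullet> v))"
proof -
  have "u \<bullet> (gram d J c a *\<^sub>v v) = (\<Sum>i<d. u $ i * (\<Sum>k<d. c * (\<Sum>j\<in>J. a j $ i * a j $ k) * v $ k))"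
  proof -
    have "(gram d J c a *\<^sub>v v) $ i = (\<Sum>k<d. c * (\<Sum>j\<in>J. a j $ i * a j $ k) * v $ k)" if "i < d" for i
      unfolding mult_mat_vec_index[OF gram_carrier assms(3) that]
      using that by (intro sum.cong) (simp_all add: gram_def)
    then show ?thesis
      using carrier_vecD[OF gram_vec[OF assms(3)]]
      by (simp add: scalar_prod_def[of u] atLeast0LessThan del: index_mult_mat_vec)
  qed
  also have "\<dots> = (\<Sum>i<d. \<Sum>k<d. \<Sum>j\<in>J. c * (a j $ i * u $ i * (a j $ k * v $ k)))"
    by (simp add: sum_distrib_left sum_distrib_right mult_ac)
  also have "\<dots> = (\<Sum>i<d. \<Sum>j\<in>J. \<Sum>k<d. c * (a j $ i * u $ i * (a j $ k * v $ k)))"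
    by (intro sum.cong refl sum.swap)
  also have "\<dots> = (\<Sum>j\<in>J. \<Sum>i<d. \<Sum>k<d. c * (a j $ i * u $ i * (a j $ k * v $ k)))"
    by (rule sum.swap)
  also have "\<dots> = c * (\<Sum>j\<in>J. (a j \<bullet> u) * (a j \<bullet> v))"
    unfolding scaled_sum_product
    using assms by (simp add: scalar_prod_def atLeast0LessThan sum_distrib_left)
  finally show ?thesis .
qed

lemma mat_eqI_bilinear:
  assumes A: "A \<in> carrier_mat d d" and B: "B \<in> carrier_mat d d"
    and eq: "\<And>u v. u \<in> carrier_vec d \<Longrightarrow> v \<in> carrier_vec d \<Longrightarrow>
      u \<bullet> (A *\<^sub>v v) = u \<bullet> (B *\<^sub>v (v :: real vec))"
  shows "A = B"
proof (rule eq_matI)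
  have *: "unit_vec d i \<bullet> (C *\<^sub>v unit_vec d k) = C $$ (i, k)"
    if "C \<in> carrier_mat d d" "i < d" "k < d" for C :: "real mat" and i k
    using that by (simp add: carrier_vecD[OF mult_mat_vec_carrier[OF that(1)]])
  fix i k assume "i < dim_row B" "k < dim_col B"
  then have "i < d" "k < d" using B by auto
  then show "A $$ (i, k) = B $$ (i, k)"
    using eq[of "unit_vec d i" "unit_vec d k"] *[OF A] *[OF B] by simp
qed (use A B in auto)

lemma conj_gram:
  assumes P: "P \<in> carrier_mat d d" "P\<^sup>T = P" and a: "\<And>j. a j \<in> carrier_vec d"
  shows "P * gram d J c a * P = gram d J c (\<lambda>j. P *\<^sub>v a j)"
proof (rule mat_eqI_bilinear)
  fix u v :: "real vec" assume uv: "u \<in> carrier_vec d" "v \<in> carrier_vec d"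
  have Pv: "P *\<^sub>v w \<in> carrier_vec d" if "w \<in> carrier_vec d" for w
    using that P by simp
  have "u \<bullet> ((P * gram d J c a * P) *\<^sub>v v) = u \<bullet> (P *\<^sub>v (gram d J c a *\<^sub>v (P *\<^sub>v v)))"
    using uv P by (simp add: assoc_mult_mat_vec[of _ d d _ d] mult_carrier_mat[of _ d d _ d])
  also have "\<dots> = (P *\<^sub>v u) \<bullet> (gram d J c a *\<^sub>v (P *\<^sub>v v))"
    using uv P by (intro symmetric_scalar_prod[symmetric, of _ d]) auto
  also have "\<dots> = c * (\<Sum>j\<in>J. (a j \<bullet> (P *\<^sub>v u)) * (a j \<bullet> (P *\<^sub>v v)))"
    using uv Pv by (intro gram_bilinear a) auto
  also have "\<dots> = c * (\<Sum>j\<in>J. ((P *\<^sub>v a j) \<bullet> u) * ((P *\<^sub>v a j) \<bullet> v))"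
    using uv by (simp add: symmetric_scalar_prod[OF P a])
  also have "\<dots> = u \<bullet> (gram d J c (\<lambda>j. P *\<^sub>v a j) *\<^sub>v v)"
    using uv Pv a by (intro gram_bilinear[symmetric]) auto
  finally show "u \<bullet> ((P * gram d J c a * P) *\<^sub>v v) = u \<bullet> (gram d J c (\<lambda>j. P *\<^sub>v a j) *\<^sub>v v)" .
qed (use P in \<open>simp_all add: mult_carrier_mat[of _ d d _ d]\<close>)

text \<open>The lower bound is the Rayleigh quotient at an eigenvector: a weighted sum of squares
  plus \<gamma>. It is used for the full and for the sub-sampled Hessian.\<close>

lemma ridge_gram_decomposition:
  assumes c: "0 \<le> c" and a: "\<And>j. a j \<in> carrier_vec d"
  obtains U f where "orthonormal_frame d U" "\<And>i. i < d \<Longrightarrow> \<gamma> \<le> f i"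
    "gram d J c a + \<gamma> \<cdot>\<^sub>m 1\<^sub>m d = orthonormal_frame.diag_conj d U f"
proof -
  let ?H = "gram d J c a + \<gamma> \<cdot>\<^sub>m 1\<^sub>m d"
  have H: "?H \<in> carrier_mat d d" by simp
  have HT: "?H\<^sup>T = ?H"
    by (simp add: transpose_add[of _ d d] gram_transpose) (auto intro!: eq_matI)
  obtain U f where fr: "orthonormal_frame d U" and HU: "?H = orthonormal_frame.diag_conj d U f"
    using symmetric_decomposition[OF H HT] by blast
  interpret orthonormal_frame d U by (rule fr)
  have "\<gamma> \<le> f i" if i: "i < d" for i
  proof -
    let ?u = "col U i"
    have u: "?u \<in> carrier_vec d" by (rule col_frame(1)[OF i])
    have "f i = ?u \<bullet> (?H *\<^sub>v ?u)"
      unfolding HU col_frame(3)[OF i] using u col_frame(2)[OF i] by simp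
    also have "?H *\<^sub>v ?u = gram d J c a *\<^sub>v ?u + \<gamma> \<cdot>\<^sub>v ?u"
      using u by (simp add: add_mult_distrib_mat_vec[of _ d d] smult_mult_mat_vec[of _ d])
    also have "?u \<bullet> \<dots> = ?u \<bullet> (gram d J c a *\<^sub>v ?u) + \<gamma>"
      using u col_frame(2)[OF i] by (subst scalar_prod_add_distrib[of _ d])
        (auto simp: mult_mat_vec_carrier[OF gram_carrier])
    also have "?u \<bullet> (gram d J c a *\<^sub>v ?u) = c * (\<Sum>j\<in>J. (a j \<bullet> ?u) * (a j \<bullet> ?u))"
      by (rule gram_bilinear[OF a u u])
    finally show ?thesis using c by (simp add: sum_nonneg)
  qed
  then show ?thesis using that fr HU by blast
qed

definition data_row :: "real mat \<Rightarrow> nat \<Rightarrow> real vec" where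
  "data_row A j = vec (dim_col A) (\<lambda>i. A $$ (j, i))"

lemma gram_rows:
  "A \<in> carrier_mat n d \<Longrightarrow> A\<^sup>T * A = gram d {..<n} 1 (data_row A)"
  by (intro eq_matI) (auto simp: gram_def data_row_def scalar_prod_def atLeast0LessThan)

lemma subsampled_hessian_eq:
  "A \<in> carrier_mat n d \<Longrightarrow> subsampled_hessian \<gamma> A s \<phi>
     = gram d {..<s} (1 / real s) (\<lambda>r. data_row A (\<phi> r)) + \<gamma> \<cdot>\<^sub>m 1\<^sub>m d"
  by (intro eq_matI)
     (auto simp: subsampled_hessian_def sampled_rows_def gram_def data_row_def scalar_prod_def
       atLeast0LessThan)

text \<open>Fixes one eigenbasis of the Hessian. The Hessian, its root, the whitening and the mean
  of the whitened rows are then functions of the same commuting calculus.\<close>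

locale ridge_data =
  fixes n d :: nat and \<gamma> :: real and A U :: "real mat" and f :: "nat \<Rightarrow> real"
  assumes n: "0 < n" and \<gamma>: "0 < \<gamma>" and A: "A \<in> carrier_mat n d"
    and frame: "orthonormal_frame d U" and f_ge: "\<And>i. i < d \<Longrightarrow> \<gamma> \<le> f i"
    and H: "gram d {..<n} (1 / real n) (data_row A) + \<gamma> \<cdot>\<^sub>m 1\<^sub>m d = orthonormal_frame.diag_conj d U f"
begin

sublocale orthonormal_frame d U by (rule frame)

definition whitened_row :: "nat \<Rightarrow> real vec" where
  "whitened_row j = diag_conj (\<lambda>i. 1 / sqrt (f i)) *\<^sub>v data_row A j"

lemma f_pos: "i < d \<Longrightarrow> 0 < f i"
  using f_ge \<gamma> by fastforce

lemma f_nonzero: "i < d \<Longrightarrow> f i \<noteq> 0"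
  using f_pos by fastforce

lemma data_row [simp]: "data_row A j \<in> carrier_vec d"
  using A by (auto simp: data_row_def)

lemma whitened_row [simp]: "whitened_row j \<in> carrier_vec d"
  by (simp add: whitened_row_def mult_mat_vec_carrier[OF diag_conj_carrier])

lemma root_whitened_row: "diag_conj (\<lambda>i. sqrt (f i)) *\<^sub>v whitened_row j = data_row A j"
proof -
  have "diag_conj (\<lambda>i. sqrt (f i)) * diag_conj (\<lambda>i. 1 / sqrt (f i)) = 1\<^sub>m d"
    unfolding diag_conj_mult using f_pos by (intro diag_conj_one) force
  then show ?thesis
    unfolding whitened_row_def
    using assoc_mult_mat_vec[OF diag_conj_carrier diag_conj_carrier data_row, symmetric] by simp
qed

lemma gram_data: "gram d {..<n} (1 / real n) (data_row A) = diag_conj (\<lambda>i. f i - \<gamma>)"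
proof -
  have "gram d {..<n} (1 / real n) (data_row A) + \<gamma> \<cdot>\<^sub>m 1\<^sub>m d = diag_conj (\<lambda>i. f i - \<gamma>) + \<gamma> \<cdot>\<^sub>m 1\<^sub>m d"
    using H diag_conj_add[of "\<lambda>i. f i - \<gamma>" "\<lambda>_. \<gamma>"] by (simp add: diag_conj_const)
  then have eq: "(gram d {..<n} (1 / real n) (data_row A) + \<gamma> \<cdot>\<^sub>m 1\<^sub>m d) $$ (i, k)
      = (diag_conj (\<lambda>i. f i - \<gamma>) + \<gamma> \<cdot>\<^sub>m 1\<^sub>m d) $$ (i, k)" for i k by simp
  note dims = carrier_matD[OF diag_conj_carrier] carrier_matD[OF gram_carrier]
  show ?thesis
  proof (rule eq_matI)
    fix i k assume "i < dim_row (diag_conj (\<lambda>i. f i - \<gamma>))" "k < dim_col (diag_conj (\<lambda>i. f i - \<gamma>))"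
    then show "gram d {..<n} (1 / real n) (data_row A) $$ (i, k) = diag_conj (\<lambda>i. f i - \<gamma>) $$ (i, k)"
      using eq[of i k] by (simp add: dims)
  qed (simp_all add: dims)
qed

lemma mean_outer_whitened:
  "mean_outer d n whitened_row = diag_conj (\<lambda>i. (f i - \<gamma>) / f i)"
proof -
  have "mean_outer d n whitened_row = gram d {..<n} (1 / real n) whitened_row"
    by (simp add: mean_outer_def gram_def)
  also have "\<dots> = diag_conj (\<lambda>i. 1 / sqrt (f i)) * gram d {..<n} (1 / real n) (data_row A)
      * diag_conj (\<lambda>i. 1 / sqrt (f i))"
    unfolding whitened_row_def[abs_def]
    by (rule conj_gram[symmetric]) (simp_all add: diag_conj_transpose)
  also have "\<dots> = diag_conj (\<lambda>i. (f i - \<gamma>) / f i)"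
    unfolding gram_data diag_conj_mult using f_pos
    by (intro diag_conj_cong) (simp add: less_imp_le)
  finally show ?thesis .
qed

lemma one_minus_mean_outer: "1\<^sub>m d - mean_outer d n whitened_row = diag_conj (\<lambda>i. \<gamma> / f i)"
proof -
  have "mean_outer d n whitened_row + diag_conj (\<lambda>i. \<gamma> / f i) = 1\<^sub>m d"
    unfolding mean_outer_whitened diag_conj_add[symmetric]
    using f_nonzero by (intro diag_conj_one) (simp add: field_simps)
  then have eq: "(mean_outer d n whitened_row + diag_conj (\<lambda>i. \<gamma> / f i)) $$ (i, k) = 1\<^sub>m d $$ (i, k)" for i k
    by simp
  have dims: "dim_row (mean_outer d n whitened_row) = d" "dim_col (mean_outer d n whitened_row) = d"
    by (simp_all add: mean_outer_def)
  note dims = dims carrier_matD[OF diag_conj_carrier]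
  show ?thesis
  proof (rule eq_matI)
    fix i k assume "i < dim_row (diag_conj (\<lambda>i. \<gamma> / f i))" "k < dim_col (diag_conj (\<lambda>i. \<gamma> / f i))"
    then show "(1\<^sub>m d - mean_outer d n whitened_row) $$ (i, k) = diag_conj (\<lambda>i. \<gamma> / f i) $$ (i, k)"
      using eq[of i k] by (simp add: dims)
  qed (simp_all add: dims)
qed

text \<open>The matrix in the leverage score is \<open>n\<close> times the Hessian, so its inverse
  splits into two equal factors, each of which whitens the row up to the root of
  \<open>n\<close>.\<close>

lemma leverage_eq:
  assumes j: "j < n"
  shows "ridge_leverage \<gamma> A j = (whitened_row j \<bullet> whitened_row j) / real n"
proof -
  have dims: "dim_row A = n" "dim_col A = d" using A by auto
  have row: "row A j = data_row A j"
    using j dims by (intro eq_vecI) (auto simp: data_row_def)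
  have "gram d {..<n} 1 (data_row A) + (real n * \<gamma>) \<cdot>\<^sub>m 1\<^sub>m d
      = real n \<cdot>\<^sub>m (gram d {..<n} (1 / real n) (data_row A) + \<gamma> \<cdot>\<^sub>m 1\<^sub>m d)"
    using n by (intro eq_matI) (auto simp: gram_def distrib_left)
  also have "\<dots> = diag_conj (\<lambda>i. real n * f i)"
    unfolding H using diag_conj_mult[of "\<lambda>_. real n" f]
    by (simp add: diag_conj_const mult_smult_assoc_mat[OF one_carrier_mat diag_conj_carrier]
        left_mult_one_mat[OF diag_conj_carrier])
  finally have eq: "gram d {..<n} 1 (data_row A) + (real n * \<gamma>) \<cdot>\<^sub>m 1\<^sub>m d = diag_conj (\<lambda>i. real n * f i)" .
  have "ridge_leverage \<gamma> A j = data_row A j \<bullet> (diag_conj (\<lambda>i. 1 / (real n * f i)) *\<^sub>v data_row A j)"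
    unfolding ridge_leverage_def row dims gram_rows[OF A] eq
    using n f_nonzero by (subst pinv_diag_conj) auto
  also have "diag_conj (\<lambda>i. 1 / (real n * f i)) =
      diag_conj (\<lambda>i. 1 / sqrt (real n * f i)) * diag_conj (\<lambda>i. 1 / sqrt (real n * f i))"
    unfolding diag_conj_mult using f_pos by (intro diag_conj_cong) (simp add: less_imp_le)
  also have "data_row A j \<bullet> (\<dots> *\<^sub>v data_row A j)
     = (diag_conj (\<lambda>i. 1 / sqrt (real n * f i)) *\<^sub>v data_row A j) \<bullet>
       (diag_conj (\<lambda>i. 1 / sqrt (real n * f i)) *\<^sub>v data_row A j)"
    unfolding assoc_mult_mat_vec[OF diag_conj_carrier diag_conj_carrier data_row]
    by (intro symmetric_scalar_prod[symmetric, of _ d])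
       (simp_all add: diag_conj_transpose mult_mat_vec_carrier[OF diag_conj_carrier])
  also have "\<dots> = (whitened_row j \<bullet> whitened_row j) / real n"
    unfolding whitened_row_def diag_conj_norm(1)[OF data_row] sum_divide_distrib
    using f_pos n by (intro sum.cong) (auto simp: power_divide less_imp_le field_simps)
  finally show ?thesis .
qed

lemma eff_dim_eq: "eff_dim \<gamma> A = mat_trace (mean_outer d n whitened_row)"
proof -
  have "eff_dim \<gamma> A = (\<Sum>j<n. (whitened_row j \<bullet> whitened_row j) / real n)"
    using A by (auto simp: eff_dim_def leverage_eq intro!: sum.cong)
  also have "\<dots> = (\<Sum>j<n. \<Sum>i<d. 1 / real n * (whitened_row j $ i * whitened_row j $ i))"
    by (simp add: scalar_prod_def atLeast0LessThan sum_divide_distrib carrier_vecD[OF whitened_row])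
  also have "\<dots> = (\<Sum>i<d. \<Sum>j<n. 1 / real n * (whitened_row j $ i * whitened_row j $ i))"
    by (rule sum.swap)
  also have "\<dots> = mat_trace (mean_outer d n whitened_row)"
    by (simp add: mat_trace_def mean_outer_def sum_distrib_left)
  finally show ?thesis .
qed

lemma leverage_nonneg: "j < n \<Longrightarrow> 0 \<le> ridge_leverage \<gamma> A j"
  by (simp add: leverage_eq scalar_prod_self_nonneg)

lemma subsampled_hessian_prob:
  assumes \<epsilon>: "0 < \<epsilon>" "\<epsilon> \<le> 4" and \<delta>: "0 < \<delta>"
    and s: "256 * (ridge_coherence \<gamma> A * eff_dim \<gamma> A / \<epsilon>\<^sup>2) * max 1 (ln (eff_dim \<gamma> A / \<delta>)) \<le> real s"
  shows "1 - \<delta> \<le> measure_pmf.prob (uniform_sampling n s)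
    {\<phi>. \<exists>E\<in>carrier_mat d d. (\<forall>v\<in>carrier_vec d. vnorm (E *\<^sub>v v) \<le> \<epsilon> / 2 * vnorm v) \<and>
        subsampled_hessian \<gamma> A s \<phi> =
          diag_conj (\<lambda>i. sqrt (f i)) * (1\<^sub>m d + E) * diag_conj (\<lambda>i. sqrt (f i))}"
    (is "_ \<le> measure_pmf.prob _ ?good")
proof -
  let ?P = "diag_conj (\<lambda>i. sqrt (f i))"
  have nD: "0 \<le> eff_dim \<gamma> A"
    using A by (auto simp: eff_dim_def leverage_nonneg intro!: sum_nonneg)
  have gram_root: "?P * gram d J c (\<lambda>r. whitened_row (\<phi> r)) * ?P = gram d J c (\<lambda>r. data_row A (\<phi> r))"
    for J c \<phi>
    by (subst conj_gram) (simp_all add: diag_conj_transpose root_whitened_row)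
  show ?thesis
  proof (cases "eff_dim \<gamma> A = 0")
    \<comment> \<open>The sample-size condition is vacuous here and even \<open>s = 0\<close> is
      allowed. But all rows vanish, so both Hessians equal \<gamma> times the identity and
      \<open>E = 0\<close> works for every sample.\<close>
    case True
    have lev: "ridge_leverage \<gamma> A j = 0" if "j < n" for j
    proof -
      have "\<forall>j\<in>{..<n}. ridge_leverage \<gamma> A j = 0"
        using True A unfolding eff_dim_def
        by (subst (asm) sum_nonneg_eq_0_iff) (auto simp: leverage_nonneg)
      then show ?thesis using that by simp
    qed
    have zero: "data_row A j = 0\<^sub>v d" if "j < n" for j
    proof -
      have "whitened_row j \<bullet> whitened_row j = 0"
        using lev[OF that] leverage_eq[OF that] n by simp
      then have "whitened_row j = 0\<^sub>v d" using scalar_prod_self_eq_0 whitened_row by blast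
      then have "data_row A j = ?P *\<^sub>v 0\<^sub>v d" using root_whitened_row by metis
      then show ?thesis 
        by (intro eq_vecI) (auto simp: carrier_matD[OF diag_conj_carrier])
    qed
    have PP: "?P * ?P = \<gamma> \<cdot>\<^sub>m 1\<^sub>m d"
    proof -
      have "?P * ?P = diag_conj f"
        unfolding diag_conj_mult using f_pos by (intro diag_conj_cong) (simp add: less_imp_le)
      also have "\<dots> = \<gamma> \<cdot>\<^sub>m 1\<^sub>m d"
        unfolding H[symmetric] by (intro eq_matI) (auto simp: gram_def zero)
      finally show ?thesis .
    qed
    have "\<phi> \<in> ?good" if "\<phi> \<in> set_pmf (uniform_sampling n s)" for \<phi>
    proof -
      have "subsampled_hessian \<gamma> A s \<phi> = \<gamma> \<cdot>\<^sub>m 1\<^sub>m d"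
        unfolding subsampled_hessian_eq[OF A]
        by (intro eq_matI) (auto simp: gram_def zero uniform_sampling_lt[OF n that])
      also have "\<dots> = ?P * (1\<^sub>m d + 0\<^sub>m d d) * ?P"
        by (simp add: PP right_mult_one_mat[OF diag_conj_carrier])
      finally have Hs: "subsampled_hessian \<gamma> A s \<phi> = ?P * (1\<^sub>m d + 0\<^sub>m d d) * ?P" .
      have "vnorm (0\<^sub>m d d *\<^sub>v v) = 0" if "v \<in> carrier_vec d" for v
        using that by (simp add: vnorm_def scalar_prod_def)
      then show ?thesis using Hs \<epsilon> by (auto intro!: bexI[of _ "0\<^sub>m d d"] simp del: right_add_zero_mat)
    qed
    then have "measure_pmf.prob (uniform_sampling n s) ?good = 1"
      by (subst measure_pmf.prob_eq_1) (auto simp: AE_measure_pmf_iff)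
    then show ?thesis using \<delta> by simp
  next
    case False
    with nD have D: "0 < eff_dim \<gamma> A" by simp
    define M where "M = real n * Max (ridge_leverage \<gamma> A ` {..<n})"
    have dimA: "dim_row A = n" using A by auto
    have cohM: "ridge_coherence \<gamma> A * eff_dim \<gamma> A = M"
      using D by (simp add: ridge_coherence_def M_def dimA)
    have lev_le: "ridge_leverage \<gamma> A j \<le> Max (ridge_leverage \<gamma> A ` {..<n})" if "j < n" for j
      using that by (intro Max_ge) auto
    have "eff_dim \<gamma> A \<le> (\<Sum>j<n. Max (ridge_leverage \<gamma> A ` {..<n}))"
      unfolding eff_dim_def dimA by (intro sum_mono lev_le) auto
    then have M0: "0 < M" using D by (simp add: M_def)
    have bM: "whitened_row j \<bullet> whitened_row j \<le> M" if "j < n" for j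
      using lev_le[OF that] n by (simp add: leverage_eq[OF that] M_def field_simps)
    have R: "1\<^sub>m d - mean_outer d n whitened_row
        = diag_conj (\<lambda>i. sqrt (\<gamma> / f i)) * (diag_conj (\<lambda>i. sqrt (\<gamma> / f i)))\<^sup>T"
      unfolding one_minus_mean_outer diag_conj_transpose diag_conj_mult
      using f_pos \<gamma> by (intro diag_conj_cong) (simp add: less_imp_le)
    have s': "256 * (M / \<epsilon>\<^sup>2) * max 1 (ln (mat_trace (mean_outer d n whitened_row) / \<delta>)) \<le> real s"
      using s unfolding cohM by (simp add: eff_dim_eq)
    have s0: "0 < s"
    proof -
      have "0 < 256 * (M / \<epsilon>\<^sup>2) * max 1 (ln (mat_trace (mean_outer d n whitened_row) / \<delta>))"
        using M0 \<epsilon> by simp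
      then show ?thesis using s' by linarith
    qed
    have "1 - \<delta> \<le> measure_pmf.prob (uniform_sampling n s) {\<phi>. \<forall>v\<in>carrier_vec d.
       vnorm ((1 / real s) \<cdot>\<^sub>m sample_deviation d n whitened_row s \<phi> *\<^sub>v v) \<le> \<epsilon> / 2 * vnorm v}"
      using sample_deviation_norm_prob[OF n whitened_row bM M0 diag_conj_carrier R _ \<epsilon> \<delta> s'] D
      by (simp add: eff_dim_eq)
    also have "\<dots> \<le> measure_pmf.prob (uniform_sampling n s) ?good"
    proof (rule measure_pmf.finite_measure_mono)
      show "{\<phi>. \<forall>v\<in>carrier_vec d.
         vnorm ((1 / real s) \<cdot>\<^sub>m sample_deviation d n whitened_row s \<phi> *\<^sub>v v) \<le> \<epsilon> / 2 * vnorm v}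
         \<subseteq> ?good"
      proof
        fix \<phi> assume \<phi>: "\<phi> \<in> {\<phi>. \<forall>v\<in>carrier_vec d.
         vnorm ((1 / real s) \<cdot>\<^sub>m sample_deviation d n whitened_row s \<phi> *\<^sub>v v) \<le> \<epsilon> / 2 * vnorm v}"
        let ?E = "(1 / real s) \<cdot>\<^sub>m sample_deviation d n whitened_row s \<phi>"
        let ?G = "gram d {..<s} (1 / real s) (\<lambda>r. whitened_row (\<phi> r))"
        have E: "?E \<in> carrier_mat d d" by (simp add: sample_deviation_def)
        \<comment> \<open>The mean is subtracted once per draw, so dividing by \<open>s\<close>
          (nonzero by \<open>s0\<close>) removes it exactly once. Conjugation by \<open>?P\<close>
          then turns the first summand into the sampled Gram matrix and the second into \<gamma>
          times the identity.\<close>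
        have "1\<^sub>m d + ?E = ?G + (1\<^sub>m d - mean_outer d n whitened_row)"
          using s0 by (intro eq_matI)
            (auto simp: sample_deviation_def gram_def mean_outer_def sum_subtractf field_simps)
        then have "1\<^sub>m d + ?E = ?G + diag_conj (\<lambda>i. \<gamma> / f i)"
          unfolding one_minus_mean_outer .
        then have "?P * (1\<^sub>m d + ?E) * ?P = ?P * ?G * ?P + ?P * diag_conj (\<lambda>i. \<gamma> / f i) * ?P"
          by (simp add: mult_add_distrib_mat[of _ d d _ d] add_mult_distrib_mat[of _ d d _ _ d]
              mult_carrier_mat[of _ d d _ d])
        also have "?P * ?G * ?P = gram d {..<s} (1 / real s) (\<lambda>r. data_row A (\<phi> r))"
          by (rule gram_root)
        also have "?P * diag_conj (\<lambda>i. \<gamma> / f i) * ?P = diag_conj (\<lambda>_. \<gamma>)"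
          unfolding diag_conj_mult using f_pos
          by (intro diag_conj_cong) (simp add: less_imp_le less_imp_neq[symmetric] field_simps)
        finally have "subsampled_hessian \<gamma> A s \<phi> = ?P * (1\<^sub>m d + ?E) * ?P"
          by (simp add: diag_conj_const subsampled_hessian_eq[OF A])
        then show "\<phi> \<in> ?good" using \<phi> E by blast
      qed
    qed simp
    finally show ?thesis .
  qed
qed

end

section \<open>Gradient and Hessian of the objective\<close>

text \<open>The supremum in \<open>spec_norm\<close> is meaningful only for a set bounded above; the
  Frobenius norm \<open>B\<close> is such a bound. Homogeneity then passes from the unit ball to all
  vectors.\<close>

lemma spec_norm_bound:
  assumes M: "M \<in> carrier_mat d d"
  shows "0 \<le> spec_norm M" and "v \<in> carrier_vec d \<Longrightarrow> vnorm (M *\<^sub>v v) \<le> spec_norm M * vnorm v"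
proof -
  define S where "S = {vnorm (M *\<^sub>v v) | v. v \<in> carrier_vec (dim_col M) \<and> vnorm v \<le> 1}"
  define B where "B = sqrt (\<Sum>i<d. (vnorm (row M i))\<^sup>2)"
  have bound: "vnorm (M *\<^sub>v v) \<le> B * vnorm v" if v: "v \<in> carrier_vec d" for v
  proof -
    have "(vnorm (M *\<^sub>v v))\<^sup>2 = (\<Sum>i<d. (row M i \<bullet> v)\<^sup>2)"
      using M unfolding vnorm_sq by (simp add: scalar_prod_def[of "M *\<^sub>v v"] atLeast0LessThan power2_eq_square)
    also have "\<dots> \<le> (\<Sum>i<d. (vnorm (row M i) * vnorm v)\<^sup>2)"
    proof (rule sum_mono)
      fix i assume "i \<in> {..<d}"
      then have "row M i \<in> carrier_vec d" using M by auto
      then have "\<bar>row M i \<bullet> v\<bar>\<^sup>2 \<le> (vnorm (row M i) * vnorm v)\<^sup>2"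
        using vec_cauchy_schwarz v by (intro power_mono) auto
      then show "(row M i \<bullet> v)\<^sup>2 \<le> (vnorm (row M i) * vnorm v)\<^sup>2" by simp
    qed
    also have "\<dots> = (B * vnorm v)\<^sup>2"
      by (simp add: B_def power_mult_distrib sum_nonneg flip: sum_distrib_right)
    finally show ?thesis by (rule power2_le_imp_le) (simp add: B_def sum_nonneg)
  qed
  have B: "0 \<le> B" by (simp add: B_def sum_nonneg)
  have "bdd_above S"
  proof (rule bdd_aboveI)
    fix y assume "y \<in> S"
    then obtain v where "v \<in> carrier_vec d" "vnorm v \<le> 1" "y = vnorm (M *\<^sub>v v)"
      using M by (auto simp: S_def)
    then show "y \<le> B" using bound[of v] B mult_left_mono[of "vnorm v" 1 B] by simp
  qed
  then have le: "vnorm (M *\<^sub>v v) \<le> spec_norm M" if "v \<in> carrier_vec d" "vnorm v \<le> 1" for v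
    unfolding spec_norm_def S_def[symmetric]
    using that M by (intro cSup_upper) (auto simp: S_def)
  have z: "vnorm (0\<^sub>v d) = 0" by (simp add: vnorm_def)
  show "0 \<le> spec_norm M"
    using order_trans[OF vnorm_nonneg le[of "0\<^sub>v d"]] by (simp add: z)
  show "vnorm (M *\<^sub>v v) \<le> spec_norm M * vnorm v" if v: "v \<in> carrier_vec d"
  proof (cases "vnorm v = 0")
    case True
    then show ?thesis using bound[OF v] by simp
  next
    case False
    then have pos: "0 < vnorm v" using vnorm_nonneg[of v] by linarith
    have "vnorm (M *\<^sub>v ((1 / vnorm v) \<cdot>\<^sub>v v)) \<le> spec_norm M"
      using v pos by (intro le) (auto simp: vnorm_smult)
    then show ?thesis using v pos by (simp add: mult_mat_vec[OF M] vnorm_smult field_simps)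
  qed
qed

text \<open>The second derivative need not be continuous, so the argument is pointwise: if it were
  negative, the first derivative would drop just to the right of \<open>z\<close>, against the sum
  of the tangent inequalities at the two points.\<close>

lemma convex_second_deriv_nonneg:
  fixes h :: "real \<Rightarrow> real"
  assumes conv: "convex_on UNIV h" and d1: "\<And>z. h differentiable at z"
    and d2: "deriv h differentiable at z"
  shows "0 \<le> deriv (deriv h) z"
proof (rule ccontr)
  assume neg: "\<not> 0 \<le> deriv (deriv h) z"
  have D: "(h has_real_derivative deriv h x) (at x)" for x
    using d1 by (simp add: DERIV_deriv_iff_real_differentiable)
  have "(deriv h has_real_derivative deriv (deriv h) z) (at z)"
    using d2 by (simp add: DERIV_deriv_iff_real_differentiable)
  then obtain e where e: "0 < e" "\<And>t. 0 < t \<Longrightarrow> t < e \<Longrightarrow> deriv h (z + t) < deriv h z"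
    using DERIV_neg_dec_right neg by (metis not_le)
  define y where "y = z + e / 2"
  have lt: "deriv h y < deriv h z" using e by (simp add: y_def)
  have tang: "deriv h a * (b - a) \<le> h b - h a" for a b
    using convex_on_imp_above_tangent[OF conv, of a b "deriv h a"] D[of a] by simp
  have "deriv h z * (y - z) + deriv h y * (z - y) \<le> 0" using tang[of z y] tang[of y z] by simp
  then have "(deriv h z - deriv h y) * (y - z) \<le> 0" by (simp add: algebra_simps)
  moreover have "0 < (deriv h z - deriv h y) * (y - z)"
    using lt e by (intro mult_pos_pos) (auto simp: y_def)
  ultimately show False by simp
qed

section \<open>Directional derivatives of the objective\<close>

locale newton_objective =
  fixes n d :: nat and \<gamma> :: real and l :: "nat \<Rightarrow> real \<Rightarrow> real" and x :: "nat \<Rightarrow> real vec"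
  assumes x: "j < n \<Longrightarrow> x j \<in> carrier_vec d"
    and diff1: "j < n \<Longrightarrow> l j differentiable at z"
    and diff2: "j < n \<Longrightarrow> deriv (l j) differentiable at z"
begin

abbreviation F :: "real vec \<Rightarrow> real" where
  "F \<equiv> objective n \<gamma> l x"

text \<open>The weak form of the gradient, as \<open>dir_deriv2\<close> is of the Hessian. With
  these forms all calculus is in one real variable along a line, and coordinates appear only in the
  identification with \<open>gradient\<close> and \<open>hessian\<close>.\<close>

definition dir_deriv :: "real vec \<Rightarrow> real vec \<Rightarrow> real" where
  "dir_deriv w v = 1 / real n * (\<Sum>j<n. deriv (l j) (x j \<bullet> w) * (x j \<bullet> v)) + \<gamma> * (w \<bullet> v)"

definition dir_deriv2 :: "real vec \<Rightarrow> real vec \<Rightarrow> real vec \<Rightarrow> real" where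
  "dir_deriv2 w u v =
     1 / real n * (\<Sum>j<n. deriv (deriv (l j)) (x j \<bullet> w) * (x j \<bullet> u) * (x j \<bullet> v)) + \<gamma> * (u \<bullet> v)"

lemma scalar_prod_line:
  assumes "u \<in> carrier_vec d" "w \<in> carrier_vec d" "v \<in> carrier_vec d"
  shows "u \<bullet> (w + t \<cdot>\<^sub>v v) = u \<bullet> w + t * (u \<bullet> (v :: real vec))"
  using assms by (simp add: scalar_prod_add_distrib[of _ d])

lemma objective_line_deriv:
  assumes w: "w \<in> carrier_vec d" and v: "v \<in> carrier_vec d"
  shows "((\<lambda>t. F (w + t \<cdot>\<^sub>v v)) has_real_derivative dir_deriv w v) (at 0)"
proof -
  have "(w + t \<cdot>\<^sub>v v) \<bullet> (w + t \<cdot>\<^sub>v v) = w \<bullet> w + 2 * t * (w \<bullet> v) + t\<^sup>2 * (v \<bullet> v)" for t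
    using w v by (simp add: scalar_prod_def algebra_simps sum.distrib sum_distrib_left power2_eq_square)
  note ww = this
  have "(\<Sum>j<n. l j (x j \<bullet> (w + t \<cdot>\<^sub>v v))) = (\<Sum>j<n. l j (x j \<bullet> w + t * (x j \<bullet> v)))" for t
    using scalar_prod_line[OF x w v] by (intro sum.cong) simp_all
  then have eq: "F (w + t \<cdot>\<^sub>v v) = 1 / real n * (\<Sum>j<n. l j (x j \<bullet> w + t * (x j \<bullet> v)))
      + \<gamma> / 2 * (w \<bullet> w + 2 * t * (w \<bullet> v) + t\<^sup>2 * (v \<bullet> v))" for t
    unfolding objective_def vnorm_sq ww by simp
  have D: "((\<lambda>t. l j (x j \<bullet> w + t * (x j \<bullet> v))) has_real_derivative
      deriv (l j) (x j \<bullet> w) * (x j \<bullet> v)) (at 0)" if j: "j < n" for j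
  proof -
    have 1: "(l j has_real_derivative deriv (l j) (x j \<bullet> w)) (at (x j \<bullet> w + 0 * (x j \<bullet> v)))"
      using diff1[OF j] by (simp add: DERIV_deriv_iff_real_differentiable)
    have 2: "((\<lambda>t. x j \<bullet> w + t * (x j \<bullet> v)) has_real_derivative x j \<bullet> v) (at 0)"
      by (auto intro!: derivative_eq_intros)
    show ?thesis by (rule DERIV_chain2[OF 1 2])
  qed
  have "((\<lambda>t. 1 / real n * (\<Sum>j<n. l j (x j \<bullet> w + t * (x j \<bullet> v)))
      + \<gamma> / 2 * (w \<bullet> w + 2 * t * (w \<bullet> v) + t\<^sup>2 * (v \<bullet> v))) has_real_derivative
      1 / real n * (\<Sum>j<n. deriv (l j) (x j \<bullet> w) * (x j \<bullet> v)) + \<gamma> * (w \<bullet> v)) (at 0)"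
    by (rule derivative_eq_intros D refl | simp)+
  then show ?thesis unfolding eq dir_deriv_def .
qed

lemma dir_deriv_line_deriv:
  assumes w: "w \<in> carrier_vec d" and u: "u \<in> carrier_vec d" and v: "v \<in> carrier_vec d"
  shows "((\<lambda>t. dir_deriv (w + t \<cdot>\<^sub>v v) u) has_real_derivative dir_deriv2 (w + t \<cdot>\<^sub>v v) u v) (at t)"
proof -
  have "(w + t \<cdot>\<^sub>v v) \<bullet> u = w \<bullet> u + t * (v \<bullet> u)" for t
    using w u v by (simp add: add_scalar_prod_distrib[of _ d])
  note wu = this
  have "(\<Sum>j<n. deriv (l j) (x j \<bullet> (w + t \<cdot>\<^sub>v v)) * (x j \<bullet> u))
      = (\<Sum>j<n. deriv (l j) (x j \<bullet> w + t * (x j \<bullet> v)) * (x j \<bullet> u))" for t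
    using scalar_prod_line[OF x w v] by (intro sum.cong) simp_all
  then have eq: "dir_deriv (w + t \<cdot>\<^sub>v v) u =
      1 / real n * (\<Sum>j<n. deriv (l j) (x j \<bullet> w + t * (x j \<bullet> v)) * (x j \<bullet> u))
      + \<gamma> * (w \<bullet> u + t * (v \<bullet> u))" for t
    unfolding dir_deriv_def wu by simp
  have D: "((\<lambda>t. deriv (l j) (x j \<bullet> w + t * (x j \<bullet> v))) has_real_derivative
      deriv (deriv (l j)) (x j \<bullet> (w + t \<cdot>\<^sub>v v)) * (x j \<bullet> v)) (at t)" if j: "j < n" for j
  proof -
    have 1: "(deriv (l j) has_real_derivative deriv (deriv (l j)) (x j \<bullet> (w + t \<cdot>\<^sub>v v)))
        (at (x j \<bullet> w + t * (x j \<bullet> v)))"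
      using diff2[OF j] x[OF j] w v by (simp add: DERIV_deriv_iff_real_differentiable scalar_prod_line)
    have 2: "((\<lambda>t. x j \<bullet> w + t * (x j \<bullet> v)) has_real_derivative x j \<bullet> v) (at t)"
      by (auto intro!: derivative_eq_intros)
    show ?thesis by (rule DERIV_chain2[OF 1 2])
  qed
  have "((\<lambda>t. 1 / real n * (\<Sum>j<n. deriv (l j) (x j \<bullet> w + t * (x j \<bullet> v)) * (x j \<bullet> u))
      + \<gamma> * (w \<bullet> u + t * (v \<bullet> u))) has_real_derivative
      1 / real n * (\<Sum>j<n. deriv (deriv (l j)) (x j \<bullet> (w + t \<cdot>\<^sub>v v)) * (x j \<bullet> v) * (x j \<bullet> u))
      + \<gamma> * (v \<bullet> u)) (at t)"
    by (rule derivative_eq_intros D refl | simp)+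
  then show ?thesis
    unfolding eq dir_deriv2_def using u v by (simp add: comm_scalar_prod[of u d v] mult_ac)
qed

lemma partial_deriv_eq:
  assumes "w \<in> carrier_vec d" "i < d"
  shows "partial_deriv i F w = dir_deriv w (unit_vec d i)"
  unfolding partial_deriv_def
  using objective_line_deriv[OF assms(1), of "unit_vec d i"] assms by (auto intro: DERIV_imp_deriv)

lemma partial_deriv2_eq:
  assumes w: "w \<in> carrier_vec d" and ik: "i < d" "k < d"
  shows "partial_deriv i (partial_deriv k F) w = dir_deriv2 w (unit_vec d k) (unit_vec d i)"
proof -
  have "partial_deriv i (partial_deriv k F) w
     = deriv (\<lambda>t. dir_deriv (w + t \<cdot>\<^sub>v unit_vec d i) (unit_vec d k)) 0"
    unfolding partial_deriv_def[of i] using w ik by (simp add: partial_deriv_eq)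
  also have "\<dots> = dir_deriv2 (w + 0 \<cdot>\<^sub>v unit_vec d i) (unit_vec d k) (unit_vec d i)"
    using dir_deriv_line_deriv[OF w, of "unit_vec d k" "unit_vec d i" 0] by (intro DERIV_imp_deriv) simp
  also have "w + 0 \<cdot>\<^sub>v unit_vec d i = w" using w by auto
  finally show ?thesis .
qed

lemma gradient_carrier: "w \<in> carrier_vec d \<Longrightarrow> gradient F w \<in> carrier_vec d"
  by (auto simp: gradient_def)

lemma hessian_carrier: "w \<in> carrier_vec d \<Longrightarrow> hessian F w \<in> carrier_mat d d"
  by (auto simp: hessian_def)

lemma gradient_scalar_prod:
  assumes w: "w \<in> carrier_vec d" and u: "u \<in> carrier_vec d"
  shows "u \<bullet> gradient F w = dir_deriv w u"
proof -
  have "u \<bullet> gradient F w = (\<Sum>i<d. u $ i * dir_deriv w (unit_vec d i))"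
    using w u by (simp add: scalar_prod_def gradient_def partial_deriv_eq atLeast0LessThan)
  also have "\<dots> = (\<Sum>i<d. u $ i * (1 / real n * (\<Sum>j<n. deriv (l j) (x j \<bullet> w) * x j $ i) + \<gamma> * w $ i))"
    using w x by (intro sum.cong refl arg_cong2[of _ _ _ _ "(*)"])
      (simp add: dir_deriv_def scalar_prod_right_unit cong: sum.cong)
  also have "\<dots> = (\<Sum>i<d. \<Sum>j<n. 1 / real n * (deriv (l j) (x j \<bullet> w) * (x j $ i * u $ i)))
      + \<gamma> * (\<Sum>i<d. w $ i * u $ i)"
    by (simp add: distrib_left sum.distrib sum_distrib_left mult_ac)
  also have "(\<Sum>i<d. \<Sum>j<n. 1 / real n * (deriv (l j) (x j \<bullet> w) * (x j $ i * u $ i)))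
      = (\<Sum>j<n. \<Sum>i<d. 1 / real n * (deriv (l j) (x j \<bullet> w) * (x j $ i * u $ i)))"
    by (rule sum.swap)
  also have "\<dots> = 1 / real n * (\<Sum>j<n. deriv (l j) (x j \<bullet> w) * (x j \<bullet> u))"
    using u by (simp add: scalar_prod_def[of _ u] atLeast0LessThan sum_distrib_left)
  also have "(\<Sum>i<d. w $ i * u $ i) = w \<bullet> u"
    using u by (simp add: scalar_prod_def atLeast0LessThan)
  finally show ?thesis by (simp add: dir_deriv_def)
qed

lemma hessian_index:
  assumes w: "w \<in> carrier_vec d" and ik: "i < d" "k < d"
  shows "hessian F w $$ (i, k) =
    1 / real n * (\<Sum>j<n. deriv (deriv (l j)) (x j \<bullet> w) * x j $ i * x j $ k) + (if i = k then \<gamma> else 0)"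
proof -
  have "hessian F w $$ (i, k) = dir_deriv2 w (unit_vec d k) (unit_vec d i)"
    using w ik by (simp add: hessian_def partial_deriv2_eq)
  also have "\<dots> = 1 / real n * (\<Sum>j<n. deriv (deriv (l j)) (x j \<bullet> w) * x j $ k * x j $ i)
      + \<gamma> * (unit_vec d k \<bullet> unit_vec d i)"
    using x ik by (simp add: dir_deriv2_def scalar_prod_right_unit cong: sum.cong)
  finally show ?thesis using ik by (simp add: mult_ac)
qed

lemma hessian_bilinear:
  assumes w: "w \<in> carrier_vec d" and u: "u \<in> carrier_vec d" and v: "v \<in> carrier_vec d"
  shows "u \<bullet> (hessian F w *\<^sub>v v) = dir_deriv2 w u v"
proof -
  have Hv: "(hessian F w *\<^sub>v v) $ i = (\<Sum>k<d. (1 / real n * (\<Sum>j<n. deriv (deriv (l j)) (x j \<bullet> w) * x j $ i * x j $ k)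
      + (if i = k then \<gamma> else 0)) * v $ k)" if "i < d" for i
    using that by (simp add: mult_mat_vec_index[OF hessian_carrier[OF w] v] hessian_index[OF w])
  have "u \<bullet> (hessian F w *\<^sub>v v) = (\<Sum>i<d. u $ i * (hessian F w *\<^sub>v v) $ i)"
    using hessian_carrier[OF w] by (simp add: scalar_prod_def[of u] atLeast0LessThan del: index_mult_mat_vec)
  also have "\<dots> = (\<Sum>i<d. \<Sum>k<d. \<Sum>j<n. 1 / real n * deriv (deriv (l j)) (x j \<bullet> w) * ((x j $ i * u $ i) * (x j $ k * v $ k)))
      + (\<Sum>i<d. \<Sum>k<d. if k = i then \<gamma> * (u $ i * v $ k) else 0)"
    unfolding sum.distrib[symmetric]
  proof (intro sum.cong refl)
    fix i assume "i \<in> {..<d}"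
    then have "u $ i * (hessian F w *\<^sub>v v) $ i = (\<Sum>k<d. u $ i * ((1 / real n * (\<Sum>j<n. deriv (deriv (l j)) (x j \<bullet> w) * x j $ i * x j $ k)
      + (if i = k then \<gamma> else 0)) * v $ k))" by (simp add: Hv sum_distrib_left)
    also have "\<dots> = (\<Sum>k<d. (\<Sum>j<n. 1 / real n * deriv (deriv (l j)) (x j \<bullet> w) * ((x j $ i * u $ i) * (x j $ k * v $ k)))
        + (if k = i then \<gamma> * (u $ i * v $ k) else 0))"
      by (intro sum.cong refl) (simp add: distrib_left distrib_right sum_distrib_left sum_distrib_right mult_ac)
    finally show "u $ i * (hessian F w *\<^sub>v v) $ i = (\<Sum>k<d. (\<Sum>j<n. 1 / real n * deriv (deriv (l j)) (x j \<bullet> w) * ((x j $ i * u $ i) * (x j $ k * v $ k)))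
        + (if k = i then \<gamma> * (u $ i * v $ k) else 0))" .
  qed
  also have "(\<Sum>i<d. \<Sum>k<d. \<Sum>j<n. 1 / real n * deriv (deriv (l j)) (x j \<bullet> w) * ((x j $ i * u $ i) * (x j $ k * v $ k)))
     = (\<Sum>i<d. \<Sum>j<n. \<Sum>k<d. 1 / real n * deriv (deriv (l j)) (x j \<bullet> w) * ((x j $ i * u $ i) * (x j $ k * v $ k)))"
    by (intro sum.cong refl sum.swap)
  also have "\<dots> = (\<Sum>j<n. \<Sum>i<d. \<Sum>k<d. 1 / real n * deriv (deriv (l j)) (x j \<bullet> w) * ((x j $ i * u $ i) * (x j $ k * v $ k)))"
    by (rule sum.swap)
  also have "\<dots> = 1 / real n * (\<Sum>j<n. deriv (deriv (l j)) (x j \<bullet> w) * ((\<Sum>i<d. x j $ i * u $ i) * (\<Sum>k<d. x j $ k * v $ k)))"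
    unfolding scaled_sum_product by (simp add: sum_distrib_left mult.assoc)
  also have "\<dots> = 1 / real n * (\<Sum>j<n. deriv (deriv (l j)) (x j \<bullet> w) * (x j \<bullet> u) * (x j \<bullet> v))"
    using u v by (simp add: scalar_prod_def[of _ u] scalar_prod_def[of _ v] atLeast0LessThan mult.assoc)
  also have "(\<Sum>i<d. \<Sum>k<d. if k = i then \<gamma> * (u $ i * v $ k) else 0) = \<gamma> * (u \<bullet> v)"
    using v by (simp add: scalar_prod_def atLeast0LessThan sum_distrib_left)
  finally show ?thesis by (simp add: dir_deriv2_def)
qed

lemma gradient_minimizer_eq_0:
  assumes "is_arg_min F (\<lambda>u. u \<in> carrier_vec d) w" "u \<in> carrier_vec d"
  shows "dir_deriv w u = 0"
proof -
  have w: "w \<in> carrier_vec d" and min: "\<And>y. y \<in> carrier_vec d \<Longrightarrow> F w \<le> F y"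
    using assms(1) by (auto simp: is_arg_min_def not_less)
  have w0: "w + 0 \<cdot>\<^sub>v u = w" using w assms(2) by auto
  show ?thesis
  proof (rule DERIV_local_min[OF objective_line_deriv[OF w assms(2)], of 1])
    show "\<forall>y. \<bar>0 - y\<bar> < 1 \<longrightarrow> F (w + 0 \<cdot>\<^sub>v u) \<le> F (w + y \<cdot>\<^sub>v u)"
      unfolding w0 using w assms(2) by (auto intro!: min)
  qed simp
qed

text \<open>The remainder \<open>r\<close> is tested against itself, so the vector estimate becomes
  a scalar one along the segment from \<open>w0\<close> to \<open>w\<close>. Comparison of
  derivatives replaces integration of the Hessian and keeps the factor 1/2.\<close>

lemma gradient_linearization:
  assumes lip: "\<And>w w'. w \<in> carrier_vec d \<Longrightarrow> w' \<in> carrier_vec d \<Longrightarrow>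
      spec_norm (hessian F w - hessian F w') \<le> L * vnorm (w - w')"
    and w: "w \<in> carrier_vec d" and w0: "w0 \<in> carrier_vec d"
    and crit: "\<And>u. u \<in> carrier_vec d \<Longrightarrow> dir_deriv w0 u = 0"
  shows "vnorm (gradient F w - hessian F w *\<^sub>v (w - w0)) \<le> L / 2 * (vnorm (w - w0))\<^sup>2"
proof -
  let ?H = "hessian F w" and ?v = "w - w0"
  have v: "?v \<in> carrier_vec d" using w w0 by simp
  have Hc: "?H \<in> carrier_mat d d" by (rule hessian_carrier[OF w])
  define r where "r = gradient F w - ?H *\<^sub>v ?v"
  have r: "r \<in> carrier_vec d"
    using gradient_carrier[OF w] mult_mat_vec_carrier[OF Hc v] by (simp add: r_def)
  define c where "c = r \<bullet> (?H *\<^sub>v ?v)"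
  define K where "K = vnorm r * (L * (vnorm ?v)\<^sup>2)"
  \<comment> \<open>No sign of \<open>L\<close> is assumed; it follows from the Lipschitz bound as
    far as it is needed.\<close>
  have L: "0 \<le> L * (vnorm ?v)\<^sup>2"
  proof -
    have "0 \<le> spec_norm (hessian F w - hessian F w0)"
      by (rule spec_norm_bound[of _ d]) (auto simp: hessian_carrier w w0 minus_carrier_mat)
    then have "0 \<le> L * vnorm ?v" using lip[OF w w0] by linarith
    then have "0 \<le> L * vnorm ?v * vnorm ?v" by (rule mult_nonneg_nonneg) simp
    then show ?thesis by (simp add: power2_eq_square mult.assoc)
  qed
  \<comment> \<open>The last term is an antiderivative of \<open>K * (1 - t)\<close>, the Lipschitz
    bound at distance \<open>(1 - t) * vnorm ?v\<close> from \<open>w\<close>. Its value at 1 is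
    \<open>K / 2\<close>.\<close>
  define \<psi> where "\<psi> t = dir_deriv (w0 + t \<cdot>\<^sub>v ?v) r - t * c - K * (t - t\<^sup>2 / 2)" for t
  have "\<psi> 1 \<le> \<psi> 0"
  proof (rule DERIV_nonpos_imp_nonincreasing[of 0 1])
    fix t :: real assume t: "0 \<le> t" "t \<le> 1"
    let ?wt = "w0 + t \<cdot>\<^sub>v ?v"
    have wt: "?wt \<in> carrier_vec d" using w w0 by simp
    have D: "(\<psi> has_real_derivative dir_deriv2 ?wt r ?v - c - K * (1 - t)) (at t)"
      unfolding \<psi>_def
      by (rule derivative_eq_intros dir_deriv_line_deriv[OF w0 r v] refl | simp)+
    have Hd: "hessian F ?wt - ?H \<in> carrier_mat d d"
      using hessian_carrier[OF wt] Hc by (auto simp: minus_carrier_mat)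
    have "dir_deriv2 ?wt r ?v - c = r \<bullet> ((hessian F ?wt - ?H) *\<^sub>v ?v)"
      using hessian_carrier[OF wt] Hc r v
      by (simp add: c_def minus_mult_distrib_mat_vec[of _ d d] scalar_prod_minus_distrib[of _ d]
          hessian_bilinear[OF wt r v])
    also have "\<dots> \<le> vnorm r * vnorm ((hessian F ?wt - ?H) *\<^sub>v ?v)"
      using vec_cauchy_schwarz[OF r mult_mat_vec_carrier[OF Hd v]] by linarith
    also have "\<dots> \<le> vnorm r * ((L * vnorm (?wt - w)) * vnorm ?v)"
    proof (rule mult_left_mono)
      have "vnorm ((hessian F ?wt - ?H) *\<^sub>v ?v) \<le> spec_norm (hessian F ?wt - ?H) * vnorm ?v"
        by (rule spec_norm_bound(2)[OF Hd v])
      also have "\<dots> \<le> (L * vnorm (?wt - w)) * vnorm ?v"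
        by (intro mult_right_mono lip wt w) simp
      finally show "vnorm ((hessian F ?wt - ?H) *\<^sub>v ?v) \<le> (L * vnorm (?wt - w)) * vnorm ?v" .
    qed simp
    also have "?wt - w = (t - 1) \<cdot>\<^sub>v ?v"
      using w w0 by (intro eq_vecI) (auto simp: algebra_simps)
    also have "vnorm r * ((L * vnorm ((t - 1) \<cdot>\<^sub>v ?v)) * vnorm ?v) = K * (1 - t)"
      using t by (simp add: vnorm_smult K_def power2_eq_square)
    finally show "\<exists>D. (\<psi> has_real_derivative D) (at t) \<and> D \<le> 0"
      using D by (intro exI conjI) auto
  qed simp
  moreover have "w0 + 1 \<cdot>\<^sub>v ?v = w" "w0 + 0 \<cdot>\<^sub>v ?v = w0" using w w0 by auto
  ultimately have "dir_deriv w r - c \<le> K / 2"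
    using crit[OF r] by (simp add: \<psi>_def)
  moreover have "r \<bullet> r = dir_deriv w r - c"
    unfolding c_def gradient_scalar_prod[OF w r, symmetric]
    using gradient_carrier[OF w] mult_mat_vec_carrier[OF Hc v] r
    by (simp add: scalar_prod_minus_distrib[of _ d, symmetric] r_def[symmetric])
  ultimately have "vnorm r * vnorm r \<le> vnorm r * (L / 2 * (vnorm ?v)\<^sup>2)"
    using vnorm_sq[of r] by (simp add: K_def power2_eq_square)
  then have "vnorm r \<le> L / 2 * (vnorm ?v)\<^sup>2"
    using L vnorm_nonneg[of r] by (cases "vnorm r = 0") (auto simp: mult_le_cancel_left)
  then show ?thesis by (simp add: r_def)
qed

end

section \<open>The sub-sampled Newton step\<close>

theorem theorem2:
  "\<exists>C>0. \<forall>(n::nat) (d::nat) (x :: nat \<Rightarrow> real vec) (l :: nat \<Rightarrow> real \<Rightarrow> real)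
      (\<gamma>::real) (L::real) (w\<^sub>t :: real vec) (wstar :: real vec)
      (\<epsilon>::real) (\<delta>::real) (s::nat).
     let F = objective n \<gamma> l x;
         A = scaled_data n d l x w\<^sub>t;
         H = hessian F w\<^sub>t
     in
       0 < n \<longrightarrow> 0 < d \<longrightarrow> 0 < \<gamma> \<longrightarrow>
       (\<forall>j<n. x j \<in> carrier_vec d) \<longrightarrow>
       (\<forall>j<n. convex_on UNIV (l j) \<and>
          (\<forall>z. l j differentiable at z) \<and> (\<forall>z. deriv (l j) differentiable at z)) \<longrightarrow>
       (\<forall>w. is_arg_min F (\<lambda>u. u \<in> carrier_vec d) w \<longleftrightarrow> w = wstar) \<longrightarrow>
       (\<forall>w \<in> carrier_vec d. \<forall>w' \<in> carrier_vec d.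
          spec_norm (hessian F w - hessian F w') \<le> L * vnorm (w - w')) \<longrightarrow>
       w\<^sub>t \<in> carrier_vec d \<longrightarrow>
       0 < \<epsilon> \<longrightarrow> \<epsilon> < 1/4 \<longrightarrow> 0 < \<delta> \<longrightarrow> \<delta> < 1 \<longrightarrow>
       real s \<ge> C * (ridge_coherence \<gamma> A * eff_dim \<gamma> A / \<epsilon>\<^sup>2) * max 1 (ln (eff_dim \<gamma> A / \<delta>)) \<longrightarrow>
       measure_pmf.prob (uniform_sampling n s)
         {\<phi>. vnorm (subsampled_newton_step \<gamma> F A s \<phi> w\<^sub>t - wstar)
               \<le> \<epsilon> * sqrt (cond_num H) * vnorm (w\<^sub>t - wstar)
                 + L / sigma_min H * (vnorm (w\<^sub>t - wstar))\<^sup>2}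
       \<ge> 1 - \<delta>"
  unfolding Let_def
proof (intro exI[of _ 256] conjI allI impI)
  fix n d :: nat and x :: "nat \<Rightarrow> real vec" and l :: "nat \<Rightarrow> real \<Rightarrow> real"
    and \<gamma> L :: real and w\<^sub>t wstar :: "real vec" and \<epsilon> \<delta> :: real and s :: nat
  let ?F = "objective n \<gamma> l x" and ?A = "scaled_data n d l x w\<^sub>t"
  assume n: "0 < n" and d: "0 < d" and \<gamma>: "0 < \<gamma>"
    and x: "\<forall>j<n. x j \<in> carrier_vec d"
    and l: "\<forall>j<n. convex_on UNIV (l j) \<and>
          (\<forall>z. l j differentiable at z) \<and> (\<forall>z. deriv (l j) differentiable at z)"
    and min: "\<forall>w. is_arg_min ?F (\<lambda>u. u \<in> carrier_vec d) w \<longleftrightarrow> w = wstar"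
    and lip: "\<forall>w \<in> carrier_vec d. \<forall>w' \<in> carrier_vec d.
          spec_norm (hessian ?F w - hessian ?F w') \<le> L * vnorm (w - w')"
    and wt: "w\<^sub>t \<in> carrier_vec d"
    and \<epsilon>: "0 < \<epsilon>" "\<epsilon> < 1/4" and \<delta>: "0 < \<delta>" "\<delta> < 1"
    and s: "real s \<ge> 256 * (ridge_coherence \<gamma> ?A * eff_dim \<gamma> ?A / \<epsilon>\<^sup>2)
        * max 1 (ln (eff_dim \<gamma> ?A / \<delta>))"
  interpret newton_objective n d \<gamma> l x
    using x l by unfold_locales auto
  let ?H = "hessian ?F w\<^sub>t"
  have A: "?A \<in> carrier_mat n d" by (simp add: scaled_data_def)
  have dr: "data_row ?A j \<in> carrier_vec d" for j using A by (auto simp: data_row_def)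
  obtain U f where frame: "orthonormal_frame d U" and f: "\<And>i. i < d \<Longrightarrow> \<gamma> \<le> f i"
    and HU: "gram d {..<n} (1 / real n) (data_row ?A) + \<gamma> \<cdot>\<^sub>m 1\<^sub>m d = orthonormal_frame.diag_conj d U f"
    by (rule ridge_gram_decomposition[where c = "1 / real n" and J = "{..<n}" and \<gamma> = \<gamma>
          and a = "data_row ?A" and d = d]) (auto intro: dr)
  interpret ridge_data n d \<gamma> ?A U f
    by (rule ridge_data.intro[OF n \<gamma> A frame f HU])
  have H: "?H = diag_conj f"
    unfolding HU[symmetric]
  proof (rule eq_matI)
    fix i k assume "i < dim_row (gram d {..<n} (1 / real n) (data_row ?A) + \<gamma> \<cdot>\<^sub>m 1\<^sub>m d)"
      "k < dim_col (gram d {..<n} (1 / real n) (data_row ?A) + \<gamma> \<cdot>\<^sub>m 1\<^sub>m d)"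
    then have ik: "i < d" "k < d" by auto
    have "deriv (deriv (l j)) (x j \<bullet> w\<^sub>t) * x j $ i * x j $ k
        = data_row ?A j $ i * data_row ?A j $ k" if j: "j < n" for j
    proof -
      \<comment> \<open>Convexity enters here: the square root in \<open>scaled_data\<close> squares
        back to the second derivative only if the latter is nonnegative.\<close>
      have "0 \<le> deriv (deriv (l j)) (x j \<bullet> w\<^sub>t)"
        using l j by (intro convex_second_deriv_nonneg) auto
      then show ?thesis
        using ik j by (simp add: data_row_def scaled_data_def mult_ac)
    qed
    then show "?H $$ (i, k) = (gram d {..<n} (1 / real n) (data_row ?A) + \<gamma> \<cdot>\<^sub>m 1\<^sub>m d) $$ (i, k)"
      using ik by (simp add: hessian_index[OF wt ik] gram_def)
  qed (use hessian_carrier[OF wt] in auto)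
  have sing: "sing_vals ?H = f ` {..<d}"
    unfolding H using f_pos by (intro sing_vals_diag_conj) (simp add: less_imp_le)
  let ?lo = "sigma_min ?H" and ?hi = "sigma_max ?H"
  have bounds: "?lo \<le> f i \<and> f i \<le> ?hi" if "i < d" for i
    unfolding sigma_min_def sigma_max_def sing using that by auto
  have lo: "0 < ?lo"
    unfolding sigma_min_def sing using d f_pos by (subst Min_gr_iff) auto
  have lohi: "?lo \<le> ?hi" using bounds[OF d] by linarith
  have ws: "is_arg_min ?F (\<lambda>u. u \<in> carrier_vec d) wstar" using min by blast
  then have wsc: "wstar \<in> carrier_vec d" by (simp add: is_arg_min_def)
  let ?v = "w\<^sub>t - wstar"
  have v: "?v \<in> carrier_vec d" using wt wsc by simp
  define r where "r = gradient ?F w\<^sub>t - ?H *\<^sub>v ?v"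
  have Hv: "?H *\<^sub>v ?v \<in> carrier_vec d" by (rule mult_mat_vec_carrier[OF hessian_carrier[OF wt] v])
  have r: "r \<in> carrier_vec d" using gradient_carrier[OF wt] Hv by (simp add: r_def)
  have r_le: "vnorm r \<le> L / 2 * (vnorm ?v)\<^sup>2"
    unfolding r_def using lip
    by (intro gradient_linearization wt wsc gradient_minimizer_eq_0[OF ws]) auto
  let ?P = "diag_conj (\<lambda>i. sqrt (f i))"
  have step: "vnorm (subsampled_newton_step \<gamma> ?F ?A s \<phi> w\<^sub>t - wstar)
      \<le> \<epsilon> * sqrt (cond_num ?H) * vnorm ?v + L / ?lo * (vnorm ?v)\<^sup>2"
    if E: "E \<in> carrier_mat d d" "\<forall>v\<in>carrier_vec d. vnorm (E *\<^sub>v v) \<le> \<epsilon> / 2 * vnorm v"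
      and Ht: "subsampled_hessian \<gamma> ?A s \<phi> = ?P * (1\<^sub>m d + E) * ?P" for E \<phi>
  proof -
    let ?Ht = "subsampled_hessian \<gamma> ?A s \<phi>"
    \<comment> \<open>The sub-sampled Hessian has its own eigenbasis, unrelated to \<open>U\<close>;
      it serves only to show invertibility, so that \<open>mat_inverse\<close> returns a
      value.\<close>
    obtain V g where fr: "orthonormal_frame d V" and g: "\<And>i. i < d \<Longrightarrow> \<gamma> \<le> g i"
      and HtV: "?Ht = orthonormal_frame.diag_conj d V g"
      using ridge_gram_decomposition[where c = "1 / real s" and J = "{..<s}" and \<gamma> = \<gamma>
          and d = d and a = "\<lambda>r. data_row ?A (\<phi> r)"]
      unfolding subsampled_hessian_eq[OF A] by (metis data_row divide_nonneg_nonneg of_nat_0_le_iff zero_le_one)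
    have g0: "g i \<noteq> 0" if "i < d" for i using g[OF that] \<gamma> by linarith
    obtain X where X: "mat_inverse ?Ht = Some X" "X \<in> carrier_mat d d" "?Ht * X = 1\<^sub>m d"
      unfolding HtV by (rule orthonormal_frame.mat_inverse_diag_conj[OF fr g0])
    have Htc: "?Ht \<in> carrier_mat d d" unfolding HtV
      by (rule orthonormal_frame.diag_conj_carrier[OF fr])
    let ?g = "gradient ?F w\<^sub>t"
    have gc: "?g \<in> carrier_vec d" by (rule gradient_carrier[OF wt])
    have Xg: "X *\<^sub>v ?g \<in> carrier_vec d" by (rule mult_mat_vec_carrier[OF X(2) gc])
    define z where "z = subsampled_newton_step \<gamma> ?F ?A s \<phi> w\<^sub>t - wstar"
    have swap: "a - b - c = a - c - b" and cancel: "a - b = (a - c) - (b - c)"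
      if "a \<in> carrier_vec d" "b \<in> carrier_vec d" "c \<in> carrier_vec d" for a b c :: "real vec"
      using that by (auto intro!: eq_vecI)
    have z_eq: "z = ?v - X *\<^sub>v ?g"
      unfolding z_def subsampled_newton_step_def X(1) option.sel
      by (rule swap[OF wt Xg wsc])
    have z: "z \<in> carrier_vec d" unfolding z_eq using v Xg by simp
    have "?Ht *\<^sub>v (X *\<^sub>v ?g) = ?g"
      using assoc_mult_mat_vec[OF Htc X(2) gc, symmetric] X(3) gc by simp
    then have "?Ht *\<^sub>v z = ?Ht *\<^sub>v ?v - ?g"
      unfolding z_eq using mult_minus_distrib_mat_vec[OF Htc v Xg] by simp
    also have "\<dots> = (?Ht - ?H) *\<^sub>v ?v - r"
      unfolding minus_mult_distrib_mat_vec[OF Htc hessian_carrier[OF wt] v] r_def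
      by (rule cancel[OF mult_mat_vec_carrier[OF Htc v] gc Hv])
    \<comment> \<open>The new error \<open>z\<close> is driven by the Hessian approximation error
      acting on the old error and by the linearization error \<open>r\<close>, as
      \<open>newton_error_estimate\<close> requires.\<close>
    finally have eq: "?Ht *\<^sub>v z = (?Ht - ?H) *\<^sub>v ?v - r" .
    have e: "0 \<le> \<epsilon> / 2" "\<epsilon> / 2 < 1" using \<epsilon> by auto
    have "vnorm z \<le> \<epsilon> / 2 / (1 - \<epsilon> / 2) * sqrt (?hi / ?lo) * vnorm ?v + vnorm r / ((1 - \<epsilon> / 2) * ?lo)"
      by (rule newton_error_estimate[OF frame H refl bounds lo lohi E(1) e _ Ht z v r eq])
         (use E(2) in auto)
    also have "\<dots> \<le> \<epsilon> * sqrt (?hi / ?lo) * vnorm ?v + L / ?lo * (vnorm ?v)\<^sup>2"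
    proof (rule add_mono)
      have "\<epsilon> / 2 / (1 - \<epsilon> / 2) \<le> \<epsilon>" using \<epsilon> by (simp add: field_simps)
      moreover have "0 \<le> ?hi / ?lo" using lo lohi by simp
      ultimately show "\<epsilon> / 2 / (1 - \<epsilon> / 2) * sqrt (?hi / ?lo) * vnorm ?v \<le> \<epsilon> * sqrt (?hi / ?lo) * vnorm ?v"
        by (intro mult_right_mono) auto
      \<comment> \<open>Bounding \<open>1 - \<epsilon> / 2\<close> below by 1/2 uses up exactly the
        factor 1/2 of the linearization error, so the constant in front of \<open>L\<close> is
        1.\<close>
      have "vnorm r / ((1 - \<epsilon> / 2) * ?lo) \<le> vnorm r / (1 / 2 * ?lo)"
        using \<epsilon> lo by (intro divide_left_mono mult_right_mono mult_pos_pos) auto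
      also have "\<dots> \<le> (L / 2 * (vnorm ?v)\<^sup>2) / (1 / 2 * ?lo)"
        using r_le lo by (intro divide_right_mono) auto
      also have "\<dots> = L / ?lo * (vnorm ?v)\<^sup>2" using lo by (simp add: field_simps)
      finally show "vnorm r / ((1 - \<epsilon> / 2) * ?lo) \<le> L / ?lo * (vnorm ?v)\<^sup>2" .
    qed
    finally show ?thesis by (simp add: z_def cond_num_def)
  qed
  have "1 - \<delta> \<le> measure_pmf.prob (uniform_sampling n s)
    {\<phi>. \<exists>E\<in>carrier_mat d d. (\<forall>v\<in>carrier_vec d. vnorm (E *\<^sub>v v) \<le> \<epsilon> / 2 * vnorm v) \<and>
        subsampled_hessian \<gamma> ?A s \<phi> = ?P * (1\<^sub>m d + E) * ?P}"
    by (rule subsampled_hessian_prob) (use \<epsilon> \<delta> s in auto)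
  also have "\<dots> \<le> measure_pmf.prob (uniform_sampling n s)
         {\<phi>. vnorm (subsampled_newton_step \<gamma> ?F ?A s \<phi> w\<^sub>t - wstar)
               \<le> \<epsilon> * sqrt (cond_num ?H) * vnorm ?v + L / ?lo * (vnorm ?v)\<^sup>2}"
    using step by (intro measure_pmf.finite_measure_mono) auto
  finally show "1 - \<delta> \<le> measure_pmf.prob (uniform_sampling n s)
         {\<phi>. vnorm (subsampled_newton_step \<gamma> ?F ?A s \<phi> w\<^sub>t - wstar)
               \<le> \<epsilon> * sqrt (cond_num ?H) * vnorm ?v + L / ?lo * (vnorm ?v)\<^sup>2}" .
qed simp

end
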